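(* Let $G$ be a triangle-free graph such that every triangle-free graph $J$ with $n(J)<n(G)$, or with $n(J)=n(G)$ and $e(J)<e(G)$, satisfies $\nu(J)\ge 0$, and moreover $J$ is isomorphic to a member of $\mathcal{G}$ whenever $J$ is connected and $\nu(J)=0$. If $\nu(G)\le 0$ and $C$ is a connected component of $G$ that is 3-regular, then $C$ is isomorphic to $(2C_7)_{2i}$ or to $W_5$.
   Context: All graphs are finite, simple and non-empty. For a graph $G$: $n(G)$, $e(G)$, $\alpha(G)$ are the numbers of vertices, edges and the independence number; $\operatorname{N}(C_4;G)$ is the number of cycles of length four in $G$ (as subgraphs); $\nu(G) = 3e(G)-17n(G)+35\alpha(G)+\operatorname{N}(C_4;G)$. Bivalent means of valency (degree) 2. $\mathcal{G} = \{W_5,(2C_7)_{2i}\}\cup\{Ch_k: k\ge2\}\cup\{BC_k:k\ge5\}$, where: $Ch_2$ is the 5-cycle; for $k\ge2$, pick a bivalent vertex $x$ of $Ch_k$ and let $Ch_{k+1}$ be $Ch_k$ with new vertices $v,w_1,w_2$ and new edges $vw_1,vw_2,w_1x$ and $w_2y$ for each $y\in N_{Ch_k}(x)$ (independent of $x$ up to isomorphism). $(2C_7)_{2i}$ has vertices $a_0,\dots,a_6,b_0,\dots,b_6$, two 7-cycles $a_0\cdots a_6$ and $b_0\cdots b_6$, and edges $b_ia_{2i}$, $0\le i\le 6$ (indices mod 7). $W_5$ has vertices $a_0,a_1,b_0,\dots,b_3,c_0,\dots,c_7$, the edge $a_0a_1$, the 8-cycle $c_0\cdots c_7$, and for $i\in\{0,1,2,3\}$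 the edges $b_ia_{i\bmod 2}$, $b_ic_{2i}$, $b_ic_{2i+3}$ ($c$-indices mod 8). $BC_k$ has vertices $c_1,\dots,c_{2k},d_1,\dots,d_k$, the cycles $c_1\cdots c_{2k}$ and $d_1\cdots d_k$, and edges $d_ic_{2i-2}$, $d_ic_{2i+1}$ for $1\le i\le k$ ($c$-indices mod $2k$). *)

theory Defs
  imports Main
begin

datatype 'a graph = Graph (verts: "'a set") (edges: "'a set set")

definition is_graph :: "'a graph \<Rightarrow> bool" where
  "is_graph G \<longleftrightarrow> finite (verts G) \<and> verts G \<noteq> {} \<and>
     (\<forall>e\<in>edges G. e \<subseteq> verts G \<and> card e = 2)"

definition nverts :: "'a graph \<Rightarrow> nat" where
  "nverts G = card (verts G)"

definition nedges :: "'a graph \<Rightarrow> nat" where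
  "nedges G = card (edges G)"

definition nbrs :: "'a graph \<Rightarrow> 'a \<Rightarrow> 'a set" where
  "nbrs G x = {y. {x, y} \<in> edges G}"

definition degree :: "'a graph \<Rightarrow> 'a \<Rightarrow> nat" where
  "degree G x = card (nbrs G x)"

definition regular :: "nat \<Rightarrow> 'a graph \<Rightarrow> bool" where
  "regular d G \<longleftrightarrow> (\<forall>x\<in>verts G. degree G x = d)"

definition triangle_free :: "'a graph \<Rightarrow> bool" where
  "triangle_free G \<longleftrightarrow>
     \<not> (\<exists>x y z. {x, y} \<in> edges G \<and> {y, z} \<in> edges G \<and> {x, z} \<in> edges G)"

definition independent :: "'a graph \<Rightarrow> 'a set \<Rightarrow> bool" where
  "independent G S \<longleftrightarrow> S \<subseteq> verts G \<and> (\<forall>x\<in>S. \<forall>y\<in>S. {x, y} \<notin> edges G)"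

definition alpha :: "'a graph \<Rightarrow> nat" where
  "alpha G = Max (card ` {S. independent G S})"

definition isomorphic :: "'a graph \<Rightarrow> 'b graph \<Rightarrow> bool"  (infix \<open>\<cong>\<close> 50) where
  "G \<cong> H \<longleftrightarrow> (\<exists>f. bij_betw f (verts G) (verts H) \<and>
     (\<forall>x\<in>verts G. \<forall>y\<in>verts G. {x, y} \<in> edges G \<longleftrightarrow> {f x, f y} \<in> edges H))"

definition subgraph :: "'a graph \<Rightarrow> 'a graph \<Rightarrow> bool" where
  "subgraph H G \<longleftrightarrow> is_graph H \<and> verts H \<subseteq> verts G \<and> edges H \<subseteq> edges G"

definition connected :: "'a graph \<Rightarrow> bool" where
  "connected G \<longleftrightarrow>
     (\<forall>x\<in>verts G. \<forall>y\<in>verts G. (x, y) \<in> {(u, v). {u, v} \<in> edges G}\<^sup>*)"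

definition component :: "'a graph \<Rightarrow> 'a graph \<Rightarrow> bool" where
  "component C G \<longleftrightarrow> subgraph C G \<and> connected C \<and>
     (\<forall>D. subgraph D G \<and> connected D \<and> subgraph C D \<longrightarrow> D = C)"

text \<open>Vertex labels: \<open>Va i\<close>, \<open>Vb i\<close>, \<open>Vc i\<close>, \<open>Vd i\<close> stand for
  $a_i$, $b_i$, $c_i$, $d_i$; a cyclic index is represented by its residue in
  $\{0, \ldots, m - 1\}$.\<close>

datatype vertex = Va nat | Vb nat | Vc nat | Vd nat

definition cycle_edges :: "(nat \<Rightarrow> 'a) \<Rightarrow> nat \<Rightarrow> 'a set set" where
  "cycle_edges f m = {{f i, f ((i + 1) mod m)} | i. i < m}"

definition cycle_graph :: "nat \<Rightarrow> vertex graph" where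
  "cycle_graph m = Graph (Vc ` {..<m}) (cycle_edges Vc m)"

definition N_C4 :: "'a graph \<Rightarrow> nat" where
  "N_C4 G = card {K. subgraph K G \<and> K \<cong> cycle_graph 4}"

definition nu :: "'a graph \<Rightarrow> int" where
  "nu G = 3 * int (nedges G) - 17 * int (nverts G) + 35 * int (alpha G) + int (N_C4 G)"

text \<open>\<open>Ch k H\<close> means that \<open>H\<close> arises by the construction of $Ch_k$, for some choice of
  the bivalent vertices and of the names of the new vertices.\<close>

inductive Ch :: "nat \<Rightarrow> vertex graph \<Rightarrow> bool" where
  Ch_base: "Ch 2 (cycle_graph 5)"
| Ch_step: "Ch (Suc k) (Graph (verts H \<union> {v, w1, w2})
      (edges H \<union> {{v, w1}, {v, w2}, {w1, x}} \<union> {{w2, y} | y. y \<in> nbrs H x}))"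
  if "Ch k H" "x \<in> verts H" "degree H x = 2" "distinct [v, w1, w2]"
     "{v, w1, w2} \<inter> verts H = {}"

definition twoC7 :: "vertex graph" where
  "twoC7 = Graph (Va ` {..<7} \<union> Vb ` {..<7})
     (cycle_edges Va 7 \<union> cycle_edges Vb 7 \<union> {{Vb i, Va ((2 * i) mod 7)} | i. i < 7})"

definition W5 :: "vertex graph" where
  "W5 = Graph (Va ` {..<2} \<union> Vb ` {..<4} \<union> Vc ` {..<8})
     ({{Va 0, Va 1}} \<union> cycle_edges Vc 8 \<union>
      {{Vb i, Va (i mod 2)} | i. i < 4} \<union>
      {{Vb i, Vc ((2 * i) mod 8)} | i. i < 4} \<union>
      {{Vb i, Vc ((2 * i + 3) mod 8)} | i. i < 4})"

text \<open>In \<open>BC k\<close>, \<open>Vc 0\<close> is $c_{2k}$ and \<open>Vd 0\<close> is $d_k$.\<close>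

definition BC :: "nat \<Rightarrow> vertex graph" where
  "BC k = Graph (Vc ` {..<2 * k} \<union> Vd ` {..<k})
     (cycle_edges Vc (2 * k) \<union> cycle_edges Vd k \<union>
      {{Vd (i mod k), Vc ((2 * i - 2) mod (2 * k))} | i. 1 \<le> i \<and> i \<le> k} \<union>
      {{Vd (i mod k), Vc ((2 * i + 1) mod (2 * k))} | i. 1 \<le> i \<and> i \<le> k})"

definition family :: "vertex graph set" where
  "family = {W5, twoC7} \<union> {H. \<exists>k\<ge>2. Ch k H} \<union> {BC k | k. k \<ge> 5}"

end

theory Submission
  imports Defs "HOL-Library.Code_Binary_Nat"
begin

text \<open>
  If \<open>C\<close> is a proper part of \<open>G\<close>, then both \<open>C\<close> and the rest of \<open>G\<close> have $\nu \ge 0$, and their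
  sum is at most $\nu(G) \le 0$; so $\nu(C) = 0$, and \<open>C\<close> is one of the cubic members of the family.

  Otherwise \<open>G = C\<close> is connected and cubic.  Deleting the closed neighbourhood \<open>S\<close> of an
  independent set \<open>I\<close> lowers $\alpha$ by at least \<open>card I\<close>, so $\nu(G - S) \ge 0$ yields
  $35 |I| \le 8 |S| + 3 e(S)$.  This local inequality alone, together with the absence of
  triangles, determines \<open>G\<close>: exploring \<open>G\<close> from an edge, one repeatedly branches on a missing
  neighbour of a known vertex, and every branch eventually exhibits a triangle, a violation of the
  inequality, or a copy of one of the two graphs in the conclusion.  The search tree was found by
  computer.  Flattened, it is a sequence of forbidden subgraphs, each of which is excluded with the
  help of the earlier ones.
\<close>

section \<open>Invariance under relabelling\<close>

text \<open>The size of \<open>G\<close> is not bounded beforehand, so the search has to close by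
  itself. Two features make this possible. A pattern records edges known to be present and is silent
  about all others; containing it is therefore a monotone condition, and a pattern settled once
  settles every pattern that contains a copy of it. This shrinks the search tree to a list of 184
  patterns. Moreover, a vertex with three known neighbours has no further ones, so the independence
  of a set and its closed neighbourhood can be read off a pattern although most of \<open>G\<close>
  is unknown.

  "Forbidden" is meant relatively: the two target graphs contain many of the patterns, a single edge
  for instance, so no absolute exclusion is possible. Each entry of the list shows that its
  occurrence forces the triangle, \<open>twoC7_pattern\<close> or \<open>W5_pattern\<close>. The
  last two are cubic, and a cubic subgraph of a connected cubic graph is the whole graph; the entry
  for a single edge thus finishes the proof.\<close>

lemma edge_cases:
  assumes "is_graph G" "e \<in> edges G"
  obtains x y where "e = {x, y}" "x \<noteq> y" "x \<in> verts G" "y \<in> verts G"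
proof -
  have "card e = 2" "e \<subseteq> verts G" using assms by (auto simp: is_graph_def)
  then obtain x y where "e = {x, y}" "x \<noteq> y" by (auto simp: card_2_iff)
  with \<open>e \<subseteq> verts G\<close> that show thesis by blast
qed

lemma edge_verts:
  assumes "is_graph G" "{x, y} \<in> edges G"
  shows "x \<in> verts G" "y \<in> verts G" "x \<noteq> y"
  using assms by (auto simp: is_graph_def doubleton_eq_iff)

lemma finite_edges: "is_graph G \<Longrightarrow> finite (edges G)"
  by (rule finite_subset[of _ "Pow (verts G)"]) (auto simp: is_graph_def)

lemma nbrs_subset: "is_graph G \<Longrightarrow> nbrs G x \<subseteq> verts G"
  using edge_verts by (fastforce simp: nbrs_def)

lemma subgraph_is_graph: "subgraph H G \<Longrightarrow> is_graph H"
  by (simp add: subgraph_def)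

lemma triangle_free_subgraph: "triangle_free G \<Longrightarrow> subgraph H G \<Longrightarrow> triangle_free H"
  unfolding triangle_free_def subgraph_def by blast

section \<open>Independence number and 4-cycle counts of finite graphs\<close>

lemma finite_independent:
  assumes "is_graph G"
  shows "finite {S. independent G S}"
  by (rule finite_subset[of _ "Pow (verts G)"])
    (use assms in \<open>auto simp: is_graph_def independent_def\<close>)

lemma card_le_alpha: "is_graph G \<Longrightarrow> independent G S \<Longrightarrow> card S \<le> alpha G"
  unfolding alpha_def by (rule Max_ge) (auto intro: finite_independent)

lemma alpha_attained:
  assumes "is_graph G"
  obtains S where "independent G S" "card S = alpha G"
proof -
  have "independent G {}" by (simp add: independent_def)
  then have "alpha G \<in> card ` {S. independent G S}"
    unfolding alpha_def using finite_independent[OF assms] by (intro Max_in) auto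
  with that show thesis by auto
qed

lemma finite_subgraphs:
  assumes "is_graph G"
  shows "finite {K. subgraph K G}"
proof (rule finite_subset)
  show "{K. subgraph K G} \<subseteq> (\<lambda>(V, E). Graph V E) ` (Pow (verts G) \<times> Pow (edges G))"
  proof
    fix K assume "K \<in> {K. subgraph K G}"
    then have "(verts K, edges K) \<in> Pow (verts G) \<times> Pow (edges G)"
      by (auto simp: subgraph_def)
    then show "K \<in> (\<lambda>(V, E). Graph V E) ` (Pow (verts G) \<times> Pow (edges G))"
      by (intro image_eqI[of _ _ "(verts K, edges K)"]) auto
  qed
  show "finite ((\<lambda>(V, E). Graph V E) ` (Pow (verts G) \<times> Pow (edges G)))"
    using assms finite_edges[OF assms] by (auto simp: is_graph_def)
qed

text \<open>Graphs are non-empty, so no 4-cycle is a subgraph of both of two disjoint graphs; the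
  two collections of 4-cycles are disjoint.\<close>

lemma N_C4_disjoint_le:
  assumes G: "is_graph G" and "subgraph C G" "subgraph D G" "verts C \<inter> verts D = {}"
  shows "N_C4 C + N_C4 D \<le> N_C4 G"
proof -
  let ?K = "\<lambda>H. {K. subgraph K H \<and> K \<cong> cycle_graph 4}"
  have fin: "finite (?K H)" if "is_graph H" for H :: "'a graph"
    using finite_subgraphs[OF that] by (rule rev_finite_subset) auto
  have "?K C \<inter> ?K D = {}"
    using assms(4) by (auto simp: subgraph_def is_graph_def)
  then have "card (?K C \<union> ?K D) = N_C4 C + N_C4 D"
    unfolding N_C4_def using assms(2,3) fin by (intro card_Un_disjoint) (auto simp: subgraph_def)
  moreover have "card (?K C \<union> ?K D) \<le> N_C4 G"
    unfolding N_C4_def using assms(2,3) by (intro card_mono fin[OF G]) (auto simp: subgraph_def)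
  ultimately show ?thesis by simp
qed

lemma N_C4_mono:
  assumes "is_graph G" "subgraph H G"
  shows "N_C4 H \<le> N_C4 G"
  unfolding N_C4_def
proof (rule card_mono)
  show "finite {K. subgraph K G \<and> K \<cong> cycle_graph 4}"
    using finite_subgraphs[OF assms(1)] by (rule rev_finite_subset) auto
qed (use assms in \<open>auto simp: subgraph_def\<close>)

section \<open>Isomorphisms and injective relabellings\<close>

lemma isomorphic_sym:
  assumes "G \<cong> H"
  shows "H \<cong> G"
proof -
  obtain f where f: "bij_betw f (verts G) (verts H)"
    and e: "\<And>x y. x \<in> verts G \<Longrightarrow> y \<in> verts G \<Longrightarrow> {x, y} \<in> edges G \<longleftrightarrow> {f x, f y} \<in> edges H"
    using assms unfolding isomorphic_def by blast
  let ?g = "inv_into (verts G) f"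
  have "bij_betw ?g (verts H) (verts G)" using f by (rule bij_betw_inv_into)
  moreover have "{x, y} \<in> edges H \<longleftrightarrow> {?g x, ?g y} \<in> edges G"
    if "x \<in> verts H" "y \<in> verts H" for x y
    using that f e[of "?g x" "?g y"] bij_betw_inv_into_right[OF f]
    by (metis bij_betw_imp_surj_on inv_into_into)
  ultimately show ?thesis unfolding isomorphic_def by (intro exI[of _ ?g]) simp
qed

lemma isomorphic_trans:
  assumes "G \<cong> H" "H \<cong> K"
  shows "G \<cong> K"
proof -
  obtain f where f: "bij_betw f (verts G) (verts H)"
    and e: "\<forall>x\<in>verts G. \<forall>y\<in>verts G. {x, y} \<in> edges G \<longleftrightarrow> {f x, f y} \<in> edges H"
    using assms(1) unfolding isomorphic_def by blast
  obtain g where g: "bij_betw g (verts H) (verts K)"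
    and e': "\<forall>x\<in>verts H. \<forall>y\<in>verts H. {x, y} \<in> edges H \<longleftrightarrow> {g x, g y} \<in> edges K"
    using assms(2) unfolding isomorphic_def by blast
  have "f x \<in> verts H" if "x \<in> verts G" for x using that f by (auto simp: bij_betw_def)
  then have "\<forall>x\<in>verts G. \<forall>y\<in>verts G. {x, y} \<in> edges G \<longleftrightarrow> {(g \<circ> f) x, (g \<circ> f) y} \<in> edges K"
    using e e' by simp
  then show ?thesis
    unfolding isomorphic_def using bij_betw_trans[OF f g] by (intro exI[of _ "g \<circ> f"] conjI)
qed

text \<open>The minimality hypothesis of the theorem speaks of graphs on \<open>nat\<close>, whereas
  the subgraphs of \<open>G\<close> live on an arbitrary type. They are transported along a map that
  is injective on the vertices, and everything entering \<nu> has to be shown invariant.\<close>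

definition relabel :: "('a \<Rightarrow> 'b) \<Rightarrow> 'a graph \<Rightarrow> 'b graph" where
  "relabel f G = Graph (f ` verts G) ((`) f ` edges G)"

lemma relabel_edge_iff:
  assumes "is_graph G" "inj_on f (verts G)" "e \<subseteq> verts G"
  shows "f ` e \<in> edges (relabel f G) \<longleftrightarrow> e \<in> edges G"
  using assms by (auto simp: relabel_def is_graph_def inj_on_image_eq_iff)

lemma relabel_is_graph:
  assumes "is_graph G" "inj_on f (verts G)"
  shows "is_graph (relabel f G)"
proof -
  have "card (f ` e) = 2" if "e \<in> edges G" for e
    using assms that by (metis card_image inj_on_subset is_graph_def)
  then show ?thesis using assms by (fastforce simp: is_graph_def relabel_def)
qed

lemma relabel_isomorphic:
  assumes "is_graph G" "inj_on f (verts G)"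
  shows "G \<cong> relabel f G"
proof -
  have "bij_betw f (verts G) (verts (relabel f G))"
    using assms by (simp add: relabel_def bij_betw_def)
  moreover have "{x, y} \<in> edges G \<longleftrightarrow> {f x, f y} \<in> edges (relabel f G)"
    if "x \<in> verts G" "y \<in> verts G" for x y
    using relabel_edge_iff[OF assms, of "{x, y}"] that by simp
  ultimately show ?thesis unfolding isomorphic_def by (intro exI[of _ f]) simp
qed

lemma relabel_inv_into:
  assumes "is_graph G" "inj_on f (verts G)"
  shows "relabel (inv_into (verts G) f) (relabel f G) = G"
proof -
  let ?g = "inv_into (verts G) f"
  have inv: "?g ` f ` e = e" if "e \<subseteq> verts G" for e
    using assms(2) that by (rule inv_into_image_cancel)
  have "(`) ?g ` (`) f ` edges G = ((`) ?g \<circ> (`) f) ` edges G" by (rule image_comp)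
  also have "\<dots> = id ` edges G"
    by (rule image_cong) (use assms(1) inv in \<open>simp_all add: is_graph_def\<close>)
  finally show ?thesis using inv[of "verts G"] by (simp add: relabel_def)
qed

lemma nverts_relabel: "inj_on f (verts G) \<Longrightarrow> nverts (relabel f G) = nverts G"
  by (simp add: nverts_def relabel_def card_image)

lemma nedges_relabel:
  assumes "is_graph G" "inj_on f (verts G)"
  shows "nedges (relabel f G) = nedges G"
proof -
  have "inj_on ((`) f) (edges G)"
    by (rule inj_onI) (use assms in \<open>simp add: is_graph_def inj_on_image_eq_iff\<close>)
  then show ?thesis by (simp add: nedges_def relabel_def card_image)
qed

lemma alpha_le_relabel:
  assumes "is_graph G" "inj_on f (verts G)"
  shows "alpha G \<le> alpha (relabel f G)"
proof -
  obtain S where S: "independent G S" "card S = alpha G" using alpha_attained[OF assms(1)] .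
  then have sub: "S \<subseteq> verts G" by (simp add: independent_def)
  have "{f x, f y} \<notin> edges (relabel f G)" if "x \<in> S" "y \<in> S" for x y
    using relabel_edge_iff[OF assms, of "{x, y}"] S that sub by (auto simp: independent_def)
  then have "independent (relabel f G) (f ` S)"
    using sub by (auto simp: independent_def relabel_def)
  from card_le_alpha[OF relabel_is_graph[OF assms] this] show ?thesis
    using S sub assms(2) by (metis card_image inj_on_subset)
qed

lemma subgraph_relabel:
  assumes "subgraph K G" "inj_on f (verts G)"
  shows "subgraph (relabel f K) (relabel f G)"
  using assms relabel_is_graph[of K f]
  by (auto simp: subgraph_def relabel_def inj_on_subset)

text \<open>Under an injective \<open>f\<close> the images of the vertex set and of the edge set
  determine a subgraph, and a relabelled 4-cycle is again a 4-cycle; so relabelling injects the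
  4-cycles of \<open>G\<close> into those of its copy.\<close>

lemma N_C4_le_relabel:
  assumes "is_graph G" "inj_on f (verts G)"
  shows "N_C4 G \<le> N_C4 (relabel f G)"
  unfolding N_C4_def
proof (rule card_inj_on_le)
  show "inj_on (relabel f) {K. subgraph K G \<and> K \<cong> cycle_graph 4}"
  proof (rule inj_onI; clarify)
    fix K L assume K: "subgraph K G" and L: "subgraph L G" and eq: "relabel f K = relabel f L"
    have E: "edges G \<subseteq> Pow (verts G)" using assms(1) by (auto simp: is_graph_def)
    have "f ` verts K = f ` verts L" "(`) f ` edges K = (`) f ` edges L"
      using eq by (simp_all add: relabel_def)
    moreover have sub: "verts K \<subseteq> verts G" "verts L \<subseteq> verts G"
      "edges K \<subseteq> edges G" "edges L \<subseteq> edges G"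
      using K L by (simp_all add: subgraph_def)
    ultimately have "verts K = verts L" "edges K = edges L"
      using inj_on_image_eq_iff[OF assms(2) sub(1,2)]
        inj_on_image_eq_iff[OF inj_on_image_Pow[OF assms(2)]
          subset_trans[OF sub(3) E] subset_trans[OF sub(4) E]]
      by simp_all
    then show "K = L" by (rule graph.expand[OF conjI])
  qed
  show "relabel f ` {K. subgraph K G \<and> K \<cong> cycle_graph 4}
      \<subseteq> {K. subgraph K (relabel f G) \<and> K \<cong> cycle_graph 4}"
  proof (rule image_subsetI)
    fix K assume "K \<in> {K. subgraph K G \<and> K \<cong> cycle_graph 4}"
    then have K: "subgraph K G" "K \<cong> cycle_graph 4" by simp_all
    then have "inj_on f (verts K)"
      using assms(2) by (meson inj_on_subset subgraph_def)
    then have "relabel f K \<cong> K"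
      using subgraph_is_graph[OF K(1)] isomorphic_sym relabel_isomorphic by blast
    then have "relabel f K \<cong> cycle_graph 4" using K(2) by (rule isomorphic_trans)
    then show "relabel f K \<in> {K. subgraph K (relabel f G) \<and> K \<cong> cycle_graph 4}"
      using subgraph_relabel[OF K(1) assms(2)] by simp
  qed
  show "finite {K. subgraph K (relabel f G) \<and> K \<cong> cycle_graph 4}"
    using finite_subgraphs[OF relabel_is_graph[OF assms]] by (rule rev_finite_subset) auto
qed

text \<open>For \<alpha> and for the number of 4-cycles one inequality has been shown; the other is
  the same statement for the inverse relabelling, which gives back \<open>G\<close> by
  \<open>relabel_inv_into\<close>.\<close>

lemma nu_relabel:
  assumes "is_graph G" "inj_on f (verts G)"
  shows "nu (relabel f G) = nu G"
proof -
  let ?g = "inv_into (verts G) f"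
  have "inj_on ?g (verts (relabel f G))" by (simp add: relabel_def inj_on_inv_into)
  note le = alpha_le_relabel[OF relabel_is_graph[OF assms] this]
    N_C4_le_relabel[OF relabel_is_graph[OF assms] this]
  then have "alpha (relabel f G) = alpha G" "N_C4 (relabel f G) = N_C4 G"
    using alpha_le_relabel[OF assms] N_C4_le_relabel[OF assms]
    by (simp_all add: relabel_inv_into[OF assms])
  then show ?thesis using assms by (simp add: nu_def nverts_relabel nedges_relabel)
qed

lemma triangle_free_relabel:
  assumes "is_graph G" "inj_on f (verts G)" "triangle_free G"
  shows "triangle_free (relabel f G)"
  unfolding triangle_free_def
proof clarify
  fix x y z
  assume e: "{x, y} \<in> edges (relabel f G)" "{y, z} \<in> edges (relabel f G)" "{x, z} \<in> edges (relabel f G)"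
  then have "x \<in> f ` verts G" "y \<in> f ` verts G" "z \<in> f ` verts G"
    using edge_verts(1)[OF relabel_is_graph[OF assms(1,2)] e(1)]
      edge_verts[OF relabel_is_graph[OF assms(1,2)] e(2)]
    by (simp_all add: relabel_def)
  then obtain a b c where abc: "a \<in> verts G" "b \<in> verts G" "c \<in> verts G" "x = f a" "y = f b" "z = f c"
    by blast
  then have "{a, b} \<in> edges G" "{b, c} \<in> edges G" "{a, c} \<in> edges G"
    using e relabel_edge_iff[OF assms(1,2), of "{a, b}"]
      relabel_edge_iff[OF assms(1,2), of "{b, c}"] relabel_edge_iff[OF assms(1,2), of "{a, c}"]
    unfolding image_insert image_empty by blast+
  with assms(3) show False unfolding triangle_free_def by blast
qed

lemma connected_relabel:
  assumes "connected G"
  shows "connected (relabel f G)"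
proof -
  have "(f x, f y) \<in> {(u, v). {u, v} \<in> edges (relabel f G)}\<^sup>*"
    if "(x, y) \<in> {(u, v). {u, v} \<in> edges G}\<^sup>*" for x y
    using that
  proof induction
    case (step y z)
    then have "f ` {y, z} \<in> edges (relabel f G)"
      unfolding relabel_def graph.sel by (intro imageI) simp
    with step.IH show ?case by (simp add: rtrancl_into_rtrancl)
  qed simp
  with assms show ?thesis unfolding connected_def relabel_def graph.sel by blast
qed

lemma nat_relabelling:
  assumes "is_graph G"
  obtains f :: "'a \<Rightarrow> nat" where "inj_on f (verts G)"
  using assms finite_imp_inj_to_nat_seg[of "verts G"] by (auto simp: is_graph_def)

section \<open>Deleting closed neighbourhoods and components\<close>

definition induced :: "'a graph \<Rightarrow> 'a set \<Rightarrow> 'a graph" where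
  "induced G U = Graph (verts G \<inter> U) {e \<in> edges G. e \<subseteq> U}"

lemma subgraph_induced:
  assumes "is_graph G" "verts G \<inter> U \<noteq> {}"
  shows "subgraph (induced G U) G"
  using assms by (auto simp: subgraph_def is_graph_def induced_def)

text \<open>A maximum independent set of the induced graph can be enlarged by \<open>I\<close>,
  since no edge runs between \<open>I\<close> and \<open>U\<close>. This serves both for deleting a
  closed neighbourhood and for splitting off a component.\<close>

lemma alpha_induced:
  assumes G: "is_graph G" and U: "U \<subseteq> verts G" "U \<noteq> {}" and I: "independent G I" "I \<inter> U = {}"
    and sep: "\<And>x y. x \<in> I \<Longrightarrow> y \<in> U \<Longrightarrow> {x, y} \<notin> edges G"
  shows "alpha (induced G U) + card I \<le> alpha G"
proof -
  have "is_graph (induced G U)"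
    using subgraph_is_graph[OF subgraph_induced[OF G]] U by blast
  then obtain T where T: "independent (induced G U) T" "card T = alpha (induced G U)"
    by (rule alpha_attained)
  have sub: "T \<subseteq> U" "I \<subseteq> verts G" using T I by (auto simp: independent_def induced_def)
  have "{x, y} \<notin> edges G" if "x \<in> T" "y \<in> T" for x y
    using that T(1) sub(1) unfolding independent_def induced_def graph.sel by blast
  moreover have "{x, y} \<notin> edges G" if "x \<in> I" "y \<in> I" for x y
    using that I(1) by (simp add: independent_def)
  moreover have "{x, y} \<notin> edges G" "{y, x} \<notin> edges G" if "x \<in> I" "y \<in> T" for x y
    using sep[of x y] that sub(1) insert_commute[of x y "{}"] by auto
  ultimately have "independent G (T \<union> I)"
    using sub U unfolding independent_def by blast
  moreover have "card (T \<union> I) = card T + card I"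
  proof (rule card_Un_disjoint)
    have "finite (verts G)" using G by (simp add: is_graph_def)
    then show "finite T" "finite I" using sub U by (metis finite_subset)+
    show "T \<inter> I = {}" using sub I by blast
  qed
  ultimately show ?thesis using card_le_alpha[OF G] T(2) by fastforce
qed

lemma degree_eq_card_edges:
  assumes "is_graph G"
  shows "degree G v = card {e \<in> edges G. v \<in> e}"
proof -
  have "bij_betw (\<lambda>y. {v, y}) (nbrs G v) {e \<in> edges G. v \<in> e}"
    unfolding bij_betw_def
  proof
    show "inj_on (\<lambda>y. {v, y}) (nbrs G v)" by (auto simp: inj_on_def doubleton_eq_iff)
    show "(\<lambda>y. {v, y}) ` nbrs G v = {e \<in> edges G. v \<in> e}"
    proof (intro equalityI subsetI)
      fix e assume e: "e \<in> {e \<in> edges G. v \<in> e}"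
      then obtain x y where "e = {x, y}" using edge_cases[OF assms] by blast
      then show "e \<in> (\<lambda>y. {v, y}) ` nbrs G v" using e by (auto simp: nbrs_def insert_commute)
    qed (auto simp: nbrs_def)
  qed
  then show ?thesis by (simp add: degree_def bij_betw_same_card)
qed

text \<open>Double counting of the incidences between \<open>S\<close> and the edges: an edge
  meeting \<open>S\<close> counts once, and once more if both of its ends lie in
  \<open>S\<close>.\<close>

lemma degree_sum:
  assumes "is_graph G" "finite S"
  shows "(\<Sum>v\<in>S. degree G v) = card {e \<in> edges G. e \<inter> S \<noteq> {}} + card {e \<in> edges G. e \<subseteq> S}"
proof -
  note fin = finite_edges[OF assms(1)]
  have "(\<Sum>v\<in>S. degree G v) = (\<Sum>v\<in>S. \<Sum>e\<in>edges G. of_bool (v \<in> e))"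
    by (simp add: degree_eq_card_edges[OF assms(1)] fin Int_def)
  also have "\<dots> = (\<Sum>e\<in>edges G. \<Sum>v\<in>S. of_bool (v \<in> e))" by (rule sum.swap)
  also have "\<dots> = (\<Sum>e\<in>edges G. of_bool (e \<inter> S \<noteq> {}) + of_bool (e \<subseteq> S))"
  proof (rule sum.cong)
    fix e assume "e \<in> edges G"
    then obtain x y where e: "e = {x, y}" "x \<noteq> y" using edge_cases[OF assms(1)] by blast
    have "(\<Sum>v\<in>S. of_bool (v \<in> e)) = card (S \<inter> {x, y})"
      unfolding e(1) using assms(2) by (simp add: Int_def del: insert_iff)
    also have "\<dots> = of_bool (e \<inter> S \<noteq> {}) + of_bool (e \<subseteq> S)"
      using e by (cases "x \<in> S"; cases "y \<in> S") auto
    finally show "(\<Sum>v\<in>S. of_bool (v \<in> e)) = (of_bool (e \<inter> S \<noteq> {}) + of_bool (e \<subseteq> S) :: nat)" .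
  qed simp
  also have "\<dots> = card {e \<in> edges G. e \<inter> S \<noteq> {}} + card {e \<in> edges G. e \<subseteq> S}"
    using fin by (simp add: sum.distrib Int_def)
  finally show ?thesis .
qed

definition closed_nbhd :: "'a graph \<Rightarrow> 'a set \<Rightarrow> 'a set" where
  "closed_nbhd G I = I \<union> (\<Union>x\<in>I. nbrs G x)"

text \<open>Write e(S) for the number of edges inside S. By \<open>degree_sum\<close>, cubicity
  makes 3|S| - e(S) the number of edges that meet S. Deleting S thus changes 3e - 17n by 17|S| -
  3(3|S| - e(S)) = 8|S| + 3e(S), which is where the 8 and the 3 come from; 35\<alpha> drops by at
  least 35|I|, and no 4-cycle is created.\<close>

lemma nu_delete_closed_nbhd:
  assumes G: "is_graph G" "regular 3 G" and I: "independent G I"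
    and S: "S = closed_nbhd G I" "verts G - S \<noteq> {}"
  shows "nu (induced G (verts G - S)) + 35 * int (card I)
    \<le> nu G + 8 * int (card S) + 3 * int (card {e \<in> edges G. e \<subseteq> S})"
proof -
  let ?J = "induced G (verts G - S)"
  have sub: "S \<subseteq> verts G"
    using I nbrs_subset[OF G(1)] by (auto simp: S(1) closed_nbhd_def independent_def)
  then have fin: "finite S" using G(1) finite_subset by (auto simp: is_graph_def)
  have J: "subgraph ?J G" using S(2) by (intro subgraph_induced G(1)) blast
  have "alpha ?J + card I \<le> alpha G"
    using S(2) I by (intro alpha_induced G(1)) (auto simp: S(1) closed_nbhd_def nbrs_def)
  moreover have "N_C4 ?J \<le> N_C4 G" using N_C4_mono[OF G(1) J] .
  moreover have "nverts ?J + card S = nverts G"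
    using sub G(1) fin
    by (simp add: nverts_def induced_def is_graph_def Int_absorb1 card_Diff_subset card_mono)
  moreover have "nedges ?J + card {e \<in> edges G. e \<inter> S \<noteq> {}} = nedges G"
  proof -
    have "edges ?J = edges G - {e \<in> edges G. e \<inter> S \<noteq> {}}"
      using G(1) by (auto simp: induced_def is_graph_def)
    then show ?thesis
      using finite_edges[OF G(1)] by (simp add: nedges_def card_Diff_subset card_mono)
  qed
  moreover have "card {e \<in> edges G. e \<inter> S \<noteq> {}} + card {e \<in> edges G. e \<subseteq> S} = 3 * card S"
    using degree_sum[OF G(1) fin] sub G(2) by (simp add: regular_def subset_iff)
  ultimately show ?thesis unfolding nu_def by linarith
qed

text \<open>If the closed neighbourhood is all of \<open>G\<close>, nothing is left to which
  \<open>nonneg\<close> could be applied. Then e = 3n/2, and \<nu>(G) \<le> 0 by itself says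
  35\<alpha> \<le> 17n - 3e = 8n + 3e, which is the claim because |I| \<le> \<alpha>.\<close>

lemma closed_nbhd_ineq:
  assumes G: "is_graph G" "regular 3 G" "nu G \<le> 0" and I: "independent G I"
    and nonneg: "\<And>J. subgraph J G \<Longrightarrow> nverts J < nverts G \<Longrightarrow> nu J \<ge> 0"
  shows "35 * card I \<le> 8 * card (closed_nbhd G I) + 3 * card {e \<in> edges G. e \<subseteq> closed_nbhd G I}"
proof -
  let ?S = "closed_nbhd G I"
  consider "I = {}" | "I \<noteq> {}" "verts G - ?S = {}" | "I \<noteq> {}" "verts G - ?S \<noteq> {}" by blast
  then show ?thesis
  proof cases
    case 2
    have "?S = verts G"
      using 2 I nbrs_subset[OF G(1)] by (auto simp: closed_nbhd_def independent_def)
    moreover have "{e \<in> edges G. e \<subseteq> verts G} = edges G" "{e \<in> edges G. e \<inter> verts G \<noteq> {}} = edges G"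
      using G(1) by (auto simp: is_graph_def) (metis card.empty inf.orderE zero_neq_numeral)
    moreover have "3 * nverts G = 2 * nedges G"
      using degree_sum[OF G(1), of "verts G"] G(1,2) calculation(2,3)
      by (simp add: regular_def nverts_def nedges_def is_graph_def)
    ultimately show ?thesis
      using card_le_alpha[OF G(1) I] G(3) unfolding nu_def nverts_def nedges_def by simp
  next
    case 3
    let ?J = "induced G (verts G - ?S)"
    have J: "subgraph ?J G" using 3 by (intro subgraph_induced G(1)) blast
    have "I \<subseteq> verts G" "I \<subseteq> ?S" using I by (auto simp: independent_def closed_nbhd_def)
    then have "verts ?J \<subset> verts G" using 3 by (auto simp: induced_def)
    then have "nverts ?J < nverts G"
      using G(1) by (simp add: nverts_def is_graph_def psubset_card_mono)
    with J nonneg have "nu ?J \<ge> 0" by blast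
    with nu_delete_closed_nbhd[OF G(1,2) I refl 3(2)] G(3) show ?thesis by linarith
  qed simp
qed

section \<open>Splitting off a connected component\<close>

lemma component_closed:
  assumes G: "is_graph G" and C: "component C G" and e: "{x, y} \<in> edges G" and x: "x \<in> verts C"
  shows "{x, y} \<in> edges C"
proof -
  \<comment> \<open>Adding the edge and its second end to \<open>C\<close> leaves it connected, so
    maximality of the component says that nothing was added.\<close>
  let ?D = "Graph (insert y (verts C)) (insert {x, y} (edges C))"
  let ?r = "\<lambda>H. {(u, v). {u, v} \<in> edges H}\<^sup>*"
  have sub: "subgraph C G" and con: "connected C" using C by (simp_all add: component_def)
  have gC: "is_graph C" using sub by (rule subgraph_is_graph)
  have "is_graph ?D"
    using gC x edge_verts(3)[OF G e] by (auto simp: is_graph_def)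
  then have D: "subgraph ?D G" "subgraph C ?D"
    using sub gC e edge_verts[OF G e] by (auto simp: subgraph_def)
  have r: "?r C \<subseteq> ?r ?D" by (rule rtrancl_mono) auto
  have xy: "(x, y) \<in> ?r ?D" "(y, x) \<in> ?r ?D" by (auto simp: insert_commute)
  have "(u, x) \<in> ?r ?D" "(x, u) \<in> ?r ?D" if "u \<in> verts ?D" for u
    using that con x r xy by (auto simp: connected_def)
  then have "connected ?D"
    unfolding connected_def by (meson rtrancl_trans)
  with D C have "?D = C" by (auto simp: component_def)
  then show ?thesis by (metis graph.sel(2) insertI1)
qed

lemma component_eq:
  assumes "is_graph G" "component C G" "verts C = verts G"
  shows "C = G"
proof -
  have "edges G \<subseteq> edges C"
  proof
    fix e assume "e \<in> edges G"
    then obtain x y where "e = {x, y}" "x \<in> verts G" "e \<in> edges G"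
      using edge_cases[OF assms(1)] by metis
    then show "e \<in> edges C" using component_closed[OF assms(1,2)] assms(3) by blast
  qed
  moreover have "edges C \<subseteq> edges G" using assms(2) by (simp add: component_def subgraph_def)
  ultimately show ?thesis using assms(3) by (intro graph.expand) auto
qed

text \<open>No edge leaves \<open>C\<close>, so n and e are additive over \<open>C\<close> and the
  rest. Only superadditivity is needed for the two terms with positive sign that are left: a maximum
  independent set of \<open>C\<close> plays the role of \<open>I\<close> in
  \<open>alpha_induced\<close>, and 4-cycles of the two parts are distinct.\<close>

lemma nu_component:
  assumes G: "is_graph G" and C: "component C G" and ne: "verts G - verts C \<noteq> {}"
  shows "nu C + nu (induced G (verts G - verts C)) \<le> nu G"
proof -
  let ?D = "induced G (verts G - verts C)"
  have sub: "subgraph C G" using C by (simp add: component_def)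
  have gC: "is_graph C" using sub by (rule subgraph_is_graph)
  have D: "subgraph ?D G" using ne by (intro subgraph_induced G) blast
  have vC: "verts C \<subseteq> verts G" and fin: "finite (verts G)"
    using sub G by (auto simp: subgraph_def is_graph_def)
  have cl: "{x, y} \<in> edges C" if "{x, y} \<in> edges G" "x \<in> verts C" for x y
    using component_closed[OF G C that] .
  obtain I where I: "independent C I" "card I = alpha C" using gC by (rule alpha_attained)
  have "independent G I"
    using I cl vC unfolding independent_def by blast
  moreover have "{x, y} \<notin> edges G" if "x \<in> I" "y \<in> verts G - verts C" for x y
    using that I cl edge_verts(2)[OF gC] unfolding independent_def by blast
  moreover have "I \<inter> (verts G - verts C) = {}" using I(1) by (auto simp: independent_def)
  ultimately have "alpha ?D + alpha C \<le> alpha G"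
    using alpha_induced[OF G Diff_subset ne, of I] I(2) by simp
  moreover have "N_C4 C + N_C4 ?D \<le> N_C4 G"
    using N_C4_disjoint_le[OF G sub D] by (auto simp: induced_def)
  moreover have "nverts C + nverts ?D = nverts G"
    using vC fin by (simp add: nverts_def induced_def Int_absorb1 card_Diff_subset card_mono finite_subset)
  moreover have "nedges C + nedges ?D = nedges G"
  proof -
    have "edges ?D = edges G - edges C"
    proof (intro equalityI subsetI)
      fix e assume "e \<in> edges G - edges C"
      then obtain x y where "e = {x, y}" "x \<in> verts G" "y \<in> verts G" "e \<in> edges G" "e \<notin> edges C"
        using edge_cases[OF G] by (metis DiffE)
      then show "e \<in> edges ?D" using cl[of x y] cl[of y x] by (auto simp: induced_def insert_commute)
    next
      fix e assume "e \<in> edges ?D"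
      moreover have "e \<noteq> {}" "e \<subseteq> verts C" if "e \<in> edges C" for e
        using that gC by (auto simp: is_graph_def)
      ultimately show "e \<in> edges G - edges C" by (auto simp: induced_def)
    qed
    moreover have "edges C \<subseteq> edges G" using sub by (simp add: subgraph_def)
    ultimately show ?thesis
      using finite_edges[OF G] by (simp add: nedges_def card_Diff_subset card_mono finite_subset)
  qed
  ultimately show ?thesis unfolding nu_def by linarith
qed

section \<open>The cubic members of the family\<close>

lemma isomorphic_degree:
  assumes "G \<cong> H" "v \<in> verts H"
  obtains x where "x \<in> verts G" "card (nbrs G x \<inter> verts G) = card (nbrs H v \<inter> verts H)"
proof -
  obtain f where f: "bij_betw f (verts G) (verts H)"
    and e: "\<And>x y. x \<in> verts G \<Longrightarrow> y \<in> verts G \<Longrightarrow> {x, y} \<in> edges G \<longleftrightarrow> {f x, f y} \<in> edges H"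
    using assms(1) unfolding isomorphic_def by blast
  obtain x where x: "x \<in> verts G" "v = f x" using f assms(2) by (auto simp: bij_betw_def)
  \<comment> \<open>Neighbourhoods are cut down to the vertex sets because \<open>\<cong>\<close>
    compares only pairs of vertices, and neither graph is assumed here to satisfy
    \<open>is_graph\<close>.\<close>
  have "f ` (nbrs G x \<inter> verts G) = nbrs H v \<inter> verts H"
  proof (intro equalityI subsetI)
    fix w assume w: "w \<in> nbrs H v \<inter> verts H"
    then obtain y where "y \<in> verts G" "w = f y" using f by (auto simp: bij_betw_def)
    then show "w \<in> f ` (nbrs G x \<inter> verts G)" using w x e[of x y] by (auto simp: nbrs_def)
  next
    fix w assume "w \<in> f ` (nbrs G x \<inter> verts G)"
    then show "w \<in> nbrs H v \<inter> verts H" using x e f by (auto simp: nbrs_def bij_betw_def)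
  qed
  moreover have "inj_on f (nbrs G x \<inter> verts G)"
    using f by (auto simp: bij_betw_def intro: inj_on_subset)
  ultimately have "card (nbrs G x \<inter> verts G) = card (nbrs H v \<inter> verts H)"
    by (metis card_image)
  with x that show thesis by blast
qed

text \<open>In the 5-cycle the vertex \<open>Vc 0\<close> has two neighbours; after a step the new
  vertex \<open>v\<close> sees only \<open>w1\<close> and \<open>w2\<close>. The first conjunct is
  carried through the induction because it guarantees that no old edge contains
  \<open>v\<close>.\<close>

lemma Ch_bivalent:
  assumes "Ch k H"
  shows "(\<forall>e\<in>edges H. e \<subseteq> verts H) \<and> (\<exists>v\<in>verts H. \<exists>a b. nbrs H v \<subseteq> {a, b})"
  using assms
proof induction
  case Ch_base
  have "nbrs (cycle_graph 5) (Vc 0) \<subseteq> {Vc 1, Vc 4}"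
  proof
    fix y assume "y \<in> nbrs (cycle_graph 5) (Vc 0)"
    then obtain i where i: "i < 5" "{Vc 0, y} = {Vc i, Vc ((i + 1) mod 5)}"
      by (auto simp: nbrs_def cycle_graph_def cycle_edges_def)
    then have "i = 0 \<or> i = 1 \<or> i = 2 \<or> i = 3 \<or> i = 4" by arith
    with i(2) show "y \<in> {Vc 1, Vc 4}" by (auto simp: doubleton_eq_iff)
  qed
  moreover have "Vc 0 \<in> verts (cycle_graph 5)" by (simp add: cycle_graph_def)
  moreover have "\<forall>e\<in>edges (cycle_graph 5). e \<subseteq> verts (cycle_graph 5)"
    by (auto simp: cycle_graph_def cycle_edges_def)
  ultimately show ?case by blast
next
  case (Ch_step k H x v w1 w2)
  let ?E = "edges H \<union> {{v, w1}, {v, w2}, {w1, x}} \<union> {{w2, y} | y. y \<in> nbrs H x}"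
  have "nbrs H x \<subseteq> verts H" using Ch_step.IH by (auto simp: nbrs_def)
  then have "y \<in> {w1, w2}" if "{v, y} \<in> ?E" for y
    using that Ch_step.IH Ch_step.hyps by (auto simp: doubleton_eq_iff)
  then have "nbrs (Graph (verts H \<union> {v, w1, w2}) ?E) v \<subseteq> {w1, w2}"
    unfolding nbrs_def graph.sel by blast
  then have "\<exists>u\<in>verts H \<union> {v, w1, w2}. \<exists>a b. nbrs (Graph (verts H \<union> {v, w1, w2}) ?E) u \<subseteq> {a, b}"
    by blast
  moreover have "\<forall>e\<in>?E. e \<subseteq> verts H \<union> {v, w1, w2}"
    using Ch_step.IH Ch_step.hyps(2) \<open>nbrs H x \<subseteq> verts H\<close> by auto
  ultimately show ?case unfolding graph.sel by (intro conjI)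
qed

text \<open>\<open>Vd 1\<close> is d_1. On the cycle of the d's it is adjacent to d_k, written
  \<open>Vd 0\<close>, and to d_2; its other two neighbours are c_{2k}, written \<open>Vc 0\<close>,
  and c_3.\<close>

lemma BC_four_valent:
  assumes "k \<ge> 5"
  shows "Vd 1 \<in> verts (BC k)" "card (nbrs (BC k) (Vd 1) \<inter> verts (BC k)) \<ge> 4"
proof -
  have "{Vd 0, Vd 1} \<in> cycle_edges Vd k" "{Vd 1, Vd 2} \<in> cycle_edges Vd k"
    unfolding cycle_edges_def using assms
    by (auto intro: exI[of _ "0::nat"] exI[of _ "1::nat"])
  moreover have "{Vd 1, Vc 0} \<in> {{Vd (i mod k), Vc ((2 * i - 2) mod (2 * k))} | i. 1 \<le> i \<and> i \<le> k}"
    "{Vd 1, Vc 3} \<in> {{Vd (i mod k), Vc ((2 * i + 1) mod (2 * k))} | i. 1 \<le> i \<and> i \<le> k}"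
    using assms by (auto intro!: exI[of _ "1::nat"])
  ultimately have "{Vd 0, Vd 2, Vc 0, Vc 3} \<subseteq> nbrs (BC k) (Vd 1) \<inter> verts (BC k)"
    using assms by (auto simp: nbrs_def BC_def insert_commute)
  moreover have "finite (verts (BC k))" by (simp add: BC_def)
  ultimately have "card {Vd 0, Vd 2, Vc 0, Vc 3} \<le> card (nbrs (BC k) (Vd 1) \<inter> verts (BC k))"
    by (intro card_mono) auto
  then show "card (nbrs (BC k) (Vd 1) \<inter> verts (BC k)) \<ge> 4" by simp
  show "Vd 1 \<in> verts (BC k)" using assms by (simp add: BC_def)
qed

text \<open>Each Ch_k has a vertex of degree at most two and each BC_k one of degree at least four,
  so neither is isomorphic to a cubic graph.\<close>

lemma cubic_family:
  assumes C: "is_graph C" "regular 3 C" and H: "H \<in> family" "C \<cong> H"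
  shows "H = twoC7 \<or> H = W5"
proof -
  have 3: "card (nbrs H v \<inter> verts H) = 3" if v: "v \<in> verts H" for v
  proof -
    obtain x where "x \<in> verts C" "card (nbrs C x \<inter> verts C) = card (nbrs H v \<inter> verts H)"
      using isomorphic_degree[OF H(2) v] .
    then show ?thesis
      using C nbrs_subset[OF C(1), of x] by (simp add: regular_def degree_def Int_absorb2)
  qed
  have "\<not> Ch k H" for k
  proof
    assume "Ch k H"
    then obtain v a b where "v \<in> verts H" "nbrs H v \<subseteq> {a, b}" using Ch_bivalent by metis
    moreover from this have "card (nbrs H v \<inter> verts H) \<le> card {a, b}" by (intro card_mono) auto
    moreover have "card {a, b} \<le> 2" by (simp add: card_insert_if)
    ultimately show False using 3 by fastforce
  qed
  moreover have "H \<noteq> BC k" if "k \<ge> 5" for k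
    using 3[of "Vd 1"] BC_four_valent[OF that] by auto
  ultimately show ?thesis using H(1) by (auto simp: family_def)
qed

section \<open>The certificate checker\<close>

datatype 'a trie = Tip | Node "'a trie" 'a "'a trie"

text \<open>The key is read bit by bit from its least significant end, so a lookup takes as many
  rewrite steps as the key has bits. The total version with a default \<open>d\<close> avoids option
  types in the checker.\<close>

fun fetch :: "'a \<Rightarrow> num \<Rightarrow> 'a trie \<Rightarrow> 'a" where
  "fetch d k Tip = d"
| "fetch d num.One (Node l a r) = a"
| "fetch d (num.Bit0 k) (Node l a r) = fetch d k l"
| "fetch d (num.Bit1 k) (Node l a r) = fetch d k r"

fun store :: "'a \<Rightarrow> num \<Rightarrow> 'a \<Rightarrow> 'a trie \<Rightarrow> 'a trie" where
  "store d num.One b Tip = Node Tip b Tip"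
| "store d (num.Bit0 k) b Tip = Node (store d k b Tip) d Tip"
| "store d (num.Bit1 k) b Tip = Node Tip d (store d k b Tip)"
| "store d num.One b (Node l a r) = Node l b r"
| "store d (num.Bit0 k) b (Node l a r) = Node (store d k b l) a r"
| "store d (num.Bit1 k) b (Node l a r) = Node l a (store d k b r)"

lemma fetch_store: "fetch d k' (store d k b t) = (if k' = k then b else fetch d k' t)"
proof (induction d k b t arbitrary: k' rule: store.induct)
  case (1 d b)
  then show ?case by (cases k') auto
next
  case (2 d k b)
  then show ?case by (cases k') auto
next
  case (3 d k b)
  then show ?case by (cases k') auto
next
  case (4 d b l a r)
  then show ?case by (cases k') auto
next
  case (5 d k b l a r)
  then show ?case by (cases k') auto
next
  case (6 d k b l a r)
  then show ?case by (cases k') auto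
qed

fun fill :: "'a \<Rightarrow> num \<Rightarrow> 'a list \<Rightarrow> 'a trie \<Rightarrow> 'a trie" where
  "fill d k [] t = t"
| "fill d k (x # xs) t = fill d (Num.inc k) xs (store d k x t)"

text \<open>A pattern maps each label to the list of its known neighbours. A missing entry expresses
  ignorance, not the absence of an edge: patterns occur as subgraphs that need not be
  induced.\<close>

type_synonym pattern = "num list trie"

abbreviation adj :: "pattern \<Rightarrow> num \<Rightarrow> num list" where
  "adj P u \<equiv> fetch [] u P"

definition join :: "pattern \<Rightarrow> num \<Rightarrow> num \<Rightarrow> pattern" where
  "join P x y = store [] x (y # adj P x) (store [] y (x # adj P y) P)"

text \<open>\<open>pick\<close> and \<open>cons_if\<close> replace \<open>if\<close>: the congruence rule of \<open>if\<close> would make the simplifier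
  normalise the large arguments again in every step.\<close>

fun pick :: "bool \<Rightarrow> 'b \<Rightarrow> 'b \<Rightarrow> 'b" where
  "pick True a b = a"
| "pick False a b = b"

text \<open>Entries out of range, loops and repetitions are skipped. Hence every list of lists gives
  a symmetric, loopless pattern, and the certificate needs no separate validity test.\<close>

fun add_nbrs :: "num \<Rightarrow> num \<Rightarrow> num list \<Rightarrow> pattern \<Rightarrow> pattern" where
  "add_nbrs n k [] P = P"
| "add_nbrs n k (v # vs) P =
     add_nbrs n k vs (pick (v < n \<and> k \<noteq> v \<and> v \<notin> set (adj P k)) (join P k v) P)"

fun symmetrize :: "num \<Rightarrow> num \<Rightarrow> num list list \<Rightarrow> pattern \<Rightarrow> pattern" where
  "symmetrize n k [] P = P"
| "symmetrize n k (vs # F) P = symmetrize n (Num.inc k) F (add_nbrs n k vs P)"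

fun labels :: "num \<Rightarrow> 'b list \<Rightarrow> num list" where
  "labels k [] = []"
| "labels k (x # xs) = k # labels (Num.inc k) xs"

text \<open>Started at \<open>num.One\<close>, this is the first label not in use; it also names the
  fresh vertex when a pattern is extended.\<close>

fun bound :: "num \<Rightarrow> 'b list \<Rightarrow> num" where
  "bound k [] = k"
| "bound k (x # xs) = bound (Num.inc k) xs"

fun subcubic :: "num list \<Rightarrow> bool" where
  "subcubic (_ # _ # _ # _) = False"
| "subcubic _ = True"

fun cubic_list :: "num list \<Rightarrow> bool" where
  "cubic_list [_, _, _] = True"
| "cubic_list _ = False"

fun cons_if :: "bool \<Rightarrow> 'b \<Rightarrow> 'b list \<Rightarrow> 'b list" where
  "cons_if True x xs = x # xs"
| "cons_if False x xs = xs"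

section \<open>Branching on a missing neighbour\<close>

fun candidates :: "pattern \<Rightarrow> num \<Rightarrow> num list \<Rightarrow> num list \<Rightarrow> num list" where
  "candidates P x ns [] = []"
| "candidates P x ns (z # zs) =
     cons_if (subcubic (adj P z) \<and> z \<noteq> x \<and> z \<notin> set ns) z (candidates P x ns zs)"

fun joins :: "pattern \<Rightarrow> num \<Rightarrow> num list \<Rightarrow> num \<Rightarrow> pattern list" where
  "joins P x [] n = [join P x n]"
| "joins P x (z # zs) n = join P x z # joins P x zs n"

text \<open>The missing neighbour of \<open>x\<close> is either a known vertex that still has a free
  place or a vertex not seen before, which receives the label \<open>n\<close>. The latter case
  always comes last.\<close>

definition children :: "pattern \<Rightarrow> num list \<Rightarrow> num \<Rightarrow> num \<Rightarrow> pattern list" where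
  "children P V n x = joins P x (candidates P x (adj P x) V) n"

fun nonempty :: "'b list \<Rightarrow> bool" where
  "nonempty [] = False"
| "nonempty (_ # _) = True"

section \<open>The two ways of refuting a pattern: embeddings and the local inequality\<close>

fun unseen :: "bool trie \<Rightarrow> num list \<Rightarrow> bool" where
  "unseen t [] = True"
| "unseen t (u # us) = (\<not> fetch False u t \<and> unseen (store False u True t) us)"

fun all_adj :: "num trie \<Rightarrow> num list \<Rightarrow> num list \<Rightarrow> bool" where
  "all_adj M ws [] = True"
| "all_adj M ws (v # vs) = (fetch num.One v M \<in> set ws \<and> all_adj M ws vs)"

text \<open>The \<open>i\<close>-th label of \<open>F\<close> is mapped to the \<open>i\<close>-th entry of the list.  A nonempty adjacency
  list certifies that this entry is a label of \<open>P\<close>.\<close>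

fun emb :: "pattern \<Rightarrow> num trie \<Rightarrow> num list \<Rightarrow> num list list \<Rightarrow> bool" where
  "emb P M (u # us) (vs # F) =
     (nonempty (adj P u) \<and> all_adj M (adj P u) vs \<and> emb P M us F)"
| "emb P M us [] = (us = [])"
| "emb P M [] (vs # F) = False"

definition embeds :: "num list list \<Rightarrow> num list \<Rightarrow> pattern \<Rightarrow> bool" where
  "embeds F m P \<longleftrightarrow> unseen Tip m \<and> emb P (fill num.One num.One m Tip) m F"

fun hull :: "pattern \<Rightarrow> num list \<Rightarrow> num list" where
  "hull P [] = []"
| "hull P (u # us) = u # adj P u @ hull P us"

text \<open>A vertex of the cubic graph with \<open>k\<close> known neighbours outside \<open>S\<close> has at most \<open>3 - k\<close> in \<open>S\<close>;
  so half of \<open>inner S P S\<close> bounds the number of edges within \<open>S\<close>.\<close>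

fun outer :: "num list \<Rightarrow> num list \<Rightarrow> nat \<Rightarrow> nat" where
  "outer S [] d = d"
| "outer S (v # vs) d = outer S vs (pick (v \<in> set S) d (d - 1))"

fun inner :: "num list \<Rightarrow> pattern \<Rightarrow> num list \<Rightarrow> nat" where
  "inner S P [] = 0"
| "inner S P (u # us) = outer S (adj P u) 3 + inner S P us"

fun disj :: "num list \<Rightarrow> num list \<Rightarrow> bool" where
  "disj I [] = True"
| "disj I (v # vs) = (v \<notin> set I \<and> disj I vs)"

fun full :: "pattern \<Rightarrow> num list \<Rightarrow> num list \<Rightarrow> bool" where
  "full P I [] = True"
| "full P I (u # us) = (cubic_list (adj P u) \<and> disj I (adj P u) \<and> full P I us)"

fun heavy :: "pattern \<Rightarrow> nat \<Rightarrow> num list \<Rightarrow> bool" where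
  "heavy P k S = (8 * length S + 3 * (inner S P S div 2) < 35 * k)"

text \<open>\<open>full\<close> demands that all neighbours of \<open>I\<close> are known and lie
  outside \<open>I\<close>. So in every occurrence \<open>I\<close> is independent and its closed
  neighbourhood is exactly the image of the hull; \<open>heavy\<close> then contradicts the local
  inequality, whatever the unknown edges are.\<close>

definition dense :: "pattern \<Rightarrow> num list \<Rightarrow> bool" where
  "dense P I \<longleftrightarrow> distinct I \<and> full P I I \<and> heavy P (length I) (remdups (hull P I))"

text \<open>\<open>Dense I\<close> refutes a pattern by the local inequality for the independent set \<open>I\<close>, and
  \<open>Sub j m\<close> by an embedding \<open>m\<close> of the \<open>j\<close>-th pattern.\<close>

datatype leaf = Dense "nat list" | Sub nat "nat list"

fun nums :: "nat list \<Rightarrow> num list" where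
  "nums [] = []"
| "nums (x # xs) = num_of_nat x # nums xs"

definition C3_pattern :: "num list list" where
  "C3_pattern = map nums [[2, 3], [3], []]"

text \<open>With \<open>C3_pattern\<close> as default, a reference to an absent library entry means
  the triangle, so the indices in a certificate require no range check.\<close>

fun refuted :: "num list list trie \<Rightarrow> pattern \<Rightarrow> leaf \<Rightarrow> bool" where
  "refuted L P (Dense I) = dense P (nums I)"
| "refuted L P (Sub j m) = embeds (fetch C3_pattern (num_of_nat j) L) (nums m) P"

fun all_refuted :: "num list list trie \<Rightarrow> pattern list \<Rightarrow> leaf list \<Rightarrow> bool" where
  "all_refuted L [] [] = True"
| "all_refuted L (P # Ps) (l # ls) = (refuted L P l \<and> all_refuted L Ps ls)"
| "all_refuted L _ _ = False"

fun step :: "num list list trie \<Rightarrow> pattern \<Rightarrow> num list \<Rightarrow> num \<Rightarrow> num \<Rightarrow> leaf list \<Rightarrow> bool" where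
  "step L P V n x ls = (x < n \<and> subcubic (adj P x) \<and> all_refuted L (children P V n x) ls)"

definition pattern_of :: "num list list \<Rightarrow> pattern" where
  "pattern_of F = symmetrize (bound num.One F) num.One F Tip"

text \<open>In a step \<open>(F, x, ls)\<close>, the list \<open>ls\<close> refutes one by one the patterns that arise from \<open>F\<close> by
  giving the vertex \<open>x\<close> one more neighbour; afterwards \<open>F\<close> is available as the \<open>j\<close>-th pattern.\<close>

fun check :: "num list list trie \<Rightarrow> num \<Rightarrow> (nat list list \<times> nat \<times> leaf list) list \<Rightarrow> bool" where
  "check L j [] = True"
| "check L j ((F, x, ls) # steps) =
     (step L (pattern_of (map nums F)) (labels num.One F) (bound num.One F) (num_of_nat x) ls \<and>
      check (store C3_pattern j (map nums F) L) (Num.inc j) steps)"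

text \<open>Labels 1 to 7 are a_0, ..., a_6 and labels 8 to 14 are b_0, ..., b_6; every edge is
  listed once, at its smaller end.\<close>

definition twoC7_pattern :: "num list list" where
  "twoC7_pattern = map nums [[2, 7, 8], [3, 12], [4, 9], [5, 13], [6, 10], [7, 14], [11],
     [9, 14], [10], [11], [12], [13], [14], []]"

text \<open>Labels 1 and 2 are a_0, a_1, labels 3 to 6 are b_0, ..., b_3 and labels 7 to 14 are c_0,
  ..., c_7.\<close>

definition W5_pattern :: "num list list" where
  "W5_pattern = map nums [[2, 3, 5], [4, 6], [7, 10], [9, 12], [11, 14], [8, 13],
     [8, 14], [9], [10], [11], [12], [13], [14], []]"

text \<open>The library begins with the possible outcomes of the search, under the keys 1, 2 and 3;
  the patterns of the certificate are numbered from 4 on.\<close>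

definition start :: "num list list trie" where
  "start = fill C3_pattern num.One [C3_pattern, twoC7_pattern, W5_pattern] Tip"

section \<open>Soundness of the checker\<close>

definition occurs_by :: "(num \<Rightarrow> 'a) \<Rightarrow> num set \<Rightarrow> pattern \<Rightarrow> 'a graph \<Rightarrow> bool" where
  "occurs_by \<phi> V P G \<longleftrightarrow> inj_on \<phi> V \<and> \<phi> ` V \<subseteq> verts G \<and>
     (\<forall>u\<in>V. \<forall>v\<in>set (adj P u). {\<phi> u, \<phi> v} \<in> edges G)"

definition wf_pattern :: "num set \<Rightarrow> pattern \<Rightarrow> bool" where
  "wf_pattern V P \<longleftrightarrow> finite V \<and> (\<forall>u. distinct (adj P u) \<and>
     (\<forall>v\<in>set (adj P u). u \<in> V \<and> v \<in> V \<and> v \<noteq> u \<and> u \<in> set (adj P v)))"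

lemma wf_patternD:
  assumes "wf_pattern V P"
  shows "finite V" and "distinct (adj P u)"
    and "v \<in> set (adj P u) \<Longrightarrow> u \<in> V"
    and "v \<in> set (adj P u) \<Longrightarrow> v \<in> V"
    and "v \<in> set (adj P u) \<Longrightarrow> v \<noteq> u"
    and "v \<in> set (adj P u) \<Longrightarrow> u \<in> set (adj P v)"
  using assms unfolding wf_pattern_def by blast+

lemma adj_join:
  assumes "x \<noteq> y"
  shows "adj (join P x y) u = (if u = x then y # adj P x else if u = y then x # adj P y else adj P u)"
  using assms by (simp add: join_def fetch_store)

lemma wf_join:
  assumes wf: "wf_pattern V P" and xy: "x \<in> V" "y \<in> V" "x \<noteq> y" "y \<notin> set (adj P x)"
  shows "wf_pattern V (join P x y)"
  unfolding wf_pattern_def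
proof (intro conjI allI ballI)
  show "finite V" using wf_patternD(1)[OF wf] .
  fix u
  have "x \<notin> set (adj P y)" using wf_patternD(6)[OF wf] xy(4) by blast
  then show "distinct (adj (join P x y) u)"
    using xy wf_patternD(2)[OF wf] by (simp add: adj_join)
  fix v assume "v \<in> set (adj (join P x y) u)"
  then consider "v \<in> set (adj P u)" | "u = x" "v = y" | "u = y" "v = x"
    using xy by (auto simp: adj_join split: if_splits)
  then show "u \<in> V" "v \<in> V" "v \<noteq> u" "u \<in> set (adj (join P x y) v)"
    by (cases; use xy wf_patternD(3-6)[OF wf] in \<open>force simp: adj_join\<close>)+
qed

lemma occurs_by_join:
  assumes "occurs_by \<phi> V P G" "x \<noteq> y" "{\<phi> x, \<phi> y} \<in> edges G"
  shows "occurs_by \<phi> V (join P x y) G"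
  using assms by (auto simp: occurs_by_def adj_join insert_commute)

lemma subcubic_iff: "subcubic vs \<longleftrightarrow> length vs < 3"
  by (cases vs rule: subcubic.cases) auto

lemma cubic_list_iff: "cubic_list vs \<longleftrightarrow> length vs = 3"
  by (cases vs rule: cubic_list.cases) auto

lemma set_candidates:
  "set (candidates P x ns V) = {z \<in> set V. length (adj P z) < 3 \<and> z \<noteq> x \<and> z \<notin> set ns}"
proof (induction V)
  case (Cons z V)
  have cons_if: "cons_if b y ys = (if b then y # ys else ys)" for b and y :: num and ys
    by (cases b) simp_all
  show ?case unfolding candidates.simps cons_if using Cons by (auto simp: subcubic_iff)
qed simp

lemma set_joins: "set (joins P x zs n) = join P x ` set zs \<union> {join P x n}"
  by (induction zs) auto

lemma set_hull: "set (hull P I) = set I \<union> (\<Union>u\<in>set I. set (adj P u))"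
  by (induction I) auto

lemma pick_if: "pick b x y = (if b then x else y)"
  by (cases b) simp_all

lemma outer_eq: "outer S vs d = d - length (filter (\<lambda>v. v \<notin> set S) vs)"
  by (induction vs arbitrary: d) (auto simp: pick_if)

lemma inner_eq: "inner S P us = (\<Sum>u\<leftarrow>us. 3 - length (filter (\<lambda>v. v \<notin> set S) (adj P u)))"
  by (induction us) (auto simp: outer_eq)

lemma disj_iff: "disj I vs \<longleftrightarrow> set I \<inter> set vs = {}"
  by (induction vs) auto

lemma full_iff:
  "full P I us \<longleftrightarrow> (\<forall>u\<in>set us. length (adj P u) = 3 \<and> set I \<inter> set (adj P u) = {})"
  by (induction us) (auto simp: cubic_list_iff disj_iff)

lemma less_inc: "k < Num.inc k" "k < n \<Longrightarrow> Num.inc k \<le> n" for k n :: num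
  by (simp_all add: less_num_def less_eq_num_def nat_of_num_inc)

lemma labels_props:
  "distinct (labels k xs)" "set (labels k xs) = {i. k \<le> i \<and> i < bound k xs}"
  "length (labels k xs) = length xs" "k \<le> bound k xs"
proof (induction xs arbitrary: k)
  case (Cons x xs)
  {
    case 1
    then show ?case using Cons less_inc(1)[of k] by auto
  next
    case 2
    then show ?case using Cons less_inc[of k] by (auto intro: less_le_trans order_less_imp_le order_antisym)
  next
    case 3
    then show ?case using Cons by simp
  next
    case 4
    then show ?case using Cons(4)[of "Num.inc k"] less_inc(1)[of k] by simp
  }
qed auto

text \<open>A list \<open>F\<close> of lists stands for the graph on the labels \<open>1, \<dots>, length F\<close> in which
  the \<open>i\<close>-th label is joined to the members of the \<open>i\<close>-th list.\<close>

definition occurs :: "(num \<Rightarrow> 'a) \<Rightarrow> num list list \<Rightarrow> 'a graph \<Rightarrow> bool" where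
  "occurs \<phi> F G \<longleftrightarrow> inj_on \<phi> (set (labels num.One F)) \<and> \<phi> ` set (labels num.One F) \<subseteq> verts G \<and>
     (\<forall>(u, vs)\<in>set (zip (labels num.One F) F). \<forall>v\<in>set vs. {\<phi> u, \<phi> v} \<in> edges G)"

text \<open>Every accepted entry of \<open>F\<close> becomes a \<open>join\<close> along an edge
  present in \<open>G\<close>, and a skipped entry only weakens the pattern; so well-formedness and
  occurrence are kept throughout \<open>symmetrize\<close>.\<close>

lemma pattern_of_occurs:
  assumes "occurs \<phi> F G"
  defines "V \<equiv> set (labels num.One F)"
  shows "wf_pattern V (pattern_of F)" "occurs_by \<phi> V (pattern_of F) G"
proof -
  have V: "v \<in> V \<longleftrightarrow> v < bound num.One F" for v
    by (simp add: V_def labels_props(2) less_eq_num_def nat_of_num_pos Suc_leI)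
  have nbrs: "wf_pattern V (add_nbrs (bound num.One F) k vs P) \<and> occurs_by \<phi> V (add_nbrs (bound num.One F) k vs P) G"
    if "k \<in> V" "wf_pattern V P" "occurs_by \<phi> V P G" "\<forall>v\<in>set vs. {\<phi> k, \<phi> v} \<in> edges G" for k vs P
    using that
  proof (induction vs arbitrary: P)
    case (Cons v vs)
    then show ?case by (simp add: pick_if V wf_join occurs_by_join)
  qed simp
  have "wf_pattern V (symmetrize (bound num.One F) k F' P) \<and> occurs_by \<phi> V (symmetrize (bound num.One F) k F' P) G"
    if "set (labels k F') \<subseteq> V" "wf_pattern V P" "occurs_by \<phi> V P G"
      "\<forall>(u, vs)\<in>set (zip (labels k F') F'). \<forall>v\<in>set vs. {\<phi> u, \<phi> v} \<in> edges G" for k F' P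
    using that
  proof (induction F' arbitrary: k P)
    case (Cons vs F')
    then show ?case using nbrs[of k P vs] by simp
  qed simp
  moreover have "wf_pattern V Tip" by (simp add: wf_pattern_def V_def)
  moreover have "occurs_by \<phi> V Tip G" using assms by (simp add: occurs_by_def occurs_def)
  ultimately show "wf_pattern V (pattern_of F)" "occurs_by \<phi> V (pattern_of F) G"
    unfolding pattern_of_def using assms(1) by (simp_all add: occurs_def V_def)
qed

section \<open>Soundness of embeddings\<close>

lemma unseen_iff: "unseen t us \<longleftrightarrow> distinct us \<and> (\<forall>u\<in>set us. \<not> fetch False u t)"
  by (induction us arbitrary: t) (auto simp: fetch_store)

lemma all_adj_iff: "all_adj M ws vs \<longleftrightarrow> (\<forall>v\<in>set vs. fetch num.One v M \<in> set ws)"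
  by (induction vs) auto

lemma nonempty_iff: "nonempty xs \<longleftrightarrow> xs \<noteq> []"
  by (cases xs) auto

lemma emb_iff:
  "emb P M us F \<longleftrightarrow> length us = length F \<and>
     (\<forall>(u, vs)\<in>set (zip us F). adj P u \<noteq> [] \<and> (\<forall>v\<in>set vs. fetch num.One v M \<in> set (adj P u)))"
  by (induction P M us F rule: emb.induct) (auto simp: all_adj_iff nonempty_iff)

lemma fetch_fill_below: "i < k \<Longrightarrow> fetch d i (fill d k xs t) = fetch d i t"
proof (induction xs arbitrary: k t)
  case (Cons x xs)
  then show ?case using less_inc(1)[of k] by (auto simp: fetch_store intro: less_trans)
qed simp

lemma map_fetch_fill: "map (\<lambda>i. fetch d i (fill d k xs t)) (labels k xs) = xs"
proof (induction xs arbitrary: k t)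
  case (Cons x xs)
  then show ?case by (simp add: fetch_store fetch_fill_below[OF less_inc(1)])
qed simp

lemma labels_cong: "length xs = length ys \<Longrightarrow> labels k xs = labels k ys"
  by (induction xs ys arbitrary: k rule: list_induct2) auto

text \<open>Occurrences compose: the labels of \<open>F\<close> go to labels of \<open>P\<close>
  through the list \<open>m\<close>, and from there to vertices of \<open>G\<close>.\<close>

lemma embedding_occurs:
  assumes wf: "wf_pattern V P" and P: "occurs_by \<phi> V P G" and emb: "embeds F m P"
  shows "\<exists>\<psi>. occurs \<psi> F G"
proof -
  define M where "M = fill num.One num.One m Tip"
  let ?f = "\<lambda>i. fetch num.One i M"
  have m: "distinct m" "emb P M m F" using emb by (auto simp: embeds_def unseen_iff M_def)
  have len: "length m = length F" using m(2) by (simp add: emb_iff)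
  have lab: "map ?f (labels num.One F) = m"
    using map_fetch_fill[of num.One num.One m Tip] labels_cong[OF len] by (simp add: M_def)
  have inj: "inj_on ?f (set (labels num.One F))"
    using m(1) lab by (metis distinct_map)
  have ran: "?f i \<in> V" if "i \<in> set (labels num.One F)" for i
  proof -
    have "?f i \<in> set m" using that lab by (metis image_eqI list.set_map)
    then obtain vs where "(?f i, vs) \<in> set (zip m F)" using len
      by (metis in_set_impl_in_set_zip1)
    then have "adj P (?f i) \<noteq> []" using m(2) by (auto simp: emb_iff)
    then show ?thesis using wf_patternD(3)[OF wf] by (metis hd_in_set)
  qed
  have "{\<phi> (?f u), \<phi> (?f v)} \<in> edges G"
    if "(u, vs) \<in> set (zip (labels num.One F) F)" "v \<in> set vs" for u vs v
  proof -
    have u: "u \<in> set (labels num.One F)" using that(1) by (rule set_zip_leftD)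
    have "(?f u, vs) \<in> set (zip m F)"
      using that(1) lab[symmetric] by (auto simp: zip_map1)
    then have "?f v \<in> set (adj P (?f u))" using m(2) that(2) by (auto simp: emb_iff)
    then show ?thesis using P ran[OF u] by (simp add: occurs_by_def)
  qed
  moreover have "inj_on (\<phi> \<circ> ?f) (set (labels num.One F))"
  proof (rule comp_inj_on[OF inj])
    show "inj_on \<phi> (?f ` set (labels num.One F))"
      using P ran by (auto simp: occurs_by_def intro: inj_on_subset)
  qed
  moreover have "(\<phi> \<circ> ?f) ` set (labels num.One F) \<subseteq> verts G"
    using P ran by (auto simp: occurs_by_def)
  ultimately have "occurs (\<phi> \<circ> ?f) F G" by (auto simp: occurs_def)
  then show ?thesis by blast
qed

text \<open>These are all the properties of \<open>G\<close> that the search uses. Connectedness and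
  the absence of triangles matter only afterwards, when the outcomes are interpreted.\<close>

locale tight_cubic =
  fixes G :: "'a graph"
  assumes graph: "is_graph G" and cubic: "regular 3 G"
    and tight: "\<And>I. independent G I \<Longrightarrow>
      35 * card I \<le> 8 * card (closed_nbhd G I) + 3 * card {e \<in> edges G. e \<subseteq> closed_nbhd G I}"
begin

lemma card_nbrs: "x \<in> verts G \<Longrightarrow> card (nbrs G x) = 3"
  using cubic by (simp add: regular_def degree_def)

lemma finite_nbrs: "finite (nbrs G x)"
  using finite_subset[OF nbrs_subset[OF graph]] graph by (simp add: is_graph_def)

lemma card_adj:
  assumes P: "wf_pattern V P" "occurs_by \<phi> V P G" and u: "u \<in> V"
  shows "\<phi> ` set (adj P u) \<subseteq> nbrs G (\<phi> u)" "card (\<phi> ` set (adj P u)) = length (adj P u)"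
    "card (nbrs G (\<phi> u)) = 3"
proof -
  show "\<phi> ` set (adj P u) \<subseteq> nbrs G (\<phi> u)"
    using P(2) u by (auto simp: occurs_by_def nbrs_def)
  have "inj_on \<phi> (set (adj P u))"
    using P(2) wf_patternD(4)[OF P(1)] unfolding occurs_by_def by (meson inj_on_subset subsetI)
  then show "card (\<phi> ` set (adj P u)) = length (adj P u)"
    using wf_patternD(2)[OF P(1)] by (simp add: card_image distinct_card)
  show "card (nbrs G (\<phi> u)) = 3"
    using P(2) u by (intro card_nbrs) (auto simp: occurs_by_def)
qed

lemma nbrs_full:
  assumes P: "wf_pattern V P" "occurs_by \<phi> V P G" and u: "u \<in> V" "length (adj P u) = 3"
  shows "nbrs G (\<phi> u) = \<phi> ` set (adj P u)"
  using card_subset_eq[OF finite_nbrs card_adj(1)[OF P u(1)]] card_adj(2,3)[OF P u(1)] u(2) by simp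

text \<open>Fewer than three neighbours of \<open>x\<close> are known, so the cubic graph supplies
  one more, \<open>y\<close>. If \<open>y\<close> already carries a label, the occurrence extends
  along the new edge; otherwise \<open>y\<close> receives the label \<open>n\<close>.\<close>

lemma children_occur:
  assumes P: "wf_pattern (set V) P" "occurs_by \<phi> (set V) P G"
    and x: "x \<in> set V" "length (adj P x) < 3" and n: "n \<notin> set V"
  shows "\<exists>Q\<in>set (children P V n x). \<exists>W \<psi>. wf_pattern W Q \<and> occurs_by \<psi> W Q G"
proof -
  have \<phi>: "inj_on \<phi> (set V)" "\<phi> ` set V \<subseteq> verts G" using P(2) by (auto simp: occurs_by_def)
  have "\<not> nbrs G (\<phi> x) \<subseteq> \<phi> ` set (adj P x)"
    using x(2) card_adj(2,3)[OF P x(1)] card_mono[of "\<phi> ` set (adj P x)" "nbrs G (\<phi> x)"] by auto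
  then obtain y where y: "y \<in> nbrs G (\<phi> x)" "y \<notin> \<phi> ` set (adj P x)" by blast
  then have e: "{\<phi> x, y} \<in> edges G" by (simp add: nbrs_def)
  show ?thesis
  proof (cases "y \<in> \<phi> ` set V")
    case True
    then obtain z where z: "z \<in> set V" "y = \<phi> z" by auto
    have zx: "z \<noteq> x" "z \<notin> set (adj P x)" using e y z edge_verts(3)[OF graph] by auto
    \<comment> \<open>Three known neighbours of \<open>z\<close> would be all of its neighbours;
      \<open>x\<close> would be among them, and the edge would not be missing. This justifies
      branching over \<open>subcubic\<close> labels only.\<close>
    have "length (adj P z) \<noteq> 3"
    proof
      assume "length (adj P z) = 3"
      then have "\<phi> x \<in> \<phi> ` set (adj P z)"
        using nbrs_full[OF P z(1)] e z(2) by (auto simp: nbrs_def insert_commute)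
      then obtain w where "w \<in> set (adj P z)" "\<phi> x = \<phi> w" by auto
      then have "x \<in> set (adj P z)"
        using inj_onD[OF \<phi>(1), of x w] x(1) wf_patternD(4)[OF P(1)] by auto
      then show False using wf_patternD(6)[OF P(1)] zx(2) by blast
    qed
    moreover have "length (adj P z) \<le> 3"
      using card_mono[OF finite_nbrs card_adj(1)[OF P z(1)]] card_adj(2,3)[OF P z(1)] by simp
    ultimately have "join P x z \<in> set (children P V n x)"
      using z zx by (auto simp: children_def set_joins set_candidates)
    moreover have "wf_pattern (set V) (join P x z)" "occurs_by \<phi> (set V) (join P x z) G"
      using P x(1) z e zx by (simp_all add: wf_join occurs_by_join)
    ultimately show ?thesis by blast
  next
    case False
    let ?W = "insert n (set V)" and ?\<psi> = "\<phi>(n := y)"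
    \<comment> \<open>Taking \<open>n\<close> in as an isolated label first lets \<open>join\<close>
      treat the new vertex like an old one.\<close>
    have "wf_pattern ?W P" using P(1) unfolding wf_pattern_def by blast
    moreover have "occurs_by ?\<psi> ?W P G"
    proof -
      have "inj_on ?\<psi> ?W" using \<phi>(1) False n by (auto simp: inj_on_def)
      moreover have "y \<in> verts G" using e edge_verts(2)[OF graph] by blast
      moreover have "{?\<psi> u, ?\<psi> v} \<in> edges G" if "v \<in> set (adj P u)" for u v
      proof -
        have "u \<in> set V" "v \<in> set V" using wf_patternD(3,4)[OF P(1) that] by auto
        then show ?thesis using P(2) that n by (auto simp: occurs_by_def)
      qed
      ultimately show ?thesis using \<phi>(2) by (auto simp: occurs_by_def)
    qed
    moreover have "n \<notin> set (adj P x)" "x \<noteq> n"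
      using wf_patternD(4)[OF P(1)] n x(1) by auto
    ultimately have "wf_pattern ?W (join P x n)" "occurs_by ?\<psi> ?W (join P x n) G"
      using x(1) e by (simp_all add: wf_join occurs_by_join)
    then show ?thesis by (auto simp: children_def set_joins)
  qed
qed

text \<open>The handshake identity in the subgraph induced by \<open>S\<close>, where both edge sets
  of \<open>degree_sum\<close> coincide. The empty set is treated apart because graphs are
  non-empty.\<close>

lemma inner_degree_sum:
  assumes "S \<subseteq> verts G"
  shows "2 * card {e \<in> edges G. e \<subseteq> S} = (\<Sum>v\<in>S. card (nbrs G v \<inter> S))"
proof (cases "S = {}")
  case True
  have "{} \<notin> edges G" using graph by (auto simp: is_graph_def)
  then show ?thesis using True by (simp add: card_eq_0_iff)
next
  case False
  let ?H = "induced G S"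
  have H: "is_graph ?H"
    using False assms by (intro subgraph_is_graph[OF subgraph_induced[OF graph]]) blast
  have fin: "finite S" using assms graph finite_subset by (auto simp: is_graph_def)
  have "degree ?H v = card (nbrs G v \<inter> S)" if "v \<in> S" for v
    using that by (simp add: degree_def nbrs_def induced_def Int_def)
  moreover have "e \<noteq> {}" if "e \<in> edges G" for e using that graph by (auto simp: is_graph_def)
  then have "{e \<in> edges ?H. e \<inter> S \<noteq> {}} = {e \<in> edges G. e \<subseteq> S}"
    unfolding induced_def graph.sel by blast
  moreover have "{e \<in> edges ?H. e \<subseteq> S} = {e \<in> edges G. e \<subseteq> S}"
    by (simp add: induced_def)
  ultimately show ?thesis using degree_sum[OF H fin] by simp
qed

text \<open>For a dense pattern the left side and the 8|S| term of \<open>tight\<close> are known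
  exactly, while the number of edges inside S can only be overestimated, by letting every unknown
  neighbour fall into S. Even with this allowance the inequality fails.\<close>

lemma not_dense:
  assumes P: "wf_pattern V P" "occurs_by \<phi> V P G"
  shows "\<not> dense P I"
proof
  assume "dense P I"
  then have I: "distinct I"
    "\<And>u. u \<in> set I \<Longrightarrow> length (adj P u) = 3" "\<And>u. u \<in> set I \<Longrightarrow> set I \<inter> set (adj P u) = {}"
    by (auto simp: dense_def full_iff)
  have IV: "u \<in> V" if "u \<in> set I" for u
    using I(2)[OF that] wf_patternD(3)[OF P(1), of "hd (adj P u)" u]
    by (cases "adj P u") auto
  define S where "S = remdups (hull P I)"
  have big: "8 * length S + 3 * (inner S P S div 2) < 35 * length I"
    using \<open>dense P I\<close> by (simp add: dense_def S_def)
  have inj: "inj_on \<phi> V" and \<phi>: "\<phi> ` V \<subseteq> verts G"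
    using P(2) by (auto simp: occurs_by_def)
  have subS: "set S \<subseteq> V"
    using IV wf_patternD(4)[OF P(1)] by (auto simp: S_def set_hull)
  have subI: "set I \<subseteq> V" using IV by auto
  have N: "nbrs G (\<phi> u) = \<phi> ` set (adj P u)" if "u \<in> set I" for u
    using nbrs_full[OF P IV[OF that] I(2)[OF that]] .
  have nbhd: "closed_nbhd G (\<phi> ` set I) = \<phi> ` set S"
    using N by (auto simp: closed_nbhd_def S_def set_hull)
  \<comment> \<open>Independence is a statement about absent edges; it is available because the
    neighbourhoods of the members of \<open>I\<close> are completely known.\<close>
  have "independent G (\<phi> ` set I)"
  proof -
    have "{\<phi> u, \<phi> v} \<notin> edges G" if "u \<in> set I" "v \<in> set I" for u v
    proof
      assume "{\<phi> u, \<phi> v} \<in> edges G"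
      then have "\<phi> v \<in> \<phi> ` set (adj P u)" using N[OF that(1)] by (auto simp: nbrs_def)
      moreover have "set (adj P u) \<subseteq> V" using wf_patternD(4)[OF P(1)] by blast
      ultimately have "v \<in> set (adj P u)"
        using inj subI that(2) by (meson inj_on_image_mem_iff subsetD)
      then show False using I(3)[OF that(1)] that(2) by blast
    qed
    moreover have "\<phi> ` set I \<subseteq> verts G" using subI \<phi> by blast
    ultimately show ?thesis by (auto simp: independent_def)
  qed
  then have "35 * card (\<phi> ` set I) \<le>
      8 * card (\<phi> ` set S) + 3 * card {e \<in> edges G. e \<subseteq> \<phi> ` set S}"
    unfolding nbhd[symmetric] by (rule tight)
  moreover have "card (\<phi> ` set I) = length I"
    using I(1) inj_on_subset[OF inj subI] by (simp add: card_image distinct_card)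
  moreover have "card (\<phi> ` set S) = length S"
    using inj_on_subset[OF inj subS] by (simp add: card_image S_def length_remdups_card_conv)
  moreover have "2 * card {e \<in> edges G. e \<subseteq> \<phi> ` set S} \<le> inner S P S"
  proof -
    have le: "card (nbrs G (\<phi> u) \<inter> \<phi> ` set S) \<le> 3 - length (filter (\<lambda>v. v \<notin> set S) (adj P u))"
      if u: "u \<in> set S" for u
    proof -
      let ?out = "filter (\<lambda>v. v \<notin> set S) (adj P u)"
      have u': "u \<in> V" using u subS by auto
      have Pu: "set (adj P u) \<subseteq> V" "distinct (adj P u)"
        using wf_patternD(2,4)[OF P(1)] by auto
      have "\<phi> ` set ?out \<subseteq> nbrs G (\<phi> u) - \<phi> ` set S"
      proof
        fix w assume "w \<in> \<phi> ` set ?out"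
        then obtain v where v: "v \<in> set (adj P u)" "v \<notin> set S" "w = \<phi> v" by auto
        then have "w \<in> nbrs G (\<phi> u)" using P(2) u' by (auto simp: occurs_by_def nbrs_def)
        moreover have "w \<notin> \<phi> ` set S"
          using v Pu(1) subS inj by (metis inj_on_image_mem_iff subsetD)
        ultimately show "w \<in> nbrs G (\<phi> u) - \<phi> ` set S" by blast
      qed
      then have "card (\<phi> ` set ?out) \<le> card (nbrs G (\<phi> u) - \<phi> ` set S)"
        by (intro card_mono) (simp_all add: finite_nbrs)
      moreover have "inj_on \<phi> (set ?out)" by (rule inj_on_subset[OF inj]) (use Pu in auto)
      then have "card (\<phi> ` set ?out) = length ?out"
        using Pu(2) by (simp add: card_image distinct_card del: set_filter)
      moreover have "card (nbrs G (\<phi> u) \<inter> \<phi> ` set S) + card (nbrs G (\<phi> u) - \<phi> ` set S) = 3"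
        using card_Int_Diff[OF finite_nbrs, of "\<phi> u" "\<phi> ` set S"] card_nbrs[of "\<phi> u"] u' \<phi> by auto
      ultimately show ?thesis by linarith
    qed
    have "\<phi> ` set S \<subseteq> verts G" using subS \<phi> by blast
    then have "2 * card {e \<in> edges G. e \<subseteq> \<phi> ` set S} =
        (\<Sum>u\<in>set S. card (nbrs G (\<phi> u) \<inter> \<phi> ` set S))"
      by (simp add: inner_degree_sum sum.reindex[OF inj_on_subset[OF inj subS]])
    also have "\<dots> \<le> (\<Sum>u\<in>set S. 3 - length (filter (\<lambda>v. v \<notin> set S) (adj P u)))"
      by (rule sum_mono) (rule le)
    also have "\<dots> = inner S P S"
      by (simp add: inner_eq S_def sum_list_distinct_conv_sum_set del: set_remdups)
    finally show ?thesis .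
  qed
  \<comment> \<open>Rounding down is sound because the number of edges is an integer.\<close>
  then have "card {e \<in> edges G. e \<subseteq> \<phi> ` set S} \<le> inner S P S div 2" by linarith
  ultimately show False using big by linarith
qed

lemma refuted_sound:
  assumes "wf_pattern V P" "occurs_by \<phi> V P G" "refuted L P l"
  shows "\<exists>j \<psi>. occurs \<psi> (fetch C3_pattern j L) G"
proof (cases l)
  case (Dense I)
  then show ?thesis using not_dense[OF assms(1,2)] assms(3) by simp
next
  case (Sub j m)
  then have "embeds (fetch C3_pattern (num_of_nat j) L) (nums m) P" using assms(3) by simp
  then show ?thesis using embedding_occurs[OF assms(1,2)] by blast
qed

lemma all_refuted_sound:
  assumes "all_refuted L Qs ls" "Q \<in> set Qs" "wf_pattern V Q" "occurs_by \<phi> V Q G"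
  shows "\<exists>j \<psi>. occurs \<psi> (fetch C3_pattern j L) G"
  using assms
proof (induction L Qs ls rule: all_refuted.induct)
  case (2 L P Ps l ls)
  then show ?case using refuted_sound[of V Q \<phi> L l] by auto
qed auto

text \<open>Since the initial entries are outcomes and not contradictions, soundness says that a
  pattern of the certificate forces some entry of the library with which the run began. The library
  grows along the list, so the induction generalises over it.\<close>

theorem check_sound:
  assumes "check L j steps" "(F, x, ls) \<in> set steps" "occurs \<phi> (map nums F) G"
  shows "\<exists>j \<psi>. occurs \<psi> (fetch C3_pattern j L) G"
  using assms
proof (induction steps arbitrary: L j F x ls \<phi>)
  case (Cons s steps)
  obtain F' x' ls' where s: "s = (F', x', ls')" by (cases s)
  let ?F = "map nums F'"
  have c: "step L (pattern_of ?F) (labels num.One F') (bound num.One F') (num_of_nat x') ls'"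
    "check (store C3_pattern j ?F L) (Num.inc j) steps" using Cons.prems(1) s by auto
  have lab: "labels num.One F' = labels num.One ?F" by (rule labels_cong) simp
  have first: "\<exists>j \<psi>. occurs \<psi> (fetch C3_pattern j L) G" if F': "occurs \<psi> ?F G" for \<psi>
  proof -
    have "\<exists>Q\<in>set (children (pattern_of ?F) (labels num.One F') (bound num.One F') (num_of_nat x')).
        \<exists>W \<psi>. wf_pattern W Q \<and> occurs_by \<psi> W Q G"
      using pattern_of_occurs[OF F'] c(1) unfolding lab[symmetric]
      by (intro children_occur[of _ _ \<psi>])
        (auto simp: subcubic_iff labels_props(2) less_eq_num_def nat_of_num_pos Suc_leI)
    then show ?thesis using c(1) all_refuted_sound by fastforce
  qed
  show ?case
  proof (cases "(F, x, ls) = s")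
    case True
    then show ?thesis using first Cons.prems(3) s by blast
  next
    case False
    then have "(F, x, ls) \<in> set steps" using Cons.prems(2) by auto
    from Cons.IH[OF c(2) this Cons.prems(3)]
    obtain k \<psi> where "occurs \<psi> (fetch C3_pattern k (store C3_pattern j ?F L)) G" by blast
    \<comment> \<open>If the entry that was found is the one stored by the present step,
      \<open>first\<close> trades it for an entry of \<open>L\<close>.\<close>
    then show ?thesis using first by (auto simp: fetch_store split: if_splits)
  qed
qed simp

end

section \<open>The closed patterns\<close>

text \<open>When all labels have three known neighbours, no edge of \<open>G\<close> leaves the
  image of \<open>V\<close>, and connectedness makes that image the whole vertex set. Only here do
  missing pattern edges become genuine non-edges.\<close>

lemma closed_pattern:
  assumes G: "is_graph G" "regular 3 G" "connected G"
    and P: "wf_pattern V P" "occurs_by \<phi> V P G" and V: "V \<noteq> {}" "\<And>u. u \<in> V \<Longrightarrow> length (adj P u) = 3"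
  shows "\<phi> ` V = verts G"
    and "u \<in> V \<Longrightarrow> v \<in> V \<Longrightarrow> {\<phi> u, \<phi> v} \<in> edges G \<longleftrightarrow> v \<in> set (adj P u)"
proof -
  have \<phi>: "inj_on \<phi> V" "\<phi> ` V \<subseteq> verts G" using P(2) by (auto simp: occurs_by_def)
  have nb: "nbrs G (\<phi> u) = \<phi> ` set (adj P u)" if "u \<in> V" for u
  proof -
    have "\<phi> ` set (adj P u) \<subseteq> nbrs G (\<phi> u)" using P(2) that by (auto simp: occurs_by_def nbrs_def)
    moreover have "finite (nbrs G (\<phi> u))"
      using finite_subset[OF nbrs_subset[OF G(1)]] G(1) by (simp add: is_graph_def)
    moreover have "card (nbrs G (\<phi> u)) = 3" using G(2) \<phi>(2) that by (auto simp: regular_def degree_def)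
    moreover have "inj_on \<phi> (set (adj P u))"
      using \<phi>(1) wf_patternD(4)[OF P(1)] by (meson inj_on_subset subsetI)
    then have "card (\<phi> ` set (adj P u)) = 3"
      using V(2)[OF that] wf_patternD(2)[OF P(1)] by (simp add: card_image distinct_card)
    ultimately show ?thesis using card_subset_eq by metis
  qed
  show "{\<phi> u, \<phi> v} \<in> edges G \<longleftrightarrow> v \<in> set (adj P u)" if "u \<in> V" "v \<in> V"
  proof -
    have "{\<phi> u, \<phi> v} \<in> edges G \<longleftrightarrow> \<phi> v \<in> \<phi> ` set (adj P u)"
      using nb[OF that(1)] by (auto simp: nbrs_def)
    also have "\<dots> \<longleftrightarrow> v \<in> set (adj P u)"
      using inj_on_image_mem_iff[OF \<phi>(1) that(2)] wf_patternD(4)[OF P(1)] by blast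
    finally show ?thesis .
  qed
  obtain u0 where u0: "u0 \<in> V" using V(1) by blast
  have reach: "y \<in> \<phi> ` V" if "(\<phi> u0, y) \<in> {(u, v). {u, v} \<in> edges G}\<^sup>*" for y
    using that
  proof induction
    case base
    show ?case using u0 by blast
  next
    case (step y z)
    then obtain u where u: "u \<in> V" "y = \<phi> u" by blast
    have "z \<in> nbrs G (\<phi> u)" using step.hyps(2) u(2) by (simp add: nbrs_def)
    then show ?case using nb[OF u(1)] wf_patternD(4)[OF P(1)] by blast
  qed
  have "\<phi> u0 \<in> verts G" using u0 \<phi>(2) by blast
  then have "verts G \<subseteq> \<phi> ` V" using G(3) reach unfolding connected_def by blast
  then show "\<phi> ` V = verts G" using \<phi>(2) by blast
qed

text \<open>The closed patterns as plain lists over \<open>nat\<close>: computed once, they let the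
  simplifier compare edge sets without unfolding tries.\<close>

definition adjacency :: "num list list \<Rightarrow> (nat \<times> nat list) list" where
  "adjacency F = map (\<lambda>u. (nat_of_num u, map nat_of_num (adj (pattern_of F) u))) (labels num.One F)"

lemma closed_pattern_isomorphic:
  assumes G: "is_graph G" "regular 3 G" "connected G"
    and occ: "occurs \<phi> F G" and ne: "F \<noteq> []"
    and cub: "\<forall>(i, js)\<in>set (adjacency F). length js = 3"
    and label: "inj_on label (fst ` set (adjacency F))" "label ` fst ` set (adjacency F) = verts H"
    and edges: "edges H = (\<Union>(i, js)\<in>set (adjacency F). (\<lambda>j. {label i, label j}) ` set js)"
  shows "G \<cong> H"
proof -
  let ?P = "pattern_of F"
  define V where "V = set (labels num.One F)"
  define g where "g = label \<circ> nat_of_num"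
  have P: "wf_pattern V ?P" "occurs_by \<phi> V ?P G"
    using pattern_of_occurs[OF occ] by (simp_all add: V_def)
  have A: "set (adjacency F) = (\<lambda>u. (nat_of_num u, map nat_of_num (adj ?P u))) ` V"
    by (simp add: V_def adjacency_def)
  have "inj_on nat_of_num V" by (rule inj_onI) (simp add: num_eq_iff)
  then have g: "inj_on g V" "g ` V = verts H"
    using label by (auto simp: A g_def image_image intro!: comp_inj_on)
  have edges: "edges H = (\<Union>u\<in>V. (\<lambda>v. {g u, g v}) ` set (adj ?P u))"
    unfolding edges A by (simp add: g_def image_image)
  have "V \<noteq> {}" using ne by (cases F) (auto simp: V_def)
  moreover have "length (adj ?P u) = 3" if "u \<in> V" for u using cub that by (auto simp: A)
  ultimately have img: "\<phi> ` V = verts G"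
    and e: "\<And>u v. u \<in> V \<Longrightarrow> v \<in> V \<Longrightarrow> {\<phi> u, \<phi> v} \<in> edges G \<longleftrightarrow> v \<in> set (adj ?P u)"
    using closed_pattern[OF G P] by blast+
  have eH: "{g u, g v} \<in> edges H \<longleftrightarrow> v \<in> set (adj ?P u)" if "u \<in> V" "v \<in> V" for u v
  proof
    assume "{g u, g v} \<in> edges H"
    then obtain u' v' where uv: "u' \<in> V" "v' \<in> set (adj ?P u')" "{g u, g v} = {g u', g v'}"
      by (auto simp: edges)
    then have "v' \<in> V" using wf_patternD(4)[OF P(1)] by blast
    then have "u = u' \<and> v = v' \<or> u = v' \<and> v = u'"
      using uv that inj_onD[OF g(1)] by (auto simp: doubleton_eq_iff)
    then show "v \<in> set (adj ?P u)" using uv(2) wf_patternD(6)[OF P(1)] by blast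
  next
    assume "v \<in> set (adj ?P u)"
    then show "{g u, g v} \<in> edges H" using that by (auto simp: edges)
  qed
  have inj: "inj_on \<phi> V" using P(2) by (simp add: occurs_by_def)
  \<comment> \<open>The isomorphism reads off the label of a vertex of \<open>G\<close> and then
    takes the vertex of \<open>H\<close> that bears this label.\<close>
  let ?h = "inv_into V \<phi>"
  have h: "bij_betw ?h (verts G) V"
    using inj img by (intro bij_betw_inv_into) (simp add: bij_betw_def)
  have "bij_betw (g \<circ> ?h) (verts G) (verts H)"
    using g by (intro bij_betw_trans[OF h]) (simp add: bij_betw_def)
  moreover have "{x, y} \<in> edges G \<longleftrightarrow> {(g \<circ> ?h) x, (g \<circ> ?h) y} \<in> edges H"
    if "x \<in> verts G" "y \<in> verts G" for x y
  proof -
    have "x \<in> \<phi> ` V" "y \<in> \<phi> ` V" using that by (simp_all add: img)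
    then obtain u v where "u \<in> V" "v \<in> V" "x = \<phi> u" "y = \<phi> v" by (elim imageE)
    then show ?thesis using e[of u v] eH[of u v] inv_into_f_f[OF inj] by simp
  qed
  ultimately show ?thesis unfolding isomorphic_def by (intro exI[of _ "g \<circ> ?h"]) simp
qed

section \<open>Recognising the two target graphs\<close>

lemma set_below: "{f i | i. i < n} = f ` {..<n}" for n :: nat
  by auto

definition twoC7_label :: "nat \<Rightarrow> vertex" where
  "twoC7_label i = (if i \<le> 7 then Va (i - 1) else Vb (i - 8))"

definition W5_label :: "nat \<Rightarrow> vertex" where
  "W5_label i = (if i \<le> 2 then Va (i - 1) else if i \<le> 6 then Vb (i - 3) else Vc (i - 7))"

lemma adjacency_twoC7:
  "adjacency twoC7_pattern =
     [(1, [8, 7, 2]), (2, [12, 3, 1]), (3, [9, 4, 2]), (4, [13, 5, 3]), (5, [10, 6, 4]), (6,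
      [14, 7, 5]), (7, [11, 6, 1]), (8, [14, 9, 1]), (9, [10, 8, 3]), (10, [11, 9, 5]), (11,
      [12, 10, 7]), (12, [13, 11, 2]), (13, [14, 12, 4]), (14, [13, 8, 6])]"
  by code_simp

lemma adjacency_W5:
  "adjacency W5_pattern =
     [(1, [5, 3, 2]), (2, [6, 4, 1]), (3, [10, 7, 1]), (4, [12, 9, 2]), (5, [14, 11, 1]), (6,
      [13, 8, 2]), (7, [14, 8, 3]), (8, [9, 7, 6]), (9, [10, 8, 4]), (10, [11, 9, 3]), (11,
      [12, 10, 5]), (12, [13, 11, 4]), (13, [14, 12, 6]), (14, [13, 7, 5])]"
  by code_simp

lemma lessThan_explicit:
  "{..<2::nat} = {0, 1}" "{..<4::nat} = {0, 1, 2, 3}" "{..<7::nat} = {0, 1, 2, 3, 4, 5, 6}"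
  "{..<8::nat} = {0, 1, 2, 3, 4, 5, 6, 7}"
  by auto

lemma occurs_twoC7:
  assumes "is_graph G" "regular 3 G" "connected G" "occurs \<phi> twoC7_pattern G"
  shows "G \<cong> twoC7"
proof (rule closed_pattern_isomorphic[OF assms, where label = twoC7_label])
  show "twoC7_pattern \<noteq> []" by (simp add: twoC7_pattern_def)
  show "\<forall>(i, js)\<in>set (adjacency twoC7_pattern). length js = 3"
    by (simp add: adjacency_twoC7)
  show "inj_on twoC7_label (fst ` set (adjacency twoC7_pattern))"
    by (simp add: adjacency_twoC7 twoC7_label_def)
  show "twoC7_label ` fst ` set (adjacency twoC7_pattern) = verts twoC7"
    by (auto simp: adjacency_twoC7 twoC7_label_def twoC7_def lessThan_explicit)
  have "edges twoC7 \<subseteq> (\<Union>(i, js)\<in>set (adjacency twoC7_pattern). (\<lambda>j. {twoC7_label i, twoC7_label j}) ` set js)"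
    by (simp add: adjacency_twoC7 twoC7_label_def twoC7_def cycle_edges_def set_below lessThan_explicit doubleton_eq_iff)
  moreover have "(\<Union>(i, js)\<in>set (adjacency twoC7_pattern). (\<lambda>j. {twoC7_label i, twoC7_label j}) ` set js) \<subseteq> edges twoC7"
    by (simp add: adjacency_twoC7 twoC7_label_def twoC7_def cycle_edges_def set_below lessThan_explicit doubleton_eq_iff)
  ultimately show "edges twoC7 = (\<Union>(i, js)\<in>set (adjacency twoC7_pattern).
      (\<lambda>j. {twoC7_label i, twoC7_label j}) ` set js)" by (rule equalityI)
qed

lemma occurs_W5:
  assumes "is_graph G" "regular 3 G" "connected G" "occurs \<phi> W5_pattern G"
  shows "G \<cong> W5"
proof (rule closed_pattern_isomorphic[OF assms, where label = W5_label])
  show "W5_pattern \<noteq> []" by (simp add: W5_pattern_def)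
  show "\<forall>(i, js)\<in>set (adjacency W5_pattern). length js = 3"
    by (simp add: adjacency_W5)
  show "inj_on W5_label (fst ` set (adjacency W5_pattern))"
    by (simp add: adjacency_W5 W5_label_def)
  show "W5_label ` fst ` set (adjacency W5_pattern) = verts W5"
    by (auto simp: adjacency_W5 W5_label_def W5_def lessThan_explicit)
  have "edges W5 \<subseteq> (\<Union>(i, js)\<in>set (adjacency W5_pattern). (\<lambda>j. {W5_label i, W5_label j}) ` set js)"
    by (simp add: adjacency_W5 W5_label_def W5_def cycle_edges_def set_below lessThan_explicit doubleton_eq_iff)
  moreover have "(\<Union>(i, js)\<in>set (adjacency W5_pattern). (\<lambda>j. {W5_label i, W5_label j}) ` set js) \<subseteq> edges W5"
    by (simp add: adjacency_W5 W5_label_def W5_def cycle_edges_def set_below lessThan_explicit doubleton_eq_iff)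
  ultimately show "edges W5 = (\<Union>(i, js)\<in>set (adjacency W5_pattern).
      (\<lambda>j. {W5_label i, W5_label j}) ` set js)" by (rule equalityI)
qed

lemma not_occurs_C3:
  assumes "triangle_free G"
  shows "\<not> occurs \<phi> C3_pattern G"
  using assms by (auto simp: occurs_def C3_pattern_def triangle_free_def)

text \<open>Key 2 holds the pattern of \<open>twoC7\<close> and key 3 that of \<open>W5\<close>; at
  every other key the stored entry or the default is the triangle.\<close>

lemma fetch_start: "fetch C3_pattern j start \<in> {C3_pattern, twoC7_pattern, W5_pattern}"
  unfolding start_def fill.simps fetch_store by simp

section \<open>The certificate\<close>

text \<open>The list is the search tree in post-order: the last leaf of a step, for the fresh
  vertex, normally points to the entry just before it. Four entries mark its main stages. Number 9
  is a 4-cycle with a pendant edge, number 43 two 5-cycles sharing a path of length two, number 80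
  two 5-cycles sharing an edge, with a pendant edge at the vertex opposite to it, and number 130 a
  5-cycle with a pendant edge. Once a stage is complete, later branches that would create its
  configuration are cut off at once. The graph \<open>W5\<close> turns up at number 24, inside the
  stage of 43. The division into twelve definitions only limits the size of the terms.\<close>

definition steps1 :: "(nat list list \<times> nat \<times> leaf list) list" where
  "steps1 = [
   ([[2,4],[3,5],[4,6],[],[6,7],[],[]], 1, [Dense [1,3], Dense [1,3], Dense [1,3,5]]),
   ([[2,4,9],[3,5],[4,8],[],[6,7],[],[],[],[]], 4, [Dense [2,4], Dense [2,4], Sub 1 [3,4,8],
   Sub 1 [1,4,9], Dense [2,4]]),
   ([[2,4],[3,5],[4,8],[],[6,7],[],[],[]], 1, [Sub 4 [5,2,1,6,3,4,8], Sub 4 [5,2,1,7,3,4,8],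
   Dense [1,3], Sub 5 [1,2,3,4,5,6,7,8,9]]),
   ([[2,4],[3,5],[4],[],[6,7],[],[]], 3, [Sub 1 [1,2,3], Sub 4 [1,2,3,4,5,6,7], Sub 4 [1,2,3,4,5,7,
   6], Sub 6 [1,2,3,4,5,6,7,8]]),
   ([[2,4],[3,5],[4],[],[6],[]], 5, [Sub 1 [1,2,5], Sub 1 [2,3,5], Dense [2,4], Sub 7 [1,2,3,4,5,6,
   7]]),
   ([[2,4],[3,5],[4],[],[]], 5, [Sub 1 [1,2,5], Sub 1 [2,3,5], Dense [2,4], Sub 8 [1,2,3,4,5,6]]),
   ([[2,10],[3,9],[4],[5,8],[7],[7,10],[9],[],[],[]], 10, [Sub 5 [2,3,10,1,4,5,8,6,9], Sub 5 [7,5,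
   10,6,4,3,8,1,9], Dense [2,4,7,10], Sub 4 [7,9,10,6,2,1,3], Dense [2,4,7,10]]),
   ([[2,5,11],[9],[4,6],[5,8],[],[7,10],[9],[12,13],[14],[],[],[14],[],[]], 12, [Sub 5 [9,2,12,14,
   1,5,11,8,7], Sub 5 [4,3,12,8,6,7,10,14,5], Sub 5 [4,5,12,8,1,2,11,14,3], Sub 5 [9,7,12,14,6,3,
   10,8,2], Sub 10 [3,6,7,9,14,8,12,2,10,4], Sub 10 [2,1,5,4,8,14,12,3,11,9], Sub 1 [8,12,13],
   Dense [1,4,6,9,12]]),
   ([[2,5,11],[9],[4,6],[5,8],[],[7,10],[9],[12,13],[14],[12],[],[],[],[]], 12, [Sub 10 [3,4,5,1,2,
   10,12,11,8,6], Sub 4 [6,3,12,10,4,8,5], Sub 5 [4,5,12,8,1,2,11,10,3], Sub 5 [6,7,12,10,9,2,14,8,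
   3], Sub 10 [3,4,5,1,11,10,12,2,8,6], Sub 1 [8,12,13], Sub 10 [3,6,7,9,14,8,12,2,10,4], Dense [1,
   4,6,9,12]]),
   ([[5],[3,9],[4,6],[5,8],[7],[],[9],[10,11],[12],[13],[],[13,14],[],[]], 13, [Sub 10 [1,5,4,3,2,
   12,9,6,7,13], Sub 5 [9,2,13,12,3,4,6,10,7], Sub 10 [2,3,4,8,10,12,13,11,6,9], Sub 5 [9,7,13,12,
   5,1,4,10,2], Sub 7 [10,8,11,13,4,3,5], Sub 1 [12,13,14], Dense [3,5,8,9,13]]),
   ([[5,11],[3,9],[4,6],[5,8],[7],[10],[9],[12,13],[14],[],[],[17],[18],[15,16],[],[],[],[]], 12,
   [Dense [3,5,9], Dense [3,5,9], Dense [3,5,9], Dense [3,5,9], Dense [3,5,8,9], Dense [3,5,8,9],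
   Sub 1 [8,12,13], Sub 13 [1,2,3,4,5,6,7,8,9,12,13,14,15,16], Sub 13 [1,2,3,4,5,6,7,8,9,12,13,14,
   16,15], Sub 6 [13,8,12,18,4,3,5,17], Dense [3,5,8,9]]),
   ([[2,5,11],[3,9],[4,6],[5,8],[7],[7,10],[9],[12,13],[14],[],[],[17],[],[15,16],[],[],[]], 13,
   [Sub 12 [1,2,3,4,5,6,7,8,9,10,11,13,12,14], Sub 12 [6,7,5,4,3,1,2,8,9,11,10,13,12,14], Sub 1 [8,
   12,13], Sub 13 [6,3,2,9,7,1,5,14,4,15,16,8,13,12], Sub 13 [6,3,2,9,7,1,5,14,4,16,15,8,13,12],
   Sub 7 [12,8,13,17,4,3,5], Sub 14 [1,2,3,4,5,6,7,8,9,10,11,12,13,14,15,16,17,18]]),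
   ([[2,5,11],[3,9],[4,6],[5,8],[7],[7,10],[9],[12,13],[14],[],[],[],[],[15,16],[],[]], 12,
   [Sub 12 [1,2,3,4,5,6,7,8,9,10,11,12,13,14], Sub 12 [6,7,5,4,3,1,2,8,9,11,10,12,13,14], Sub 1 [8,
   12,13], Sub 13 [6,3,2,9,7,1,5,14,4,15,16,8,12,13], Sub 13 [6,3,2,9,7,1,5,14,4,16,15,8,12,13],
   Sub 15 [1,2,3,4,5,6,7,8,9,10,11,12,13,14,15,16,17]]),
   ([[2,5,11],[3,9],[4,6],[5,8],[7],[7,10],[9],[12,13],[14],[],[],[],[],[15],[]], 14, [Sub 10 [1,2,
   9,14,10,7,6,15,3,5], Sub 10 [2,1,11,14,9,6,7,15,5,3], Sub 11 [1,2,3,4,5,6,7,8,9,10,11,12,13,14],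
   Sub 11 [1,2,3,4,5,6,7,8,9,10,11,13,12,14], Sub 16 [1,2,3,4,5,6,7,8,9,10,11,12,13,14,15,16]]),
   ([[2,5,11],[3,9],[4,6],[5,8],[7],[7,10],[9],[12,13],[14],[],[],[],[],[]], 14, [Sub 10 [9,2,1,5,
   7,10,6,4,3,14], Sub 10 [11,1,2,3,6,9,7,4,5,14], Sub 11 [1,2,3,4,5,6,7,8,9,10,11,12,13,14],
   Sub 11 [1,2,3,4,5,6,7,8,9,10,11,13,12,14], Sub 17 [1,2,3,4,5,6,7,8,9,10,11,12,13,14,15]]),
   ([[2,5,11],[3,9],[4,6],[5,8],[7],[7,10],[9],[12,13],[],[],[],[],[]], 9, [Sub 5 [6,7,9,10,5,1,4,
   2,3], Sub 5 [1,2,9,11,3,4,6,7,5], Dense [3,5,8,9], Dense [3,5,8,9], Sub 18 [1,2,3,4,5,6,7,8,9,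
   10,11,12,13,14]]),
   ([[2,5,11],[3,9],[4,6],[5,8],[7],[7,10],[9],[12],[],[],[],[]], 8, [Sub 10 [3,2,9,8,4,7,5,12,1,
   6], Sub 10 [8,4,3,2,9,6,7,1,5,10], Sub 10 [5,1,11,8,4,6,3,12,2,7], Sub 19 [1,2,3,4,5,6,7,8,9,10,
   11,12,13]]),
   ([[2,5,11],[3,9],[4,6],[5,8],[7],[7,10],[9],[],[],[],[]], 8, [Sub 10 [9,2,3,6,7,4,5,10,1,8],
   Sub 10 [8,4,3,2,9,6,7,1,5,10], Sub 10 [11,1,5,7,6,4,3,9,2,8], Sub 20 [1,2,3,4,5,6,7,8,9,10,11,
   12]]),
   ([[2,5],[3,9],[4,6],[5,8],[7],[7,10],[9],[],[],[]], 1, [Sub 5 [1,5,4,8,7,6,9,3,2], Sub 1 [1,2,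
   9], Sub 10 [2,1,5,4,3,7,6,8,10,9], Sub 21 [1,2,3,4,5,6,7,8,9,10,11]]),
   ([[2,5,10],[3,9],[4,6],[],[7],[7],[8],[9],[],[]], 9, [Sub 5 [3,2,9,4,1,5,10,8,6], Sub 4 [7,5,9,
   8,1,2,10], Sub 4 [7,6,9,8,3,2,4], Sub 5 [1,2,9,10,3,4,6,8,5], Dense [1,3,7,9]]),
   ([[2,5,12],[3,11],[4,6],[5,8],[7],[7,10],[9],[13,14],[12,14],[11],[13],[13],[],[]], 10,
   [Sub 3 [4,8,3,13,5,14,6,10,11,2,1,12,9,7], Sub 11 [1,5,11,13,12,10,6,8,7,15,2,14,4,9]]),
   ([[2,5,12],[3,11],[4,6],[5,8],[7],[7,10],[9],[13,14],[12,14],[],[13],[13],[],[]], 11,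
   [Sub 24 [1,2,3,4,5,6,7,8,9,10,11,12,13,14], Sub 5 [8,13,11,14,12,1,9,2,4], Sub 13 [10,1,5,7,6,4,
   3,9,2,12,14,11,13,15]]),
   ([[2,5,12],[3,11],[4,6],[5,8],[7],[7,10],[9],[13,14],[12],[],[13],[13],[],[]], 9, [Sub 5 [6,7,9,
   10,5,1,4,12,3], Sub 5 [9,11,13,12,2,1,3,8,7], Sub 25 [1,2,3,4,5,6,7,8,9,10,11,12,13,14],
   Dense [1,4,6,9,13]]),
   ([[2,5,12],[3,11],[4,6],[5,8],[7],[7,10],[9],[13,14],[12],[],[],[13],[],[]], 13, [Sub 1 [9,12,
   13], Sub 10 [3,4,5,1,12,10,13,2,8,6], Sub 26 [1,2,3,4,5,6,7,8,9,10,11,12,13,14], Sub 1 [8,13,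
   14], Dense [2,5,6,8,12]]),
   ([[2,5,12],[3,11],[4,6],[8],[7],[7,10],[9],[13,14],[16],[],[],[15],[18],[17],[],[],[],[]], 13,
   [Sub 1 [4,8,13], Dense [1,3,7], Dense [1,3,7], Dense [1,3,7,8], Dense [1,3,7,8], Dense [1,3,7],
   Sub 1 [8,13,14], Dense [1,3,7,8], Dense [1,3,7,8], Sub 8 [13,8,14,17,4,3], Dense [1,3,7,8]]),
   ([[2,5,12],[3,11],[4,6],[5,8],[7],[7,10],[9],[13,14],[12,16],[],[],[15],[],[17],[],[],[]], 13,
   [Sub 12 [1,12,3,4,5,6,7,8,9,10,2,13,14,16], Sub 12 [7,9,3,4,5,2,1,8,12,11,6,13,14,15], Sub 1 [8,
   13,14], Sub 11 [2,1,5,4,3,7,9,8,12,6,11,13,14,15], Sub 11 [1,12,3,4,5,6,7,8,9,10,2,13,14,16],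
   Sub 7 [13,8,14,17,4,3,5], Sub 28 [1,2,3,4,5,6,7,8,9,10,11,12,13,14,15,16,17,18]]),
   ([[2,5,12],[3,11],[4,6],[5,8],[7],[7,10],[9],[13,14],[12,16],[],[],[15],[],[],[],[]], 14,
   [Sub 12 [1,12,3,4,5,6,7,8,9,10,2,14,13,16], Sub 12 [7,9,3,4,5,2,1,8,12,11,6,14,13,15], Sub 1 [8,
   13,14], Sub 11 [2,1,5,4,3,7,9,8,12,6,11,14,13,15], Sub 11 [1,12,3,4,5,6,7,8,9,10,2,14,13,16],
   Sub 29 [1,2,3,4,5,6,7,8,9,10,11,12,13,14,15,16,17]]),
   ([[2,5,12],[3,11],[4,6],[5,8],[7],[7,10],[9],[13,14],[12],[],[],[15],[],[],[]], 9, [Sub 5 [6,7,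
   9,10,5,1,4,12,3], Sub 23 [1,2,3,4,5,6,7,9,11,12], Sub 27 [7,6,3,4,5,2,1,8,12,11,10,9,13,14],
   Sub 27 [7,6,3,4,5,2,1,8,12,11,10,9,14,13], Sub 1 [9,12,15], Sub 30 [1,2,3,4,5,6,7,8,9,10,11,12,
   13,14,15,16]]),
   ([[2,5,12],[3,11],[4,6],[5,8],[7],[7,10],[9],[13,14],[12],[],[],[],[],[]], 12, [Sub 23 [2,1,5,4,
   3,7,6,10,12,11], Sub 5 [2,1,12,11,5,4,7,9,3], Sub 27 [1,2,3,4,5,6,7,8,9,10,11,12,13,14],
   Sub 27 [1,2,3,4,5,6,7,8,9,10,11,12,14,13], Sub 31 [1,2,3,4,5,6,7,8,9,10,11,12,13,14,15]]),
   ([[2,5,12],[3,11],[4,6],[5,8],[7],[7,10],[9],[13,14],[13],[],[],[],[],[]], 9, [Sub 5 [6,7,9,10,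
   5,1,4,13,3], Sub 10 [1,5,4,8,13,11,9,14,7,2], Sub 27 [7,6,3,4,5,2,1,8,12,11,10,9,13,14],
   Sub 7 [13,8,14,9,4,3,5], Dense [2,5,6,8,9]]),
   ([[2,5,12],[3,11],[4,6],[5,8],[7],[7,10],[9],[],[13,14],[],[],[],[],[]], 12, [Sub 10 [12,1,5,7,
   6,4,3,9,2,8], Sub 23 [2,1,5,4,3,7,6,10,12,11], Sub 6 [12,1,2,11,5,4,7,3], Sub 10 [12,1,2,3,6,9,
   7,4,5,13], Sub 10 [12,1,2,3,6,9,7,4,5,14], Dense [1,3,7]]),
   ([[2,5,12],[3,11],[4,6],[5,8],[7],[7,10],[9],[13,14],[15],[],[],[],[],[],[]], 9, [Sub 5 [6,7,9,
   10,5,1,4,15,3], Sub 23 [1,2,3,4,5,6,7,9,11,12], Sub 31 [7,6,3,4,5,2,1,8,12,11,10,9,13,14,15],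
   Sub 33 [1,2,3,4,5,6,7,8,9,10,11,12,13,14], Sub 33 [1,2,3,4,5,6,7,8,9,10,11,12,14,13], Sub 34 [1,
   2,3,4,5,6,7,8,9,10,11,12,15,16]])]"

text \<open>Numbers 36 to 64. The stage of two 5-cycles with a common path of length two ends with
  43. Number 44 opens the stage of two 5-cycles with a common edge and is the place where
  \<open>twoC7\<close> turns up.\<close>

definition steps2 :: "(nat list list \<times> nat \<times> leaf list) list" where
  "steps2 = [
   ([[2,5,12],[3,11],[4,6],[5,8],[7],[7,10],[9],[13,14],[],[],[],[],[],[]], 9, [Sub 6 [10,6,7,9,3,
   2,4,5], Sub 23 [1,2,3,4,5,6,7,9,11,12], Sub 32 [1,2,3,4,5,6,7,8,9,10,11,12,13,14], Sub 33 [1,2,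
   3,4,5,6,7,8,9,10,11,12,13,14], Sub 33 [1,2,3,4,5,6,7,8,9,10,11,12,14,13], Sub 35 [1,2,3,4,5,6,7,
   8,9,10,11,12,13,14,15]]),
   ([[2,5,12],[3,11],[4,6],[5,8],[7],[7,10],[9],[13],[],[],[],[],[]], 8, [Sub 10 [2,3,4,8,9,5,7,13,
   6,1], Sub 10 [1,5,4,8,10,3,6,13,7,2], Sub 10 [3,2,11,8,4,7,5,13,1,6], Sub 10 [5,1,12,8,4,6,3,13,
   2,7], Sub 36 [1,2,3,4,5,6,7,8,9,10,11,12,13,14]]),
   ([[2,5,12],[3,11],[4,6],[5,8],[7],[7,10],[9],[],[],[],[],[]], 8, [Sub 10 [4,3,2,1,5,9,7,12,6,8],
   Sub 10 [4,5,1,2,3,10,6,11,7,8], Sub 10 [11,2,3,6,7,4,5,10,1,8], Sub 10 [12,1,5,7,6,4,3,9,2,8],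
   Sub 37 [1,2,3,4,5,6,7,8,9,10,11,12,13]]),
   ([[2,5],[3,11],[4,6],[5,8],[7],[7,10],[9],[],[],[],[]], 1, [Sub 5 [1,5,4,8,7,6,9,3,2], Sub 5 [1,
   5,7,9,4,3,8,6,2], Sub 21 [2,1,5,4,3,7,6,8,10,9,11], Sub 1 [1,2,11], Sub 38 [1,2,3,4,5,6,7,8,9,
   10,11,12]]),
   ([[2,5],[3],[4,6],[5,8],[7],[7,10],[9],[],[],[]], 2, [Sub 5 [2,3,4,8,6,7,10,5,1], Sub 22 [1,2,3,
   4,5,6,7,8,9,10], Sub 5 [2,3,6,10,4,5,8,7,1], Sub 39 [1,2,3,4,5,6,7,8,9,10,11]]),
   ([[2,5],[3],[4,6],[5,8],[7],[7],[9],[],[]], 6, [Sub 4 [2,1,6,3,5,7,4], Sub 1 [2,3,6], Sub 6 [8,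
   4,3,6,5,1,7,2], Sub 1 [6,7,9], Sub 40 [1,2,3,4,5,6,7,8,9,10]]),
   ([[2,5],[3],[4,6],[5,8],[7],[7],[],[]], 7, [Sub 1 [1,5,7], Sub 4 [1,2,7,5,3,6,4], Sub 6 [8,4,5,
   7,3,2,6,1], Sub 41 [1,2,3,4,5,6,7,8,9]]),
   ([[2,5],[3],[4,6],[5],[7],[7],[]], 4, [Sub 1 [1,4,5], Sub 1 [2,3,4], Sub 1 [3,4,6], Sub 1 [4,5,
   7], Sub 42 [1,2,3,4,5,6,7,8]]),
   ([[2,5,12],[3,9],[4,10],[5,6],[8],[7,13],[8,9],[11],[14],[11,13],[12],[14],[],[]], 13,
   [Sub 2 [1,5,4,6,13,14,12,2,3,10,11,8,7,9], Sub 10 [9,7,6,13,10,12,11,15,8,14]]),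
   ([[2,5,12],[3,9],[4,10],[5,6],[8],[7,13],[8,9],[11],[14],[11,13],[12],[],[],[]], 12, [Sub 5 [10,
   11,12,13,8,5,7,1,3], Sub 44 [1,2,3,4,5,6,7,8,9,10,11,12,13,14], Dense [1,3,6,8,9]]),
   ([[2,5,12],[3,9],[4,10],[5,6],[8],[7,13],[8,9],[11],[14],[11],[12],[],[],[]], 10, [Sub 1 [10,11,
   12], Sub 45 [1,2,3,4,5,6,7,8,9,10,11,12,13,14], Sub 10 [5,8,7,9,14,3,10,2,11,4], Dense [1,3,6,8,
   9]]),
   ([[2,5,12],[3,9],[4,10],[5,6],[8],[7,13],[8,9],[11],[14],[],[12,14],[],[],[]], 12, [Sub 39 [10,
   12,1,2,3,5,4,9,6,8,11], Sub 46 [8,7,6,4,5,3,2,1,9,13,12,11,10,14], Sub 1 [11,12,14], Dense [1,3,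
   6,8,9]]),
   ([[2,5,12],[3,9],[4,10],[5,6],[8],[7,13],[8,9],[11],[14],[],[12],[],[],[]], 11, [Sub 46 [1,2,3,
   4,5,6,7,8,9,10,11,12,13,14], Sub 39 [13,11,8,7,6,5,4,9,3,1,12], Sub 47 [1,2,3,4,5,6,7,8,9,10,11,
   12,13,14], Dense [1,3,6,8,9]]),
   ([[2,5,12],[3,9],[4,10],[5,6],[8],[7,13],[8,9],[11],[14],[],[],[13],[],[]], 12, [Sub 10 [2,3,10,
   12,13,7,6,1,4,9], Sub 46 [8,7,6,4,5,3,2,1,9,13,12,11,10,14], Sub 10 [4,6,7,9,14,1,12,2,13,5],
   Dense [1,3,6,8,9]]),
   ([[2,5,12],[3,9],[4,10],[5,6],[8],[7,13],[8,9],[11],[14],[],[],[14],[],[]], 12, [Sub 10 [2,3,4,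
   5,1,14,12,8,10,9], Sub 47 [8,7,6,4,5,3,2,1,9,13,12,11,10,14], Sub 10 [4,6,7,9,14,1,12,2,13,5],
   Dense [1,3,6,8,9]]),
   ([[2,5,12],[3,9],[4,10],[5,6],[8],[7,13],[8,9],[11],[14],[],[],[],[],[]], 12, [Sub 40 [10,12,1,
   2,3,5,4,9,6,8], Sub 48 [1,2,3,4,5,6,7,8,9,10,11,12,13,14], Sub 49 [1,2,3,4,5,6,7,8,9,10,11,12,
   13,14], Sub 50 [1,2,3,4,5,6,7,8,9,10,11,12,13,14], Dense [1,3,6,8,9]]),
   ([[2,5,12],[3,9],[4,10],[5,6],[8],[7,13],[8,9],[11],[],[],[],[],[]], 9, [Sub 5 [3,2,9,10,1,5,12,
   7,4], Sub 5 [8,7,9,11,6,4,13,2,5], Sub 5 [1,2,9,12,3,4,10,7,5], Sub 5 [6,7,9,13,8,5,11,2,4],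
   Sub 51 [1,2,3,4,5,6,7,8,9,10,11,12,13,14]]),
   ([[2,5,11],[3,12],[4,9],[5,6],[8],[],[8],[10],[10],[11],[],[]], 11, [Sub 10 [3,4,5,8,10,1,11,7,
   6,2], Sub 6 [7,8,10,11,5,1,4,9], Sub 1 [9,10,11], Sub 5 [2,1,11,12,5,4,8,10,3], Sub 52 [2,3,4,5,
   1,8,10,11,9,6,13,12,7]]),
   ([[2,5,11],[3,12],[4,9],[5,6],[8],[],[8],[10],[10,14],[13],[],[],[],[]], 13, [Sub 23 [3,4,5,1,9,
   8,10,13,6,2], Sub 6 [7,8,10,13,5,1,4,9], Sub 10 [1,5,4,3,9,13,10,2,8,11], Sub 10 [2,3,4,5,8,13,
   10,1,9,12], Sub 6 [14,9,10,13,3,2,4,8], Dense [3,5,10]]),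
   ([[5],[3],[4,10],[5,6],[8],[7,12],[8,9],[11],[],[11],[13],[],[]], 10, [Sub 43 [3,4,5,1,10,8,11],
   Sub 1 [2,3,10], Sub 53 [7,6,4,5,8,1,13,11,3,10,9,12], Sub 53 [6,7,8,5,4,1,2,3,11,10,12,9],
   Sub 1 [10,11,13], Sub 54 [6,7,8,5,4,1,2,3,11,10,12,9,14,13]]),
   ([[2,5,11],[3,12],[4,9],[5,6],[8],[],[8],[10],[10],[],[],[]], 9, [Sub 5 [4,3,9,6,2,1,12,10,5],
   Sub 7 [7,8,10,9,5,1,4], Sub 23 [1,5,4,6,11,3,9,10,8,2], Sub 5 [2,3,9,12,4,5,6,10,1], Sub 55 [6,
   7,8,5,4,1,2,3,12,10,9,11,13]]),
   ([[2,5,12],[3,14],[4,10],[6],[8],[7,13],[8,9],[11],[16,17],[],[16],[15],[],[15,17],[],[18],[],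
   []], 15, [Sub 39 [12,1,2,14,15,3,4,17,6,10,5], Sub 5 [1,5,15,12,8,7,11,14,2], Sub 41 [3,10,15,
   14,2,12,1,17,5], Sub 12 [3,4,17,14,2,9,7,15,6,16,10,11,12,13], Sub 11 [3,2,13,6,4,15,12,7,1,14,
   10,8,9,5], Sub 1 [14,15,17], Sub 12 [3,4,17,14,2,9,7,15,6,16,10,18,12,13], Dense [1,3,6,8,9,
   14]]),
   ([[2,5,12],[3,14],[4,10],[5,6],[8],[7,13],[8,9],[11],[16,17],[],[12,16],[15],[],[15],[],[18],[],
   []], 14, [Sub 5 [3,2,14,10,1,5,12,15,4], Sub 13 [15,4,3,2,14,10,13,1,6,5,12,7,8,9], Sub 57 [1,2,
   3,4,5,6,7,8,9,10,11,12,13,14,15,16,17,18], Dense [3,5,7,12,14,16], Dense [3,5,7,12,14,16]]),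
   ([[2,5,12],[3,14],[4,10],[5,6],[8],[13],[8,9],[11],[],[],[12,16],[15],[],[17,18],[],[],[],[]],
   15, [Sub 55 [8,13,6,4,5,3,2,1,14,15,12,10,11], Sub 39 [15,7,8,11,12,5,1,16,2,4,9], Dense [2,4,8,
   12], Sub 56 [5,4,3,2,1,14,11,12,10,15,8,6], Dense [2,4,8,12], Sub 6 [16,11,12,15,8,5,7,1],
   Sub 12 [4,5,1,2,3,12,11,14,8,15,6,17,18,7], Sub 12 [4,5,1,2,3,12,11,14,8,15,6,18,17,7],
   Dense [2,4,8,12]]),
   ([[2,5,12],[3,14],[4,10],[5,6],[8],[7,13],[8,9],[11],[16,17],[],[12,16],[15],[],[17],[],[18],[],
   []], 14, [Sub 5 [3,2,14,10,1,5,12,17,4], Sub 10 [4,6,7,9,17,2,14,16,13,3], Sub 57 [1,2,3,4,5,6,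
   7,8,9,10,11,12,13,14,15,16,17,18], Sub 59 [1,2,3,4,5,6,7,8,9,10,11,12,13,14,15,16,17,18],
   Sub 59 [1,2,3,4,5,6,7,8,9,10,11,12,13,14,15,16,17,19]]),
   ([[2,5,12],[3,14],[4,10],[5,6],[8],[13],[8,9],[11],[16],[],[12,16],[15],[],[17],[],[17],[]], 14,
   [Sub 34 [6,14,2,3,4,1,5,10,8,12,17,13,7,11], Sub 10 [5,8,11,16,17,2,14,9,7,1], Sub 6 [17,14,9,
   16,2,1,3,7], Sub 5 [3,2,14,10,1,5,12,17,4], Sub 12 [12,11,3,2,1,4,5,14,8,6,15,13,17,7],
   Dense [3,5,12,14,16], Sub 59 [1,2,3,4,5,6,7,8,9,10,11,12,13,14,15,16,17,18]]),
   ([[2,5,12],[3,14],[4,10],[5,6],[8],[7,13],[8,9],[11],[16,17],[],[12,16],[15],[],[19],[],[18],[],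
   [],[]], 14, [Sub 5 [3,2,14,10,1,5,12,19,4], Sub 12 [12,11,3,2,1,4,5,14,8,6,15,13,19,7],
   Sub 58 [1,2,3,4,5,6,7,8,9,10,11,12,13,14,15,16,17,18], Sub 59 [1,2,3,4,5,6,7,8,9,10,11,12,13,14,
   15,16,17,19], Sub 59 [1,2,3,4,5,6,7,8,9,10,11,12,13,14,15,16,18,19], Sub 59 [1,2,3,4,5,6,7,8,9,
   10,11,12,13,14,15,16,19,20]]),
   ([[2,5,12],[3,14],[4,10],[5,6],[8],[7,13],[8,9],[11],[16,17],[],[12,16],[15],[],[],[],[18],[],
   []], 14, [Sub 6 [14,2,3,10,1,5,12,4], Sub 56 [5,1,2,3,4,10,7,6,14,13,8,12], Sub 58 [1,2,3,4,5,6,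
   7,8,9,10,11,12,13,14,15,16,17,18], Sub 60 [1,2,3,4,5,6,7,8,9,10,11,12,13,14,15,16,17,18],
   Sub 61 [1,2,3,4,5,6,7,8,9,10,11,12,13,14,15,16,18], Sub 62 [1,2,3,4,5,6,7,8,9,10,11,12,13,14,15,
   16,17,18,19]]),
   ([[2,5,12],[3,14],[4,10],[5,6],[8],[7,13],[8,9],[11],[16,17],[],[12,16],[15],[],[],[],[],[]],
   16, [Sub 11 [3,4,11,16,10,12,1,9,5,15,2,7,17,8], Sub 39 [13,6,7,9,16,8,11,17,12,5,4],
   Sub 13 [15,14,2,1,12,3,11,5,16,8,4,9,7,17], Sub 5 [12,11,16,15,8,5,7,9,1], Sub 1 [9,16,17],
   Sub 63 [1,2,3,4,5,6,7,8,9,10,11,12,13,14,15,16,17,18]])]"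

text \<open>Numbers 65 to 88. After 80 comes the preparation for a single 5-cycle; 81 to 83 are
  hexagons with pendant trees.\<close>

definition steps3 :: "(nat list list \<times> nat \<times> leaf list) list" where
  "steps3 = [
   ([[2,5,12],[3,14],[4,10],[5,6],[8],[7,13],[8,9],[11],[16],[],[12,16],[15],[],[],[],[]], 9,
   [Sub 13 [16,4,6,7,9,13,10,8,3,5,11,2,1,14], Sub 5 [6,7,9,13,8,5,11,16,4], Sub 11 [9,7,1,2,14,12,
   11,3,8,15,16,4,10,5], Sub 43 [8,7,9,16,11,15,12], Sub 64 [1,2,3,4,5,6,7,8,9,10,11,12,13,14,15,
   16,17]]),
   ([[2,5,12],[3,13],[4,10],[5,6],[],[7],[8,9],[11],[],[14],[12,14],[],[],[]], 10, [Sub 5 [4,3,10,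
   5,2,1,13,14,6], Sub 5 [4,3,10,6,2,1,13,14,5], Sub 5 [10,8,11,14,7,6,9,12,3], Sub 10 [6,7,8,11,
   14,3,10,12,9,4], Sub 5 [10,12,11,14,1,2,5,8,3], Sub 5 [2,3,10,13,4,5,6,14,1], Dense [1,4,7,10,
   11]]),
   ([[2,5,12],[3,14],[4,10],[5,6],[8],[7,13],[8,9],[11],[],[],[12,16],[15],[],[],[],[17],[]], 16,
   [Sub 64 [4,3,2,1,5,12,11,8,16,14,7,6,15,10,13,9,17], Sub 11 [1,2,11,8,5,16,10,7,3,17,12,6,9,4],
   Sub 56 [5,4,6,7,8,9,12,11,13,16,1,3], Sub 12 [7,6,12,11,8,1,5,16,4,2,9,14,17,3], Sub 5 [12,11,
   16,15,8,5,7,17,1], Sub 59 [8,11,12,1,5,2,3,4,10,15,6,7,14,16,9,13,17,18]]),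
   ([[2,5,12],[3,14],[4,10],[5,6],[8],[7,13],[8,9],[11],[],[],[12,16],[15],[],[],[],[]], 16,
   [Sub 65 [1,2,3,4,5,6,7,8,9,10,11,12,13,14,15,16], Sub 66 [1,2,3,4,5,6,7,8,9,10,11,12,14,16],
   Sub 56 [5,4,6,7,8,9,12,11,13,16,1,3], Sub 56 [5,8,11,12,1,15,3,2,16,14,4,7], Sub 6 [16,11,12,15,
   8,5,7,1], Sub 67 [1,2,3,4,5,6,7,8,9,10,11,12,13,14,15,16,17]]),
   ([[2,5,12],[3,14],[4,10],[5,6],[8],[7,13],[8,9],[11],[],[],[12],[15],[],[],[]], 11, [Sub 5 [7,8,
   11,9,5,1,4,12,6], Sub 52 [2,3,4,5,1,8,11,12,10,6,15,14,7], Sub 39 [13,11,8,7,6,5,4,9,3,1,12],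
   Sub 39 [14,2,1,12,11,5,8,15,7,4,3], Sub 1 [11,12,15], Sub 68 [1,2,3,4,5,6,7,8,9,10,11,12,13,14,
   15,16]]),
   ([[2,5,12],[3,14],[4,10],[5,6],[8],[7,13],[8,9],[11],[],[],[12],[],[],[]], 12, [Sub 43 [1,5,8,
   11,12,7,9], Sub 39 [10,12,1,2,3,5,4,14,6,8,11], Sub 53 [8,7,6,4,5,3,2,1,13,12,11,9], Sub 5 [2,1,
   12,14,5,4,8,11,3], Sub 69 [1,2,3,4,5,6,7,8,9,10,11,12,13,14,15]]),
   ([[2,5,11],[3],[4,9],[5,6],[8],[7,12],[8],[10],[13],[],[],[13],[]], 9, [Sub 1 [2,3,9],
   Sub 10 [6,4,5,8,7,13,9,10,3,12], Sub 10 [6,4,5,8,10,13,9,7,3,12], Sub 10 [6,4,5,1,11,13,9,2,3,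
   12], Sub 1 [9,12,13], Sub 12 [1,5,4,3,2,6,7,9,8,12,11,13,14,10]]),
   ([[2,5,12],[3,14],[4,10],[5,6],[8],[7,13],[8,9],[11],[],[17],[15,16],[],[],[],[],[],[]], 13,
   [Sub 6 [13,6,7,9,4,3,5,8], Sub 69 [3,2,1,5,4,8,7,6,9,12,13,10,11,14,17], Sub 56 [3,2,1,5,4,8,7,
   6,12,13,10,14], Sub 56 [5,1,2,3,4,10,7,6,14,13,8,12], Sub 12 [1,2,7,8,5,6,4,11,3,13,12,15,16,
   10], Sub 12 [1,2,7,8,5,6,4,11,3,13,12,16,15,10], Sub 71 [1,2,3,4,5,6,7,8,10,11,12,13,17],
   Sub 59 [5,8,7,6,4,13,10,3,17,9,2,1,18,11,12,14,15,16]]),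
   ([[2,5,12],[3,14],[4,10],[5,6],[8],[7,13],[8,9],[11],[],[],[15,16],[],[],[],[],[]], 10,
   [Sub 56 [5,8,7,6,4,13,2,3,9,10,1,11], Sub 40 [10,12,1,2,3,5,4,14,6,8], Sub 70 [3,2,1,5,4,8,7,6,
   9,12,13,10,11,14], Sub 6 [14,2,3,10,1,5,12,4], Sub 11 [1,2,7,8,5,6,4,11,3,13,12,15,16,10],
   Sub 11 [1,2,7,8,5,6,4,11,3,13,12,16,15,10], Sub 72 [1,2,3,4,5,6,7,8,9,10,11,12,13,14,15,16,17]]),
   ([[2,5,12],[3,14],[4,10],[5,6],[8],[7,13],[8,9],[11],[],[],[15],[],[],[],[]], 11, [Sub 5 [7,8,
   11,9,5,1,4,15,6], Sub 55 [1,2,3,4,5,6,7,8,9,10,11,13,15], Sub 69 [8,7,6,4,5,3,2,1,14,13,12,11,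
   10,9,15], Sub 39 [13,11,8,7,6,5,4,9,3,1,15], Sub 56 [4,3,2,1,5,12,7,8,14,11,6,10], Sub 73 [1,2,
   3,4,5,6,7,8,9,10,11,12,13,14,15,16]]),
   ([[2,5,12],[3,14],[4,10],[5,6],[8],[7,13],[8,9],[11],[],[],[],[],[],[]], 11, [Sub 6 [9,7,8,11,6,
   4,13,5], Sub 56 [1,2,3,4,5,6,7,8,10,11,12,14], Sub 70 [1,2,3,4,5,6,7,8,9,10,11,12,13,14],
   Sub 40 [11,13,6,7,8,4,5,9,1,3], Sub 56 [4,3,2,1,5,12,7,8,14,11,6,10], Sub 74 [1,2,3,4,5,6,7,8,9,
   10,11,12,13,14,15]]),
   ([[2,5,12],[3],[4,10],[5,6],[8],[7,13],[8,9],[11],[],[],[],[],[]], 2, [Sub 52 [1,2,3,4,5,6,7,8,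
   9,10,11,12,13], Sub 1 [2,3,10], Sub 39 [11,8,5,1,2,4,3,12,10,6,7], Sub 1 [1,2,12], Sub 39 [13,6,
   4,3,2,5,1,10,12,8,7], Sub 75 [1,2,3,4,5,6,7,8,9,10,11,12,13,14]]),
   ([[2,5,12],[3],[4,10],[5,6],[8],[7],[8,9],[11],[],[],[],[]], 6, [Sub 5 [2,6,4,3,7,8,9,5,1],
   Sub 1 [6,7,9], Sub 5 [3,4,6,10,5,1,8,7,2], Sub 6 [11,6,7,8,4,3,5,9], Sub 10 [2,1,5,8,7,4,6,11,
   12,3], Sub 76 [1,2,3,4,5,6,7,8,9,10,11,12,13]]),
   ([[2,5],[3],[4,10],[5,6],[8],[7],[8,9],[11],[],[],[]], 1, [Sub 5 [1,5,4,6,8,7,11,3,2],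
   Sub 41 [4,6,7,8,5,9,1,11,2], Sub 7 [2,1,10,3,5,4,8], Sub 5 [1,5,8,11,4,3,6,7,2], Sub 77 [1,2,3,
   4,5,6,7,8,9,10,11,12]]),
   ([[2,5],[3],[4,10],[5,6],[8],[7],[8,9],[],[],[]], 8, [Sub 1 [1,5,8], Sub 5 [2,8,5,1,7,6,9,4,3],
   Sub 1 [6,7,8], Sub 1 [7,8,9], Sub 41 [1,2,3,4,5,10,8,6,7], Sub 78 [1,2,3,4,5,6,7,8,9,10,11]]),
   ([[2,5],[3],[4],[5,6],[8],[7],[8,9],[],[]], 3, [Sub 1 [1,2,3], Sub 1 [3,4,6], Sub 5 [3,8,5,4,7,
   6,9,1,2], Sub 43 [9,3,4,6,7,5,8], Sub 79 [1,2,3,4,5,6,7,8,9,10]]),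
   ([[5],[3],[4,8],[5,6],[9],[7,10],[11,13],[11,12],[],[],[14],[13],[],[]], 12, [Sub 10 [5,4,6,7,
   11,12,8,13,3,1], Sub 5 [3,8,12,2,11,7,14,13,4], Sub 10 [5,4,6,7,11,12,8,13,3,9], Sub 23 [3,8,11,
   14,4,7,6,10,12,2], Sub 5 [11,8,12,14,3,2,4,13,7], Dense [4,7,8]]),
   ([[2],[3,7],[4,9],[5,6],[],[8,10],[],[11,13],[11,12],[],[14],[],[],[]], 10, [Sub 10 [2,3,9,11,8,
   10,6,14,4,1], Sub 6 [5,4,6,10,3,2,9,8], Sub 10 [2,3,9,11,8,10,6,14,4,7], Sub 23 [3,9,11,14,4,8,
   6,10,12,2], Sub 6 [10,6,8,13,4,3,5,11], Sub 81 [1,5,4,3,2,9,11,6,7,12,8,10,14,13], Dense [3,6,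
   11]]),
   ([[5],[3],[4,8],[5,6],[9],[7,10],[11,13],[11,12],[],[],[],[],[]], 11, [Sub 23 [3,4,5,9,8,1,11,7,
   6,2], Sub 6 [2,3,8,11,4,5,6,12], Sub 23 [3,4,5,1,8,9,11,7,6,2], Sub 6 [10,6,7,11,4,3,5,13],
   Sub 1 [8,11,12], Sub 1 [7,11,13], Sub 82 [1,5,4,3,2,8,9,11,6,12,7,10,14,13]]),
   ([[2,5],[3,7],[4,9],[5,6],[],[8,10],[],[11],[11,12],[],[],[]], 11, [Sub 23 [1,11,9,12,5,3,4,6,8,
   2], Sub 10 [2,3,4,6,8,5,11,10,9,1], Sub 79 [1,5,4,3,2,9,11,7,8,6], Sub 7 [8,6,10,11,4,3,5],
   Sub 1 [9,11,12], Sub 83 [1,5,4,3,2,9,11,6,7,12,8,10,13]]),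
   ([[2,5,7],[3],[4,8],[5,6],[9],[],[],[13,14],[10,11],[13],[14],[13],[],[]], 14, [Sub 5 [2,3,8,14,
   4,5,6,13,1], Sub 10 [5,9,10,13,8,6,14,12,11,4], Sub 10 [2,1,5,9,11,8,14,10,7,3], Sub 4 [13,10,
   14,8,9,11,5], Sub 5 [13,8,14,12,3,2,4,11,10], Dense [1,3,9,13,14]]),
   ([[2,5,8],[7],[4,10],[5,6],[11],[9,13],[],[14,15],[],[16,17],[],[16],[],[16],[],[],[18,19],[],
   []], 14, [Sub 5 [2,1,8,14,5,4,11,15,7], Sub 5 [3,10,16,14,17,18,19,12,4], Dense [1,4,10,14],
   Dense [1,4,10,14], Dense [1,4,10,14], Sub 1 [12,14,16], Dense [1,4,10,14], Sub 1 [8,14,15],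
   Dense [1,4,10,14], Dense [1,4,10,14], Dense [1,4,10,14]]),
   ([[2,5,8],[3,7],[4,9],[5,6],[10],[],[14,15],[],[16,17],[11,12],[16],[],[16],[],[],[],[18],[]],
   17, [Sub 77 [2,1,5,4,3,6,17,9,18,10,16,7], Sub 56 [4,5,1,2,3,7,16,9,8,17,6,10], Sub 5 [16,9,17,
   11,3,2,4,18,13], Sub 85 [1,2,3,4,5,6,8,9,10,11,12,13,16,17], Sub 5 [16,9,17,13,3,2,4,18,11],
   Sub 83 [5,1,2,3,4,9,17,7,6,16,14,15,18], Sub 83 [5,1,2,3,4,9,17,7,6,16,15,14,18], Sub 86 [5,4,3,
   2,1,7,6,10,14,9,8,13,15,11,12,16,17,18,19]]),
   ([[2,5,8],[3,7],[4,9],[5,6],[10],[],[14,15],[],[16,17],[11,12],[16],[],[16],[],[],[],[]], 17,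
   [Sub 78 [6,17,9,3,4,2,1,5,8,16,10], Sub 56 [4,5,1,2,3,7,16,9,8,17,6,10], Sub 6 [17,9,16,11,3,2,
   4,13], Sub 85 [1,2,3,4,5,6,8,9,10,11,12,13,16,17], Sub 6 [17,9,16,13,3,2,4,11], Sub 84 [5,1,2,3,
   4,9,8,17,7,16,14,15], Sub 84 [5,1,2,3,4,9,8,17,7,16,15,14], Sub 87 [1,2,3,4,5,6,7,8,9,10,11,12,
   13,14,15,16,17,18]])]"

definition steps4 :: "(nat list list \<times> nat \<times> leaf list) list" where
  "steps4 = [
   ([[2,5,8],[3,7],[4,9],[5,6],[10],[],[13,14],[],[15,16],[11,12],[15],[],[],[],[],[]], 15,
   [Sub 77 [2,1,5,4,3,6,15,9,11,10,16,7], Sub 10 [2,1,5,10,11,9,15,12,8,3], Sub 7 [11,10,12,15,5,1,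
   4], Sub 83 [5,1,2,3,4,9,15,7,6,16,13,14,11], Sub 83 [5,1,2,3,4,9,15,7,6,16,14,13,11], Sub 1 [9,
   15,16], Sub 88 [1,2,3,4,5,6,7,8,9,10,11,12,17,13,14,15,16]]),
   ([[5],[3],[4,8],[5,6],[9],[7,12],[],[13,14],[10,11],[15,19],[],[],[15,16],[17,18],[],[],[],[],
   []], 15, [Dense [4,8,9,15], Dense [4,8,9,15], Dense [4,8,9,15], Sub 6 [11,9,10,15,5,1,4,19],
   Dense [4,8,9,15], Sub 1 [13,15,16], Dense [4,8,9,15], Dense [4,8,9,15], Sub 1 [10,15,19],
   Dense [4,8,9,15]]),
   ([[5],[3],[4,8],[5,6],[9],[7,12],[],[13,14],[10,11],[15],[],[],[15,16],[17,18],[],[],[],[]], 10,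
   [Sub 6 [1,5,9,10,4,3,6,11], Sub 10 [4,3,8,13,15,9,10,16,2,5], Dense [3,5,6,10,13], Sub 1 [9,10,
   11], Dense [3,5,6,10,13], Sub 7 [15,10,16,13,9,5,11], Sub 13 [18,15,13,8,14,16,17,3,10,4,2,9,5,
   11], Sub 13 [17,15,13,8,14,16,18,3,10,4,2,9,5,11], Sub 90 [1,2,3,4,5,6,7,8,9,10,11,12,13,14,15,
   16,17,18,19]]),
   ([[2,5,8],[7],[4,10],[5,6],[11],[9,12],[14,16],[13,15],[],[17,18],[],[],[],[],[],[19,21],[19,
   20],[21,22],[],[],[],[]], 21, [Sub 5 [2,21,16,7,18,10,22,19,1], Sub 5 [3,10,18,21,17,19,20,22,
   4], Dense [1,4,7,10,21], Dense [1,4,7,10,21], Dense [1,4,7,10,21], Dense [1,4,7,10,21],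
   Sub 6 [14,21,16,7,18,10,22,19], Dense [1,4,7,10,21], Sub 1 [16,19,21], Sub 43 [18,10,17,20,21,
   19,16], Sub 1 [18,21,22], Dense [1,4,7,10,21]]),
   ([[2,5,8],[7],[4,10],[5,6],[11],[9,12],[14,16],[13,15],[],[17,18],[],[],[],[],[],[19,23],[19,
   20],[21,22],[],[],[],[],[]], 19, [Sub 5 [2,19,16,7,17,10,20,23,1], Sub 5 [3,10,17,19,18,21,22,
   20,4], Dense [1,4,7,10,19], Dense [1,4,7,10,19], Dense [1,4,7,10,19], Dense [1,4,7,10,19],
   Sub 6 [14,19,16,7,17,10,20,23], Dense [1,4,7,10,19], Sub 1 [17,19,20], Dense [1,4,7,10,19],
   Dense [1,4,7,10,19], Sub 1 [16,19,23], Dense [1,4,7,10,19]]),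
   ([[2,5,8],[3,7],[4,10],[5,6],[11],[9,12],[14,16],[13,15],[],[17,18],[],[],[],[],[],[19],[19,20],
   [21,22],[],[],[],[]], 16, [Sub 88 [5,1,2,3,4,10,8,11,7,6,9,12,19,13,15,16,14], Sub 56 [3,4,5,1,
   2,8,14,7,11,16,10,6], Sub 88 [5,1,2,3,4,10,8,11,7,6,12,9,19,13,15,16,14], Sub 83 [4,5,1,2,3,7,
   16,8,10,14,13,15,19], Sub 1 [7,14,16], Sub 83 [4,5,1,2,3,7,16,8,10,14,15,13,19], Sub 7 [19,16,
   20,17,7,2,14], Sub 92 [1,2,3,4,5,6,7,8,9,10,11,12,13,14,15,16,17,18,19,20,21,22], Sub 92 [1,2,3,
   4,5,6,7,8,9,10,11,12,13,14,15,16,17,18,19,20,22,21], Sub 93 [1,2,3,4,5,6,7,8,9,10,11,12,13,14,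
   15,16,17,18,19,20,21,22,23]]),
   ([[2,5,8],[3,7],[4,10],[6],[11],[9,14],[16,18],[15,17],[31,32],[19,20],[12,13],[23,25],[24,26],
   [30,33],[],[29],[],[27,28],[21,22],[],[24],[],[],[],[],[],[],[],[],[],[],[],[]], 24, [Sub 12 [1,
   5,4,3,2,24,13,10,11,21,8,19,20,12], Sub 5 [5,11,13,24,12,23,25,26,1], Dense [1,3,6,7,11,19,24],
   Sub 86 [7,18,5,1,2,8,27,16,15,11,3,26,17,24,29,13,12,23,25], Dense [1,3,6,7,11,19,24], Dense [1,
   3,6,7,11,19,24], Sub 7 [21,19,22,24,10,3,20], Dense [1,3,6,7,11,19,24], Dense [1,3,6,7,11,19,
   24], Sub 1 [13,24,26], Dense [1,3,6,7,11,19,24], Dense [1,3,6,7,11,19,24], Dense [1,3,6,7,11,19,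
   24], Dense [1,3,6,7,11,19,24], Dense [1,3,6,7,11,19,24], Dense [1,3,6,7,11,19,24], Dense [1,3,6,
   7,11,19,24], Dense [1,3,6,7,11,19,24]]),
   ([[5,8],[3,7],[4,10],[5,6],[11],[9,14],[16,18],[15,17],[29,30],[19,20],[12,13],[],[22,23],[28,
   31],[32,34],[26,27],[33,35],[24,25],[],[],[22],[],[36],[],[],[],[],[],[],[],[],[],[],[],[],[]],
   22, [Dense [3,5,6,7,8], Dense [3,5,6,7,8], Sub 6 [12,11,13,22,5,1,4,23], Dense [3,5,6,7,8,13],
   Dense [3,5,6,7,8,13], Sub 1 [13,22,23], Sub 95 [3,4,5,1,2,8,6,10,15,11,7,16,18,17,19,14,20,9,13,
   12,22,23,26,24,27,25,29,30,28,33,32,34,35], Sub 95 [3,4,5,1,2,8,6,10,15,11,7,16,18,17,19,14,20,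
   9,13,12,22,23,26,25,27,24,29,30,28,33,32,34,35], Sub 95 [3,4,5,1,2,8,6,10,15,11,7,18,16,17,19,
   14,20,9,13,12,22,23,24,26,25,27,29,30,28,33,32,34,35], Sub 95 [3,4,5,1,2,8,6,10,15,11,7,18,16,
   17,19,14,20,9,13,12,22,23,24,27,25,26,29,30,28,33,32,34,35], Dense [3,5,6,7,8,13], Dense [3,5,6,
   7,8,13], Dense [3,5,6,7,8,13], Dense [3,5,6,7,8,13], Sub 86 [13,23,1,5,11,4,36,22,3,8,12,34,6,
   32,21,15,17,33,35], Sub 86 [13,23,1,5,11,4,36,22,3,8,12,35,6,33,21,17,15,32,34], Sub 86 [13,23,
   1,5,11,4,36,22,3,8,12,32,6,34,21,15,17,33,35], Sub 86 [13,23,1,5,11,4,36,22,3,8,12,33,6,35,21,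
   17,15,32,34], Sub 6 [23,13,22,36,11,5,12,21], Dense [3,5,6,7,8,13]]),
   ([[2,5,8],[3,7],[4,10],[5,6],[11],[9,14],[16,18],[15,17],[30,31],[19,20],[12,13],[],[23,24],[29,
   32],[33,35],[27,28],[34,36],[25,26],[21],[22],[],[],[37],[],[],[],[],[],[],[],[],[],[],[],[],[],
   []], 24, [Sub 6 [12,11,13,24,5,1,4,23], Dense [3,5,6,7,8,13,19], Dense [3,5,6,7,8,13,20],
   Sub 96 [1,2,3,4,5,6,7,8,9,10,11,12,13,14,15,16,17,18,19,20,37,23,24,25,26,27,28,29,30,31,32,33,
   34,35,36,21], Sub 96 [1,2,3,4,5,6,7,8,9,10,11,12,13,14,15,16,17,18,19,20,37,23,24,25,26,27,28,
   29,30,31,32,33,34,35,36,22], Sub 1 [13,23,24], Sub 95 [3,4,5,1,2,8,6,10,15,11,7,16,18,17,19,14,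
   20,9,13,12,24,23,27,25,28,26,30,31,29,34,33,35,36], Sub 95 [3,4,5,1,2,8,6,10,15,11,7,16,18,17,
   19,14,20,9,13,12,24,23,27,26,28,25,30,31,29,34,33,35,36], Sub 95 [3,4,5,1,2,8,6,10,15,11,7,18,
   16,17,19,14,20,9,13,12,24,23,25,27,26,28,30,31,29,34,33,35,36], Sub 95 [3,4,5,1,2,8,6,10,15,11,
   7,18,16,17,19,14,20,9,13,12,24,23,25,28,26,27,30,31,29,34,33,35,36], Sub 91 [12,3,4,5,11,1,2,6,
   13,24,23,8,14,9,29,32,30,31], Sub 91 [12,3,4,5,11,1,2,6,13,24,23,8,9,14,30,31,29,32],
   Sub 91 [12,3,4,5,11,1,2,6,13,24,23,8,9,14,31,30,29,32], Sub 91 [12,3,4,5,11,1,2,6,13,24,23,8,14,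
   9,32,29,30,31], Sub 91 [12,2,1,5,11,4,3,8,13,24,23,6,15,17,33,35,34,36], Sub 91 [12,2,1,5,11,4,
   3,8,13,24,23,6,17,15,34,36,33,35], Sub 91 [12,2,1,5,11,4,3,8,13,24,23,6,15,17,35,33,34,36],
   Sub 91 [12,2,1,5,11,4,3,8,13,24,23,6,17,15,36,34,33,35], Sub 7 [23,13,24,37,11,5,12], Sub 96 [1,
   2,3,4,5,6,7,8,9,10,11,12,13,14,15,16,17,18,19,20,37,23,24,25,26,27,28,29,30,31,32,33,34,35,36,
   38]]),
   ([[2,5,8],[3,7],[4,10],[5,6],[11],[9,14],[16,18],[15,17],[34,35],[19,20],[12,13],[25,27],[26,
   28],[33,36],[],[31,32],[37,38],[29,30],[21,22],[23,24],[],[],[],[],[],[],[],[],[],[],[],[],[],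
   [],[],[],[],[]], 37, [Sub 6 [15,8,17,37,1,2,5,38], Sub 95 [4,5,1,2,3,7,11,6,16,8,10,20,19,18,9,
   13,14,12,17,15,37,38,23,21,24,22,25,27,26,29,31,32,30], Sub 95 [4,5,1,2,3,7,11,6,16,8,10,20,19,
   18,9,13,14,12,17,15,37,38,23,22,24,21,25,27,26,29,31,32,30], Sub 95 [4,5,1,2,3,7,11,6,16,8,10,
   19,20,18,9,13,14,12,17,15,37,38,21,23,22,24,25,27,26,29,31,32,30], Sub 95 [4,5,1,2,3,7,11,6,16,
   8,10,19,20,18,9,13,14,12,17,15,37,38,21,24,22,23,25,27,26,29,31,32,30], Sub 91 [15,4,5,1,8,2,3,
   11,17,37,38,7,12,13,25,27,26,28], Sub 91 [15,4,5,1,8,2,3,11,17,37,38,7,13,12,26,28,25,27],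
   Sub 91 [15,4,5,1,8,2,3,11,17,37,38,7,12,13,27,25,26,28], Sub 91 [15,4,5,1,8,2,3,11,17,37,38,7,
   13,12,28,26,25,27], Sub 91 [15,3,2,1,8,5,4,7,17,37,38,11,18,16,29,30,31,32], Sub 91 [15,3,2,1,8,
   5,4,7,17,37,38,11,18,16,30,29,31,32], Sub 91 [15,3,2,1,8,5,4,7,17,37,38,11,16,18,31,32,29,30],
   Sub 91 [15,3,2,1,8,5,4,7,17,37,38,11,16,18,32,31,29,30], Sub 95 [3,2,1,5,4,11,7,10,12,8,6,9,14,
   13,19,18,20,16,17,15,37,38,34,33,35,36,31,32,29,26,25,27,28], Sub 95 [3,2,1,5,4,11,7,10,12,8,6,
   14,9,13,19,18,20,16,17,15,37,38,33,34,36,35,31,32,29,26,25,27,28], Sub 95 [3,2,1,5,4,11,7,10,12,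
   8,6,14,9,13,19,18,20,16,17,15,37,38,33,35,36,34,31,32,29,26,25,27,28], Sub 95 [3,2,1,5,4,11,7,
   10,12,8,6,9,14,13,19,18,20,16,17,15,37,38,34,36,35,33,31,32,29,26,25,27,28], Sub 1 [17,37,38],
   Sub 97 [2,3,4,5,1,11,10,7,12,6,8,15,17,13,16,19,18,20,9,14,34,33,37,38,23,24,21,22,26,25,27,28,
   31,29,32,30,39]])]"

text \<open>Numbers 99 to 104. All these patterns extend the 5-cycle on the labels 1 to 5 together
  with its five outer neighbours 8, 7, 10, 6, 11.\<close>

definition steps5 :: "(nat list list \<times> nat \<times> leaf list) list" where
  "steps5 = [
   ([[2,5,8],[3,7],[4,10],[5,6],[11],[9,14],[16,18],[15,17],[34,35],[19,20],[12,13],[25,27],[26,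
   28],[33,36],[37],[31,32],[],[29,30],[21,22],[23,24],[],[],[],[],[],[],[],[],[],[],[],[],[],[],
   [],[],[]], 15, [Sub 1 [8,15,17], Sub 90 [5,4,3,2,1,7,16,10,8,15,17,18,19,20,21,22,23,24,37],
   Sub 90 [5,4,3,2,1,7,16,10,8,15,17,18,19,20,22,21,23,24,37], Sub 90 [5,4,3,2,1,7,16,10,8,15,17,
   18,20,19,23,24,21,22,37], Sub 90 [5,4,3,2,1,7,16,10,8,15,17,18,20,19,24,23,21,22,37], Sub 93 [2,
   1,5,4,3,6,8,7,9,11,10,14,16,17,18,15,12,13,25,27,26,28,37], Sub 93 [2,1,5,4,3,6,8,7,9,11,10,14,
   16,17,18,15,13,12,26,28,25,27,37], Sub 93 [2,1,5,4,3,6,8,7,9,11,10,14,16,17,18,15,12,13,27,25,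
   26,28,37], Sub 93 [2,1,5,4,3,6,8,7,9,11,10,14,16,17,18,15,13,12,28,26,25,27,37], Sub 93 [5,1,2,
   3,4,10,8,11,19,7,6,20,12,17,13,15,18,16,29,30,31,32,37], Sub 93 [5,1,2,3,4,10,8,11,19,7,6,20,12,
   17,13,15,18,16,30,29,31,32,37], Sub 93 [5,1,2,3,4,10,8,11,19,7,6,20,12,17,13,15,16,18,31,32,29,
   30,37], Sub 93 [5,1,2,3,4,10,8,11,19,7,6,20,12,17,13,15,16,18,32,31,29,30,37], Sub 90 [2,3,4,5,
   1,11,12,6,8,15,17,13,14,9,33,36,34,35,37], Sub 90 [2,3,4,5,1,11,12,6,8,15,17,13,9,14,34,35,33,
   36,37], Sub 90 [2,3,4,5,1,11,12,6,8,15,17,13,9,14,35,34,33,36,37], Sub 90 [2,3,4,5,1,11,12,6,8,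
   15,17,13,14,9,36,33,34,35,37], Sub 98 [1,2,3,4,5,6,7,8,9,10,11,12,13,14,17,16,15,18,19,20,21,22,
   23,24,25,26,27,28,29,30,31,32,33,34,35,36,37,38]]),
   ([[2,5,8],[3,7],[4,10],[5,6],[11],[9,14],[16,18],[15,17],[34,35],[19,20],[12,13],[25,27],[26,
   28],[33,36],[],[31,32],[],[29,30],[21,22],[23,24],[],[],[],[],[],[],[],[],[],[],[],[],[],[],[],
   []], 15, [Sub 1 [8,15,17], Sub 91 [5,4,3,2,1,7,16,10,8,15,17,18,19,20,21,22,23,24], Sub 91 [5,4,
   3,2,1,7,16,10,8,15,17,18,19,20,22,21,23,24], Sub 91 [5,4,3,2,1,7,16,10,8,15,17,18,20,19,23,24,
   21,22], Sub 91 [5,4,3,2,1,7,16,10,8,15,17,18,20,19,24,23,21,22], Sub 94 [2,1,5,4,3,6,8,7,9,11,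
   10,14,16,17,18,15,12,13,25,27,26,28], Sub 94 [2,1,5,4,3,6,8,7,9,11,10,14,16,17,18,15,13,12,26,
   28,25,27], Sub 94 [2,1,5,4,3,6,8,7,9,11,10,14,16,17,18,15,12,13,27,25,26,28], Sub 94 [2,1,5,4,3,
   6,8,7,9,11,10,14,16,17,18,15,13,12,28,26,25,27], Sub 94 [5,1,2,3,4,10,8,11,19,7,6,20,12,17,13,
   15,18,16,29,30,31,32], Sub 94 [5,1,2,3,4,10,8,11,19,7,6,20,12,17,13,15,18,16,30,29,31,32],
   Sub 94 [5,1,2,3,4,10,8,11,19,7,6,20,12,17,13,15,16,18,31,32,29,30], Sub 94 [5,1,2,3,4,10,8,11,
   19,7,6,20,12,17,13,15,16,18,32,31,29,30], Sub 91 [2,3,4,5,1,11,12,6,8,15,17,13,14,9,33,36,34,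
   35], Sub 91 [2,3,4,5,1,11,12,6,8,15,17,13,9,14,34,35,33,36], Sub 91 [2,3,4,5,1,11,12,6,8,15,17,
   13,9,14,35,34,33,36], Sub 91 [2,3,4,5,1,11,12,6,8,15,17,13,14,9,36,33,34,35], Sub 99 [1,2,3,4,5,
   6,7,8,9,10,11,12,13,14,15,16,17,18,19,20,21,22,23,24,25,26,27,28,29,30,31,32,33,34,35,36,37]]),
   ([[2,5,8],[3,7],[4,10],[5,6],[11],[9,14],[16,18],[15,17],[34,35],[19,20],[12,13],[25,27],[26,
   28],[33],[],[31,32],[],[29,30],[21,22],[23,24],[],[],[],[],[],[],[],[],[],[],[],[],[],[],[]],
   14, [Sub 86 [1,5,4,3,2,10,11,8,19,6,7,33,20,15,17,14,9,34,35], Sub 86 [1,5,4,3,2,10,11,8,19,6,7,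
   33,20,17,15,14,9,34,35], Sub 93 [2,3,4,5,1,11,10,7,12,6,8,13,16,20,18,19,14,9,21,33,34,35,22],
   Sub 93 [2,3,4,5,1,11,10,7,12,6,8,13,16,20,18,19,14,9,22,33,34,35,21], Sub 93 [2,3,4,5,1,11,10,7,
   12,6,8,13,16,19,18,20,14,9,23,33,34,35,24], Sub 93 [2,3,4,5,1,11,10,7,12,6,8,13,16,19,18,20,14,
   9,24,33,34,35,23], Sub 93 [1,5,4,3,2,10,11,8,19,6,7,20,15,13,17,12,14,9,25,33,34,35,27],
   Sub 93 [1,5,4,3,2,10,11,8,19,6,7,20,15,12,17,13,14,9,26,33,34,35,28], Sub 93 [1,5,4,3,2,10,11,8,
   19,6,7,20,15,13,17,12,14,9,27,33,34,35,25], Sub 93 [1,5,4,3,2,10,11,8,19,6,7,20,15,12,17,13,14,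
   9,28,33,34,35,26], Sub 86 [6,9,2,3,4,10,34,14,19,7,5,30,20,29,33,18,16,31,32], Sub 86 [6,9,2,3,
   4,10,34,14,19,7,5,29,20,30,33,18,16,31,32], Sub 86 [6,9,2,3,4,10,34,14,19,7,5,32,20,31,33,16,18,
   29,30], Sub 86 [6,9,2,3,4,10,34,14,19,7,5,31,20,32,33,16,18,29,30], Sub 5 [9,6,14,34,4,3,5,33,
   35], Sub 5 [9,6,14,35,4,3,5,33,34], Sub 100 [1,2,3,4,5,6,7,8,9,10,11,12,13,14,15,16,17,18,19,20,
   21,22,23,24,25,26,27,28,29,30,31,32,33,34,35,36]]),
   ([[2,5,8],[3,7],[4,10],[5,6],[11],[9,14],[16,18],[15,17],[34],[19,20],[12,13],[25,27],[26,28],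
   [33],[],[31,32],[],[29,30],[21,22],[23,24],[],[],[],[],[],[],[],[],[],[],[],[],[],[]], 9,
   [Sub 1 [6,9,14], Sub 87 [2,3,4,5,1,11,10,7,6,8,15,17,34,19,20,9,14,33], Sub 87 [2,3,4,5,1,11,10,
   7,6,8,17,15,34,19,20,9,14,33], Sub 93 [5,4,3,2,1,7,6,11,16,10,8,18,12,14,13,9,19,20,21,22,23,24,
   34], Sub 93 [5,4,3,2,1,7,6,11,16,10,8,18,12,14,13,9,19,20,22,21,23,24,34], Sub 93 [5,4,3,2,1,7,
   6,11,16,10,8,18,12,14,13,9,20,19,23,24,21,22,34], Sub 93 [5,4,3,2,1,7,6,11,16,10,8,18,12,14,13,
   9,20,19,24,23,21,22,34], Sub 93 [3,4,5,1,2,8,6,10,15,11,7,17,19,14,20,9,12,13,25,27,26,28,34],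
   Sub 93 [3,4,5,1,2,8,6,10,15,11,7,17,19,14,20,9,13,12,26,28,25,27,34], Sub 93 [3,4,5,1,2,8,6,10,
   15,11,7,17,19,14,20,9,12,13,27,25,26,28,34], Sub 93 [3,4,5,1,2,8,6,10,15,11,7,17,19,14,20,9,13,
   12,28,26,25,27,34], Sub 86 [6,14,2,3,4,10,33,9,19,7,5,30,20,29,34,18,16,31,32], Sub 86 [6,14,2,
   3,4,10,33,9,19,7,5,29,20,30,34,18,16,31,32], Sub 86 [6,14,2,3,4,10,33,9,19,7,5,32,20,31,34,16,
   18,29,30], Sub 86 [6,14,2,3,4,10,33,9,19,7,5,31,20,32,34,16,18,29,30], Sub 6 [14,6,9,33,4,3,5,
   34], Sub 101 [1,2,3,4,5,6,7,8,9,10,11,12,13,14,15,16,17,18,19,20,21,22,23,24,25,26,27,28,29,30,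
   31,32,33,34,35]]),
   ([[2,5,8],[3,7],[4,10],[5,6],[11],[9,14],[16,18],[15,17],[],[19,20],[12,13],[25,27],[26,28],
   [33],[],[31,32],[],[29,30],[21,22],[23,24],[],[],[],[],[],[],[],[],[],[],[],[],[]], 9,
   [Sub 1 [6,9,14], Sub 89 [2,3,4,5,1,11,10,7,6,8,15,17,19,20,9,14], Sub 89 [2,3,4,5,1,11,10,7,6,8,
   17,15,19,20,9,14], Sub 94 [5,4,3,2,1,7,6,11,16,10,8,18,12,14,13,9,19,20,21,22,23,24], Sub 94 [5,
   4,3,2,1,7,6,11,16,10,8,18,12,14,13,9,19,20,22,21,23,24], Sub 94 [5,4,3,2,1,7,6,11,16,10,8,18,12,
   14,13,9,20,19,23,24,21,22], Sub 94 [5,4,3,2,1,7,6,11,16,10,8,18,12,14,13,9,20,19,24,23,21,22],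
   Sub 94 [3,4,5,1,2,8,6,10,15,11,7,17,19,14,20,9,12,13,25,27,26,28], Sub 94 [3,4,5,1,2,8,6,10,15,
   11,7,17,19,14,20,9,13,12,26,28,25,27], Sub 94 [3,4,5,1,2,8,6,10,15,11,7,17,19,14,20,9,12,13,27,
   25,26,28], Sub 94 [3,4,5,1,2,8,6,10,15,11,7,17,19,14,20,9,13,12,28,26,25,27], Sub 91 [5,1,2,3,4,
   10,19,7,6,9,14,20,18,16,29,30,31,32], Sub 91 [5,1,2,3,4,10,19,7,6,9,14,20,18,16,30,29,31,32],
   Sub 91 [5,1,2,3,4,10,19,7,6,9,14,20,16,18,31,32,29,30], Sub 91 [5,1,2,3,4,10,19,7,6,9,14,20,16,
   18,32,31,29,30], Sub 7 [9,6,14,33,4,3,5], Sub 102 [1,2,3,4,5,6,7,8,9,10,11,12,13,14,15,16,17,18,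
   19,20,21,22,23,24,25,26,27,28,29,30,31,32,33,34]]),
   ([[2,5,8],[3,7],[4,10],[5,6],[11],[9,14],[16,18],[15,17],[],[19,20],[12,13],[25,27],[26,28],[],
   [],[31,32],[],[29,30],[21,22],[23,24],[],[],[],[],[],[],[],[],[],[],[],[]], 14, [Sub 1 [6,9,14],
   Sub 89 [2,3,4,5,1,11,10,7,6,8,15,17,19,20,14,9], Sub 89 [2,3,4,5,1,11,10,7,6,8,17,15,19,20,14,
   9], Sub 94 [5,4,3,2,1,7,6,11,16,10,8,18,12,9,13,14,19,20,21,22,23,24], Sub 94 [5,4,3,2,1,7,6,11,
   16,10,8,18,12,9,13,14,19,20,22,21,23,24], Sub 94 [5,4,3,2,1,7,6,11,16,10,8,18,12,9,13,14,20,19,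
   23,24,21,22], Sub 94 [5,4,3,2,1,7,6,11,16,10,8,18,12,9,13,14,20,19,24,23,21,22], Sub 94 [3,4,5,
   1,2,8,6,10,15,11,7,17,19,9,20,14,12,13,25,27,26,28], Sub 94 [3,4,5,1,2,8,6,10,15,11,7,17,19,9,
   20,14,13,12,26,28,25,27], Sub 94 [3,4,5,1,2,8,6,10,15,11,7,17,19,9,20,14,12,13,27,25,26,28],
   Sub 94 [3,4,5,1,2,8,6,10,15,11,7,17,19,9,20,14,13,12,28,26,25,27], Sub 91 [5,1,2,3,4,10,19,7,6,
   14,9,20,18,16,29,30,31,32], Sub 91 [5,1,2,3,4,10,19,7,6,14,9,20,18,16,30,29,31,32], Sub 91 [5,1,
   2,3,4,10,19,7,6,14,9,20,16,18,31,32,29,30], Sub 91 [5,1,2,3,4,10,19,7,6,14,9,20,16,18,32,31,29,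
   30], Sub 103 [1,2,3,4,5,6,7,8,9,10,11,12,13,14,15,16,17,18,19,20,21,22,23,24,25,26,27,28,29,30,
   31,32,33]])]"

definition steps6 :: "(nat list list \<times> nat \<times> leaf list) list" where
  "steps6 = [
   ([[2,5,8],[3,7],[4,10],[5,6],[11],[9,14],[16,18],[15,17],[],[19,20],[12,13],[25,27],[26,28],[],
   [],[31],[],[29,30],[21,22],[23,24],[],[],[],[],[],[],[],[],[],[],[]], 16, [Sub 86 [4,3,2,1,5,8,
   10,6,15,7,11,31,17,9,14,16,18,29,30], Sub 86 [4,3,2,1,5,8,10,6,15,7,11,31,17,14,9,16,18,29,30],
   Sub 83 [4,5,1,2,3,7,16,8,10,18,15,17,31], Sub 83 [4,5,1,2,3,7,16,8,10,18,17,15,31], Sub 93 [1,2,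
   3,4,5,6,7,8,9,10,11,14,15,18,17,16,19,20,21,22,23,24,31], Sub 93 [1,2,3,4,5,6,7,8,9,10,11,14,15,
   18,17,16,19,20,22,21,23,24,31], Sub 93 [1,2,3,4,5,6,7,8,9,10,11,14,15,18,17,16,20,19,23,24,21,
   22,31], Sub 93 [1,2,3,4,5,6,7,8,9,10,11,14,15,18,17,16,20,19,24,23,21,22,31], Sub 86 [7,18,5,1,
   2,8,29,16,15,11,3,27,17,25,31,12,13,26,28], Sub 86 [7,18,5,1,2,8,29,16,15,11,3,28,17,26,31,13,
   12,25,27], Sub 86 [7,18,5,1,2,8,29,16,15,11,3,25,17,27,31,12,13,26,28], Sub 86 [7,18,5,1,2,8,29,
   16,15,11,3,26,17,28,31,13,12,25,27], Sub 5 [16,7,18,29,2,1,3,30,31], Sub 5 [16,7,18,30,2,1,3,29,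
   31], Sub 104 [1,2,3,4,5,6,7,8,9,10,11,12,13,14,15,16,17,18,19,20,21,22,23,24,25,26,27,28,29,30,
   31,32]]),
   ([[2,5,8],[3,7],[4,10],[5,6],[11],[9,14],[16,18],[15,17],[],[19,20],[12,13],[25,27],[26,28],[],
   [],[],[],[29,30],[21,22],[23,24],[],[],[],[],[],[],[],[],[],[]], 16, [Sub 89 [1,5,4,3,2,10,11,8,
   6,7,16,18,12,13,9,14], Sub 89 [1,5,4,3,2,10,11,8,6,7,16,18,12,13,14,9], Sub 84 [4,3,2,1,5,8,10,
   15,7,17,16,18], Sub 84 [4,3,2,1,5,8,10,17,7,15,16,18], Sub 94 [1,2,3,4,5,6,7,8,9,10,11,14,15,18,
   17,16,19,20,21,22,23,24], Sub 94 [1,2,3,4,5,6,7,8,9,10,11,14,15,18,17,16,19,20,22,21,23,24],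
   Sub 94 [1,2,3,4,5,6,7,8,9,10,11,14,15,18,17,16,20,19,23,24,21,22], Sub 94 [1,2,3,4,5,6,7,8,9,10,
   11,14,15,18,17,16,20,19,24,23,21,22], Sub 91 [3,4,5,1,2,8,15,11,7,16,18,17,12,13,25,27,26,28],
   Sub 91 [3,4,5,1,2,8,15,11,7,16,18,17,13,12,26,28,25,27], Sub 91 [3,4,5,1,2,8,15,11,7,16,18,17,
   12,13,27,25,26,28], Sub 91 [3,4,5,1,2,8,15,11,7,16,18,17,13,12,28,26,25,27], Sub 6 [16,7,18,29,
   2,1,3,30], Sub 6 [16,7,18,30,2,1,3,29], Sub 105 [1,2,3,4,5,6,7,8,9,10,11,12,13,14,15,16,17,18,
   19,20,21,22,23,24,25,26,27,28,29,30,31]]),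
   ([[2,5,8],[3,7],[4,10],[5,6],[11],[9,14],[16,18],[15,17],[],[19,20],[12,13],[25,27],[26,28],[],
   [],[],[],[29],[21,22],[23,24],[],[],[],[],[],[],[],[],[]], 18, [Sub 88 [5,1,2,3,4,10,8,11,7,6,9,
   14,29,15,17,18,16], Sub 88 [5,1,2,3,4,10,8,11,7,6,14,9,29,15,17,18,16], Sub 83 [4,5,1,2,3,7,18,
   8,10,16,15,17,29], Sub 1 [7,16,18], Sub 83 [4,5,1,2,3,7,18,8,10,16,17,15,29], Sub 93 [1,2,3,4,5,
   6,7,8,9,10,11,14,15,16,17,18,19,20,21,22,23,24,29], Sub 93 [1,2,3,4,5,6,7,8,9,10,11,14,15,16,17,
   18,19,20,22,21,23,24,29], Sub 93 [1,2,3,4,5,6,7,8,9,10,11,14,15,16,17,18,20,19,23,24,21,22,29],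
   Sub 93 [1,2,3,4,5,6,7,8,9,10,11,14,15,16,17,18,20,19,24,23,21,22,29], Sub 90 [3,4,5,1,2,8,15,11,
   7,18,16,17,12,13,25,27,26,28,29], Sub 90 [3,4,5,1,2,8,15,11,7,18,16,17,13,12,26,28,25,27,29],
   Sub 90 [3,4,5,1,2,8,15,11,7,18,16,17,12,13,27,25,26,28,29], Sub 90 [3,4,5,1,2,8,15,11,7,18,16,
   17,13,12,28,26,25,27,29], Sub 106 [1,2,3,4,5,6,7,8,9,10,11,12,13,14,15,16,17,18,19,20,21,22,23,
   24,25,26,27,28,29,30]]),
   ([[2,5,8],[3,7],[4,10],[5,6],[11],[9,14],[16,18],[15,17],[],[19,20],[12,13],[25,27],[26,28],[],
   [],[],[],[],[21,22],[23,24],[],[],[],[],[],[],[],[]], 18, [Sub 89 [1,5,4,3,2,10,11,8,6,7,18,16,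
   12,13,9,14], Sub 89 [1,5,4,3,2,10,11,8,6,7,18,16,12,13,14,9], Sub 84 [4,3,2,1,5,8,10,15,7,17,18,
   16], Sub 1 [7,16,18], Sub 84 [4,3,2,1,5,8,10,17,7,15,18,16], Sub 94 [1,2,3,4,5,6,7,8,9,10,11,14,
   15,16,17,18,19,20,21,22,23,24], Sub 94 [1,2,3,4,5,6,7,8,9,10,11,14,15,16,17,18,19,20,22,21,23,
   24], Sub 94 [1,2,3,4,5,6,7,8,9,10,11,14,15,16,17,18,20,19,23,24,21,22], Sub 94 [1,2,3,4,5,6,7,8,
   9,10,11,14,15,16,17,18,20,19,24,23,21,22], Sub 91 [3,4,5,1,2,8,15,11,7,18,16,17,12,13,25,27,26,
   28], Sub 91 [3,4,5,1,2,8,15,11,7,18,16,17,13,12,26,28,25,27], Sub 91 [3,4,5,1,2,8,15,11,7,18,16,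
   17,12,13,27,25,26,28], Sub 91 [3,4,5,1,2,8,15,11,7,18,16,17,13,12,28,26,25,27], Sub 107 [1,2,3,
   4,5,6,7,8,9,10,11,12,13,14,15,16,17,18,19,20,21,22,23,24,25,26,27,28,29]]),
   ([[2,5,8],[3,7],[4,10],[5,6],[11],[9,14],[16,18],[15,17],[],[19,20],[12,13],[25,27],[26],[],[],
   [],[],[],[21,22],[23,24],[],[],[],[],[],[],[]], 13, [Sub 83 [2,3,4,5,1,11,13,6,8,12,9,14,26],
   Sub 83 [2,3,4,5,1,11,13,6,8,12,14,9,26], Sub 83 [3,2,1,5,4,11,13,8,6,12,15,17,26], Sub 86 [2,1,
   5,4,3,6,8,7,9,11,10,26,14,16,18,13,12,25,27], Sub 83 [3,2,1,5,4,11,13,8,6,12,17,15,26],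
   Sub 86 [2,1,5,4,3,6,8,7,9,11,10,26,14,18,16,13,12,25,27], Sub 86 [10,20,5,4,3,6,23,19,9,11,2,26,
   14,21,22,13,12,25,27], Sub 86 [10,20,5,4,3,6,23,19,9,11,2,26,14,22,21,13,12,25,27], Sub 86 [10,
   19,5,4,3,6,21,20,9,11,2,26,14,23,24,13,12,25,27], Sub 86 [10,19,5,4,3,6,21,20,9,11,2,26,14,24,
   23,13,12,25,27], Sub 5 [12,11,13,25,5,1,4,26,27], Sub 5 [12,11,13,27,5,1,4,26,25], Sub 108 [1,2,
   3,4,5,6,7,8,9,10,11,12,13,14,15,16,17,18,19,20,21,22,23,24,25,26,27,28]]),
   ([[2,5,8],[3,7],[4,10],[5,6],[11],[9,14],[16,18],[15,17],[],[19,20],[12,13],[25],[26],[],[],[],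
   [],[],[21,22],[23,24],[],[],[],[],[],[]], 12, [Sub 83 [2,3,4,5,1,11,12,6,8,13,9,14,25],
   Sub 1 [11,12,13], Sub 83 [2,3,4,5,1,11,12,6,8,13,14,9,25], Sub 83 [3,2,1,5,4,11,12,8,6,13,15,17,
   25], Sub 87 [3,4,5,1,2,8,6,10,11,7,16,18,25,9,14,12,13,26], Sub 83 [3,2,1,5,4,11,12,8,6,13,17,
   15,25], Sub 87 [3,4,5,1,2,8,6,10,11,7,18,16,25,9,14,12,13,26], Sub 86 [11,13,3,4,5,6,26,12,9,10,
   1,22,14,21,25,19,20,23,24], Sub 86 [11,13,3,4,5,6,26,12,9,10,1,21,14,22,25,19,20,23,24],
   Sub 86 [11,13,3,4,5,6,26,12,9,10,1,24,14,23,25,20,19,21,22], Sub 86 [11,13,3,4,5,6,26,12,9,10,1,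
   23,14,24,25,20,19,21,22], Sub 6 [13,11,12,26,5,1,4,25], Sub 109 [1,2,3,4,5,6,7,8,9,10,11,12,13,
   14,15,16,17,18,19,20,21,22,23,24,25,26,27]]),
   ([[2,5,8],[3,7],[4,10],[5,6],[11],[9,14],[16,18],[15,17],[],[19,20],[12,13],[25],[],[],[],[],[],
   [],[21,22],[23,24],[],[],[],[],[]], 13, [Sub 84 [2,1,5,4,3,6,8,9,11,14,13,12], Sub 1 [11,12,13],
   Sub 84 [2,1,5,4,3,6,8,14,11,9,13,12], Sub 84 [3,2,1,5,4,11,7,13,8,12,15,17], Sub 89 [3,4,5,1,2,
   8,6,10,11,7,16,18,9,14,13,12], Sub 84 [3,2,1,5,4,11,7,13,8,12,17,15], Sub 89 [3,4,5,1,2,8,6,10,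
   11,7,18,16,9,14,13,12], Sub 91 [1,2,3,4,5,6,9,10,11,13,12,14,19,20,21,22,23,24], Sub 91 [1,2,3,
   4,5,6,9,10,11,13,12,14,19,20,22,21,23,24], Sub 91 [1,2,3,4,5,6,9,10,11,13,12,14,20,19,23,24,21,
   22], Sub 91 [1,2,3,4,5,6,9,10,11,13,12,14,20,19,24,23,21,22], Sub 7 [12,11,13,25,5,1,4],
   Sub 110 [1,2,3,4,5,6,7,8,9,10,11,12,13,14,15,16,17,18,19,20,21,22,23,24,25,26]]),
   ([[2,5,8],[3,7],[4,10],[5,6],[11],[9,14],[16,18],[15,17],[],[19,20],[12,13],[],[],[],[],[],[],
   [],[21,22],[23,24],[],[],[],[]], 12, [Sub 84 [2,1,5,4,3,6,8,9,11,14,12,13], Sub 1 [11,12,13],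
   Sub 84 [2,1,5,4,3,6,8,14,11,9,12,13], Sub 84 [3,2,1,5,4,11,7,12,8,13,15,17], Sub 89 [3,4,5,1,2,
   8,6,10,11,7,16,18,9,14,12,13], Sub 84 [3,2,1,5,4,11,7,12,8,13,17,15], Sub 89 [3,4,5,1,2,8,6,10,
   11,7,18,16,9,14,12,13], Sub 91 [1,2,3,4,5,6,9,10,11,12,13,14,19,20,21,22,23,24], Sub 91 [1,2,3,
   4,5,6,9,10,11,12,13,14,19,20,22,21,23,24], Sub 91 [1,2,3,4,5,6,9,10,11,12,13,14,20,19,23,24,21,
   22], Sub 91 [1,2,3,4,5,6,9,10,11,12,13,14,20,19,24,23,21,22], Sub 111 [1,2,3,4,5,6,7,8,9,10,11,
   12,13,14,15,16,17,18,19,20,21,22,23,24,25]])]"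

text \<open>Numbers 113 to 131. The surroundings of the 5-cycle shrink until 130 leaves only the
  cycle and one pendant edge. Number 131, a hexagon with pendant trees, belongs to the last stage,
  in which 4-cycles and 5-cycles are already settled.\<close>

definition steps7 :: "(nat list list \<times> nat \<times> leaf list) list" where
  "steps7 = [
   ([[2,5,8],[3,7],[4,10],[5,6],[11],[9,14],[16,18],[15,17],[],[19,20],[12,13],[],[],[],[],[],[],
   [],[21,22],[23],[],[],[]], 20, [Sub 83 [1,5,4,3,2,10,20,6,7,19,9,14,23], Sub 86 [5,4,3,2,1,7,6,
   11,16,10,8,23,18,12,13,20,19,21,22], Sub 86 [5,4,3,2,1,7,6,11,16,10,8,23,18,13,12,20,19,21,22],
   Sub 83 [1,5,4,3,2,10,20,6,7,19,14,9,23], Sub 86 [1,2,3,4,5,6,7,8,9,10,11,23,14,15,17,20,19,21,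
   22], Sub 83 [5,1,2,3,4,10,20,7,6,19,16,18,23], Sub 86 [1,2,3,4,5,6,7,8,9,10,11,23,14,17,15,20,
   19,21,22], Sub 83 [5,1,2,3,4,10,20,7,6,19,18,16,23], Sub 5 [19,10,20,21,3,2,4,23,22], Sub 5 [19,
   10,20,22,3,2,4,23,21], Sub 112 [1,2,3,4,5,6,7,8,9,10,11,12,13,14,15,16,17,18,19,20,21,22,23,
   24]]),
   ([[2,5,8],[3,7],[4,10],[5,6],[11],[9,14],[16,18],[15,17],[],[19,20],[12,13],[],[],[],[],[],[],
   [],[21,22],[],[],[]], 20, [Sub 84 [1,2,3,4,5,6,7,9,10,14,20,19], Sub 89 [1,2,3,4,5,6,7,8,10,11,
   12,13,16,18,20,19], Sub 89 [1,2,3,4,5,6,7,8,10,11,13,12,16,18,20,19], Sub 84 [1,2,3,4,5,6,7,14,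
   10,9,20,19], Sub 89 [4,5,1,2,3,7,11,6,8,10,20,19,12,13,15,17], Sub 84 [5,1,2,3,4,10,8,20,7,19,
   16,18], Sub 89 [4,5,1,2,3,7,11,6,8,10,20,19,12,13,17,15], Sub 84 [5,1,2,3,4,10,8,20,7,19,18,16],
   Sub 6 [20,10,19,21,3,2,4,22], Sub 6 [20,10,19,22,3,2,4,21], Sub 113 [1,2,3,4,5,6,7,8,9,10,11,12,
   13,14,15,16,17,18,19,20,21,22,23]]),
   ([[2,5,8],[3,7],[4,10],[5,6],[11],[9,14],[16,18],[15,17],[],[19,20],[12,13],[],[],[],[],[],[],
   [],[21],[],[]], 19, [Sub 83 [1,5,4,3,2,10,19,6,7,20,9,14,21], Sub 88 [1,2,3,4,5,6,7,8,10,11,12,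
   13,21,16,18,19,20], Sub 88 [1,2,3,4,5,6,7,8,10,11,13,12,21,16,18,19,20], Sub 83 [1,5,4,3,2,10,
   19,6,7,20,14,9,21], Sub 88 [5,4,3,2,1,7,6,11,10,8,15,17,21,9,14,19,20], Sub 83 [5,1,2,3,4,10,19,
   7,6,20,16,18,21], Sub 88 [5,4,3,2,1,7,6,11,10,8,17,15,21,9,14,19,20], Sub 83 [5,1,2,3,4,10,19,7,
   6,20,18,16,21], Sub 1 [10,19,20], Sub 114 [1,2,3,4,5,6,7,8,9,10,11,12,13,14,15,16,17,18,19,20,
   21,22]]),
   ([[2,5,8],[3,7],[4,10],[5,6],[11],[9,14],[16,18],[15,17],[],[19,20],[12,13],[],[],[],[],[],[],
   [],[],[]], 19, [Sub 84 [1,2,3,4,5,6,7,9,10,14,19,20], Sub 89 [1,2,3,4,5,6,7,8,10,11,12,13,16,18,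
   19,20], Sub 89 [1,2,3,4,5,6,7,8,10,11,13,12,16,18,19,20], Sub 84 [1,2,3,4,5,6,7,14,10,9,19,20],
   Sub 89 [4,5,1,2,3,7,11,6,8,10,19,20,12,13,15,17], Sub 84 [5,1,2,3,4,10,8,19,7,20,16,18],
   Sub 89 [4,5,1,2,3,7,11,6,8,10,19,20,12,13,17,15], Sub 84 [5,1,2,3,4,10,8,19,7,20,18,16],
   Sub 1 [10,19,20], Sub 115 [1,2,3,4,5,6,7,8,9,10,11,12,13,14,15,16,17,18,19,20,21]]),
   ([[2,5,8],[3,7],[4,10],[5,6],[11],[9,14],[16,18],[15,17],[],[19],[12,13],[],[],[],[],[],[],[],
   []], 10, [Sub 76 [6,9,10,3,4,2,1,5,8,19,11,14,7], Sub 55 [6,19,10,3,4,2,1,5,8,12,11,7,13],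
   Sub 55 [6,19,10,3,4,2,1,5,8,13,11,7,12], Sub 76 [6,14,10,3,4,2,1,5,8,19,11,9,7], Sub 55 [7,17,8,
   1,2,5,4,3,6,15,10,11,19], Sub 76 [7,16,10,3,2,4,5,1,11,19,8,18,6], Sub 55 [7,15,8,1,2,5,4,3,6,
   17,10,11,19], Sub 76 [7,18,10,3,2,4,5,1,11,19,8,16,6], Sub 116 [1,2,3,4,5,6,7,8,9,10,11,12,13,
   14,15,16,17,18,19,20]]),
   ([[2,5,8],[3,7],[4,10],[5,6],[11],[9,14],[16,18],[15,17],[],[],[12,13],[],[],[],[],[],[],[]],
   10, [Sub 78 [10,9,6,4,3,5,1,2,8,14,7], Sub 56 [1,2,3,4,5,6,13,11,10,12,8,7], Sub 56 [1,2,3,4,5,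
   6,12,11,10,13,8,7], Sub 78 [10,14,6,4,3,5,1,2,8,9,7], Sub 56 [5,4,3,2,1,7,17,8,10,15,11,6],
   Sub 78 [10,16,7,2,3,1,5,4,11,18,6], Sub 56 [5,4,3,2,1,7,15,8,10,17,11,6], Sub 78 [10,18,7,2,3,1,
   5,4,11,16,6], Sub 117 [1,2,3,4,5,6,7,8,9,10,11,12,13,14,15,16,17,18,19]]),
   ([[2,5,8],[3,7],[4,10],[5,6],[11],[9,14],[16],[15,17],[],[],[12,13],[],[],[],[],[],[]], 7,
   [Sub 55 [10,14,6,4,3,5,1,2,8,9,7,11,16], Sub 5 [3,2,7,10,1,5,8,16,4], Sub 55 [8,16,7,2,1,3,4,5,
   6,12,11,10,13], Sub 55 [8,16,7,2,1,3,4,5,6,13,11,10,12], Sub 55 [10,9,6,4,3,5,1,2,8,14,7,11,16],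
   Sub 76 [7,15,8,1,2,5,4,3,6,17,10,16,11], Sub 76 [7,17,8,1,2,5,4,3,6,15,10,16,11], Sub 118 [1,2,
   3,4,5,6,7,8,9,10,11,12,13,14,15,16,17,18]]),
   ([[2,5,8],[3,7],[4,10],[5,6],[11],[9,14],[16],[15],[],[],[12,13],[],[],[],[],[]], 8, [Sub 5 [1,
   2,7,8,3,4,10,16,5], Sub 55 [11,14,6,4,5,3,2,1,7,9,8,10,15], Sub 39 [10,8,1,2,3,5,4,7,6,11,15],
   Sub 76 [8,12,11,5,1,4,3,2,10,13,7,15,6], Sub 76 [8,13,11,5,1,4,3,2,10,12,7,15,6], Sub 55 [11,9,
   6,4,5,3,2,1,7,14,8,10,15], Sub 78 [7,16,8,1,2,5,4,3,6,15,10], Sub 119 [1,2,3,4,5,6,7,8,9,10,11,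
   12,13,14,15,16,17]]),
   ([[2,5,8],[3,7],[4,10],[5,6],[11],[9,14],[],[15],[],[],[12,13],[],[],[],[]], 7, [Sub 5 [2,1,8,7,
   5,4,11,15,3], Sub 56 [5,1,2,3,4,10,14,6,7,9,11,8], Sub 6 [7,2,3,10,1,5,8,4], Sub 56 [4,3,2,1,5,
   8,13,11,7,12,6,10], Sub 56 [4,3,2,1,5,8,12,11,7,13,6,10], Sub 56 [5,1,2,3,4,10,9,6,7,14,11,8],
   Sub 80 [7,15,8,1,2,5,4,3,6], Sub 120 [1,2,3,4,5,6,7,8,9,10,11,12,13,14,15,16]]),
   ([[2,5,8],[3,7],[4,10],[5,6],[11],[9,14],[],[],[],[],[12,13],[],[],[]], 8, [Sub 6 [8,1,2,7,5,4,
   11,3], Sub 56 [3,2,1,5,4,11,14,6,8,9,10,7], Sub 40 [10,8,1,2,3,5,4,7,6,11], Sub 78 [8,12,11,5,1,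
   4,3,2,10,13,7], Sub 78 [8,13,11,5,1,4,3,2,10,12,7], Sub 56 [3,2,1,5,4,11,9,6,8,14,10,7],
   Sub 121 [1,2,3,4,5,6,7,8,9,10,11,12,13,14,15]]),
   ([[2,5,8],[3,7],[4,10],[5,6],[11],[9],[],[],[],[],[12,13],[],[]], 6, [Sub 39 [7,6,4,3,2,5,1,10,
   8,11,9], Sub 39 [8,6,4,5,1,3,2,11,7,10,9], Sub 5 [3,4,6,10,5,1,11,9,2], Sub 76 [6,12,11,5,4,1,2,
   3,7,13,10,9,8], Sub 76 [6,13,11,5,4,1,2,3,7,12,10,9,8], Sub 122 [1,2,3,4,5,6,7,8,9,10,11,12,13,
   14]]),
   ([[2,5,8],[3,7],[4,10],[5,6],[11],[9],[],[],[],[],[12],[]], 11, [Sub 5 [4,5,11,6,1,2,8,12,3],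
   Sub 39 [7,11,5,1,2,4,3,8,10,6,12], Sub 5 [1,5,11,8,4,3,6,12,2], Sub 78 [6,9,11,5,4,1,2,3,7,12,
   10], Sub 39 [10,11,5,4,3,1,2,6,7,8,12], Sub 123 [1,2,3,4,5,6,7,8,9,10,11,12,13]]),
   ([[2,5,8],[3,7],[4,10],[5,6],[11],[9],[],[],[],[],[]], 11, [Sub 5 [5,4,6,11,3,2,10,9,1],
   Sub 40 [11,7,2,1,5,3,4,8,6,10], Sub 6 [8,1,5,11,2,3,7,4], Sub 80 [11,9,6,4,5,3,2,1,7],
   Sub 40 [11,10,3,4,5,2,1,6,8,7], Sub 124 [1,2,3,4,5,6,7,8,9,10,11,12]]),
   ([[2,5,8],[3,7],[4,10],[5,6],[],[9],[],[],[],[]], 5, [Sub 1 [4,5,6], Sub 6 [7,2,1,5,3,4,10,8],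
   Sub 1 [1,5,8], Sub 6 [6,4,5,9,3,2,10,1], Sub 6 [10,3,4,5,2,1,7,6], Sub 125 [1,2,3,4,5,6,7,8,9,
   10,11]]),
   ([[2,5,8],[3,7],[4],[5,6],[],[9],[],[],[]], 3, [Sub 1 [3,4,5], Sub 1 [3,4,6], Sub 1 [2,3,7],
   Sub 6 [8,3,2,1,4,5,6,7], Sub 6 [9,3,4,6,2,1,7,5], Sub 126 [1,2,3,4,5,6,7,8,9,10]]),
   ([[2,5,8],[3,7],[4],[5,6],[],[],[],[]], 6, [Sub 1 [3,4,6], Sub 1 [4,5,6], Sub 43 [5,1,2,3,4,7,
   6], Sub 43 [3,2,1,5,4,8,6], Sub 127 [1,2,3,4,5,6,7,8,9]]),
   ([[2,5],[3,7],[4],[5,6],[],[],[]], 1, [Sub 1 [1,2,3], Sub 7 [5,1,6,4,2,3,7], Sub 1 [1,2,7],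
   Sub 128 [1,2,3,4,5,6,7,8]]),
   ([[2,5],[3],[4],[5,6],[],[]], 2, [Sub 1 [1,2,5], Sub 8 [3,2,6,4,1,5], Sub 129 [1,2,3,4,5,6,7]]),
   ([[2],[3,4],[5,6],[7,10],[11],[],[8,9],[],[],[11,12],[],[]], 11, [Sub 43 [5,3,2,1,11,4,10],
   Sub 7 [5,3,6,11,2,1,4], Sub 126 [7,4,10,11,8,5,2,9,3,12], Sub 126 [7,4,10,11,9,5,2,8,3,12],
   Sub 1 [10,11,12], Sub 83 [8,1,2,4,7,10,11,3,9,12,5,6,13]])]"

definition steps8 :: "(nat list list \<times> nat \<times> leaf list) list" where
  "steps8 = [
   ([[2],[4,5],[8,10],[],[6,7],[8,9],[10,11],[],[],[],[]], 10, [Sub 126 [2,5,7,10,1,3,6,4,8,11],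
   Sub 126 [2,5,7,10,4,3,6,1,8,11], Sub 1 [3,8,10], Sub 43 [7,5,6,9,10,8,3], Sub 1 [7,10,11],
   Sub 131 [11,7,10,5,3,12,2,1,4,6,8,9]]),
   ([[2,7,11],[3,4],[5,6],[8,12],[],[14,16],[],[9,10],[17,19],[16,18],[],[13],[14,15],[17],[],[],
   [],[],[]], 17, [Sub 126 [3,6,14,17,5,9,16,2,8,13], Dense [1,4,6,10,13,17], Dense [1,4,6,10,13,
   17], Sub 5 [12,17,14,13,9,8,19,6,4], Sub 5 [13,14,17,15,6,3,16,9,12], Sub 5 [6,14,17,16,13,12,
   15,9,3], Sub 126 [10,8,9,17,18,14,4,16,6,19], Sub 1 [9,17,19], Sub 90 [19,12,4,8,9,10,16,2,17,
   14,20,18,3,1,6,5,7,11,13]]),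
   ([[2,3],[4,5],[6,9],[],[12,16],[7,8],[17,19],[16,18],[10,11],[12,13],[14,15],[],[],[],[],[],[],
   [],[]], 12, [Sub 5 [1,12,5,2,10,9,13,16,3], Sub 6 [4,12,5,2,10,9,13,16], Sub 1 [10,12,13],
   Sub 126 [11,9,10,12,14,5,3,15,2,13], Sub 126 [11,9,10,12,15,5,3,14,2,13], Sub 1 [5,12,16],
   Sub 133 [11,9,10,3,13,12,14,6,8,7,15,1,2,5,4,17,16,19,18], Sub 127 [5,12,18,8,16,6,10,2,3],
   Sub 133 [11,9,10,3,13,12,14,6,8,7,15,1,2,5,4,19,16,17,18], Sub 90 [13,1,3,9,10,11,14,6,12,5,20,
   15,8,7,16,18,17,19,2]]),
   ([[2,7,11],[3,4],[5,6],[8,12],[],[15,22],[],[9,10],[19,21],[20],[],[13,14],[16],[17,18],[23],[],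
   [22],[],[],[],[],[],[]], 17, [Sub 127 [3,6,22,17,5,14,15,2,12], Dense [2,6,8,12,17], Sub 28 [8,
   10,17,22,4,14,12,6,13,18,20,9,3,15,19,16,23,2], Dense [2,6,8,12,17], Sub 5 [13,12,14,17,4,2,8,
   18,16], Sub 6 [22,6,15,17,3,2,5,23], Sub 129 [13,12,14,17,16,22,4], Sub 1 [14,17,18], Dense [2,
   6,8,12,17], Dense [2,6,8,12,17], Dense [2,6,8,12,17], Sub 129 [15,6,22,17,23,14,3], Dense [2,6,
   8,12,17]]),
   ([[2,7,11],[3,4],[5,6],[8],[],[15,20],[16],[9,10],[18,19],[17],[],[13,14],[15,16],[],[21],[],[],
   [],[],[22,23],[],[],[]], 7, [Sub 5 [1,2,4,7,3,5,6,8,11], Sub 126 [3,2,1,7,5,16,4,6,13,11],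
   Sub 12 [13,15,1,7,16,2,3,10,6,4,12,8,17,20], Sub 1 [1,7,11], Sub 6 [16,7,12,13,1,2,11,14],
   Sub 129 [14,7,16,13,12,15,1], Dense [2,6,7,8,13], Dense [2,6,7,8,13], Dense [2,6,7,8,13],
   Sub 127 [13,15,21,7,16,1,6,12,2], Dense [2,6,7,8,13], Dense [2,6,7,8,13], Dense [2,6,7,8,13]]),
   ([[2,7,11],[3,4],[5,6],[8],[],[15,20],[],[9,10],[18],[17,19],[],[13,14],[15,16],[],[21],[17],[],
   [],[],[22,23],[],[],[]], 17, [Sub 5 [8,4,17,10,2,1,3,16,9], Dense [2,6,8,13,17], Dense [2,6,8,
   13,17], Sub 8 [9,8,10,17,4,2], Dense [2,6,8,13,17], Sub 6 [16,13,12,17,15,6,21,14], Sub 129 [12,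
   13,16,17,14,10,15], Sub 129 [9,8,10,17,18,16,4], Sub 1 [10,17,19], Sub 127 [13,15,21,17,16,10,6,
   12,8], Dense [2,6,8,13,17], Dense [2,6,8,13,17], Dense [2,6,8,13,17]]),
   ([[2],[3,4],[5,6],[7,10],[26,27],[13,18],[8,9],[],[17],[11,12],[13,14],[15,16],[19],[24,25],[],
   [],[],[20,22],[21,23],[24],[],[],[],[],[],[],[]], 24, [Sub 90 [10,18,6,13,11,19,21,3,14,24,25,
   23,2,5,1,4,26,27,20], Dense [7,10,13,18,24], Dense [3,4,9,13,14], Sub 83 [6,4,10,11,13,14,24,12,
   19,25,15,16,20], Sub 83 [6,4,10,11,13,14,24,12,19,25,16,15,20], Sub 91 [25,12,10,11,14,13,6,4,
   24,17,20,19,7,2,9,8,1,3], Sub 83 [4,6,13,11,10,14,24,19,12,25,21,23,20], Sub 7 [20,18,22,24,6,3,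
   13], Sub 83 [4,6,13,11,10,14,24,19,12,25,23,21,20], Sub 1 [14,24,25], Sub 90 [10,18,6,13,11,19,
   21,3,14,24,25,23,5,2,26,27,1,4,20], Sub 90 [10,18,6,13,11,19,21,3,14,24,25,23,5,2,27,26,1,4,20],
   Dense [3,4,11,18,24]]),
   ([[2,10],[3,4],[5,6],[7,11],[],[14,19],[8,9],[],[17,18],[],[12,13],[14,15],[16],[20],[23,24],[],
   [22],[],[21,22],[],[],[],[25],[],[]], 22, [Sub 28 [2,3,6,14,1,19,22,12,17,21,5,4,11,15,7,9,23,
   13], Sub 126 [3,6,19,22,5,17,14,2,9,21], Sub 127 [7,9,17,22,8,19,18,4,6], Dense [4,6,9,12,22],
   Dense [2,6,11,15,22], Sub 91 [21,20,14,6,19,3,2,12,22,16,17,5,11,15,13,4,23,24], Sub 7 [17,9,18,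
   22,7,4,8], Sub 126 [14,6,19,22,20,17,3,12,9,21], Sub 1 [19,21,22], Dense [2,6,11,15,22],
   Dense [2,6,11,15,22], Sub 91 [21,20,14,6,19,3,2,12,22,25,17,5,15,11,23,24,4,13], Dense [4,6,9,
   12,22]]),
   ([[3],[4],[5,8],[11,19],[6,7],[16,18],[15,17],[9,10],[11,12],[13,14],[20],[25,26],[],[],[],[],
   [],[],[21,23],[22,24],[],[],[31,32],[],[27,30],[28,29],[],[],[],[],[],[]], 21, [Sub 91 [2,12,9,
   11,4,20,22,8,19,21,23,24,3,10,1,5,13,14], Sub 6 [2,4,19,21,11,9,20,23], Sub 91 [2,12,9,11,4,20,
   22,8,19,21,23,24,10,3,13,14,1,5], Sub 91 [2,12,9,11,4,20,22,8,19,21,23,24,10,3,14,13,1,5],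
   Sub 137 [10,8,9,3,12,11,13,5,6,7,14,23,19,31,4,21,15,16,17,20,2,22,24], Sub 137 [10,8,9,3,12,11,
   13,5,7,6,14,23,19,31,4,21,16,15,18,20,2,22,24], Sub 137 [10,8,9,3,12,11,13,5,6,7,14,23,19,31,4,
   21,17,16,15,20,2,22,24], Sub 137 [10,8,9,3,12,11,13,5,7,6,14,23,19,31,4,21,18,15,16,20,2,22,24],
   Sub 131 [2,4,19,11,21,23,9,8,12,20,22,24], Sub 131 [2,4,19,11,21,23,9,8,12,20,24,22], Sub 91 [2,
   8,9,11,4,20,22,12,19,21,23,24,25,26,27,30,28,29], Sub 91 [2,8,9,11,4,20,22,12,19,21,23,24,26,25,
   28,29,27,30], Sub 91 [2,8,9,11,4,20,22,12,19,21,23,24,26,25,29,28,27,30], Sub 91 [2,8,9,11,4,20,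
   22,12,19,21,23,24,25,26,30,27,28,29], Sub 6 [21,19,23,31,4,2,11,32], Sub 6 [21,19,23,32,4,2,11,
   31], Dense [5,8,11,12,19]]),
   ([[3],[4],[5,8],[11,19],[6,7],[16,18],[15,17],[9,10],[11,12],[13,14],[20],[25,26],[],[],[],[],
   [],[],[21,23],[22,24],[],[],[31],[],[27,30],[28,29],[],[],[],[],[]], 23, [Sub 90 [2,12,9,11,4,
   20,22,8,19,23,21,24,3,10,1,5,13,14,31], Sub 6 [2,4,19,23,11,9,20,21], Sub 90 [2,12,9,11,4,20,22,
   8,19,23,21,24,10,3,13,14,1,5,31], Sub 90 [2,12,9,11,4,20,22,8,19,23,21,24,10,3,14,13,1,5,31],
   Sub 93 [11,4,3,8,9,10,19,20,13,5,12,14,22,21,24,23,7,6,15,17,16,18,31], Sub 93 [11,4,3,8,9,10,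
   19,20,13,5,12,14,22,21,24,23,6,7,16,18,15,17,31], Sub 93 [11,4,3,8,9,10,19,20,13,5,12,14,22,21,
   24,23,7,6,17,15,16,18,31], Sub 93 [11,4,3,8,9,10,19,20,13,5,12,14,22,21,24,23,6,7,18,16,15,17,
   31], Sub 1 [19,21,23], Sub 131 [2,4,19,11,23,21,9,8,12,20,22,24], Sub 131 [2,4,19,11,23,21,9,8,
   12,20,24,22], Sub 90 [2,8,9,11,4,20,22,12,19,23,21,24,25,26,27,30,28,29,31], Sub 90 [2,8,9,11,4,
   20,22,12,19,23,21,24,26,25,28,29,27,30,31], Sub 90 [2,8,9,11,4,20,22,12,19,23,21,24,26,25,29,28,
   27,30,31], Sub 90 [2,8,9,11,4,20,22,12,19,23,21,24,25,26,30,27,28,29,31], Sub 140 [1,2,3,4,5,6,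
   7,8,9,10,11,12,13,14,15,16,17,18,19,20,21,22,23,24,25,26,27,28,29,30,31,32]]),
   ([[2,10],[3,4],[5,6],[7,11],[],[14,22],[8,9],[19,21],[18,20],[],[12,13],[14,15],[16,17],[23],
   [28,29],[],[],[],[],[],[],[24,26],[25,27],[],[],[],[],[30,33],[31,32],[],[],[],[]], 26,
   [Sub 131 [5,3,2,6,1,4,14,12,23,22,26,24], Sub 129 [5,3,6,22,26,24,2], Sub 141 [2,3,4,6,7,8,9,11,
   12,13,14,15,16,17,18,19,20,21,22,23,24,25,26,27,28,29,30,31,32,33,10], Sub 91 [3,15,12,14,6,23,
   25,11,22,26,24,27,13,4,16,17,2,7], Sub 91 [3,15,12,14,6,23,25,11,22,26,24,27,13,4,17,16,2,7],
   Sub 139 [1,2,3,4,5,6,7,8,9,10,11,12,13,14,15,16,18,20,22,23,24,26,28,29,30], Sub 139 [1,2,3,4,5,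
   6,7,9,8,10,11,12,13,14,15,16,19,21,22,23,24,26,28,29,30], Sub 139 [1,2,3,4,5,6,7,8,9,10,11,12,
   13,14,15,16,20,18,22,23,24,26,28,29,30], Sub 139 [1,2,3,4,5,6,7,9,8,10,11,12,13,14,15,16,21,19,
   22,23,24,26,28,29,30], Sub 1 [22,24,26], Sub 131 [3,6,22,14,26,24,12,11,15,23,25,27],
   Sub 131 [3,6,22,14,26,24,12,11,15,23,27,25], Sub 91 [3,11,12,14,6,23,25,15,22,26,24,27,28,29,30,
   33,31,32], Sub 91 [3,11,12,14,6,23,25,15,22,26,24,27,29,28,31,32,30,33], Sub 91 [3,11,12,14,6,
   23,25,15,22,26,24,27,29,28,32,31,30,33], Sub 91 [3,11,12,14,6,23,25,15,22,26,24,27,28,29,33,30,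
   31,32], Sub 141 [2,3,4,6,7,8,9,11,12,13,14,15,16,17,18,19,20,21,22,23,24,25,26,27,28,29,30,31,
   32,33,34]])]"

definition steps9 :: "(nat list list \<times> nat \<times> leaf list) list" where
  "steps9 = [
   ([[2,7],[3,4],[5,6],[8,11],[30,31],[14,22],[],[9,10],[19,21],[18,20],[12,13],[14,15],[16,17],
   [23],[28,29],[],[],[],[],[],[],[24,26],[25,27],[],[],[],[],[32],[33,34],[],[],[],[],[]], 28,
   [Sub 86 [3,5,12,14,6,23,30,2,25,15,22,32,27,1,4,28,29,33,34], Sub 91 [29,13,11,12,15,14,6,4,28,
   7,32,23,2,8,1,3,9,10], Sub 83 [6,4,11,12,14,15,28,13,23,29,16,17,32], Sub 83 [6,4,11,12,14,15,
   28,13,23,29,17,16,32], Sub 86 [8,9,12,11,4,13,19,10,16,15,2,32,17,18,20,28,29,33,34], Sub 86 [8,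
   10,12,11,4,13,18,9,16,15,2,32,17,19,21,28,29,33,34], Sub 86 [8,9,12,11,4,13,19,10,16,15,2,32,17,
   20,18,28,29,33,34], Sub 86 [8,10,12,11,4,13,18,9,16,15,2,32,17,21,19,28,29,33,34], Sub 138 [1,2,
   3,4,5,6,8,10,9,11,12,13,14,15,16,17,19,22,23,24,25,26,27,28,29,30,31], Sub 83 [4,6,14,12,11,15,
   28,23,13,29,25,27,32], Sub 138 [1,2,3,4,5,6,8,10,9,11,12,13,14,15,16,17,19,22,23,26,25,24,27,28,
   29,30,31], Sub 83 [4,6,14,12,11,15,28,23,13,29,27,25,32], Sub 86 [3,2,12,14,6,23,1,5,25,15,22,
   32,27,30,31,28,29,33,34], Sub 86 [3,2,12,14,6,23,1,5,25,15,22,32,27,31,30,28,29,33,34],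
   Sub 5 [28,15,29,33,12,11,14,34,32], Sub 5 [28,15,29,34,12,11,14,33,32], Sub 142 [1,2,3,4,5,6,8,
   9,10,7,11,12,13,14,15,16,17,18,19,20,21,22,23,24,25,26,27,28,29,32,33,34,35]]),
   ([[2,7],[3,4],[5,6],[8,11],[30,31],[14,22],[],[9,10],[19,21],[18,20],[12,13],[14,15],[16,17],
   [23],[28,29],[],[],[],[],[],[],[24,26],[25,27],[],[],[],[],[32],[33],[],[],[],[]], 29,
   [Sub 86 [15,28,6,14,12,23,32,29,25,3,11,4,27,1,33,2,5,30,31], Sub 91 [28,13,11,12,15,14,6,4,29,
   7,33,23,2,8,1,3,9,10], Sub 83 [6,4,11,12,14,15,29,13,23,28,16,17,33], Sub 83 [6,4,11,12,14,15,
   29,13,23,28,17,16,33], Sub 86 [15,28,4,11,12,13,32,29,16,8,14,20,17,18,33,10,9,19,21],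
   Sub 86 [15,28,4,11,12,13,32,29,16,8,14,21,17,19,33,9,10,18,20], Sub 86 [15,28,4,11,12,13,32,29,
   16,8,14,18,17,20,33,10,9,19,21], Sub 86 [15,28,4,11,12,13,32,29,16,8,14,19,17,21,33,9,10,18,20],
   Sub 138 [1,2,3,4,5,6,8,10,9,11,12,13,14,15,16,17,19,22,23,24,25,26,27,29,28,30,31], Sub 83 [4,6,
   14,12,11,15,29,23,13,28,25,27,33], Sub 138 [1,2,3,4,5,6,8,10,9,11,12,13,14,15,16,17,19,22,23,26,
   25,24,27,29,28,30,31], Sub 83 [4,6,14,12,11,15,29,23,13,28,27,25,33], Sub 1 [15,28,29],
   Sub 86 [15,28,6,14,12,23,32,29,25,3,11,31,27,30,33,5,2,1,4], Sub 86 [15,28,6,14,12,23,32,29,25,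
   3,11,30,27,31,33,5,2,1,4], Sub 6 [28,15,29,32,12,11,14,33], Sub 143 [1,2,3,4,5,6,7,8,9,10,11,12,
   13,14,15,16,17,18,19,20,21,22,23,24,25,26,27,28,29,30,31,32,33,34]]),
   ([[2,7,11],[3,4],[5,6],[8,12],[31,32],[15,23],[],[9,10],[20,22],[19,21],[],[13,14],[15,16],[17,
   18],[24],[29,30],[],[],[],[],[],[],[25,27],[26,28],[],[],[],[],[33],[],[],[],[]], 30,
   [Sub 91 [15,8,4,12,13,14,17,2,16,30,29,18,1,3,7,11,5,6], Sub 91 [15,8,4,12,13,14,17,2,16,30,29,
   18,1,3,11,7,5,6], Sub 131 [4,12,14,13,17,18,15,6,24,16,30,29], Sub 131 [4,12,14,13,18,17,15,6,
   24,16,30,29], Sub 91 [15,2,4,12,13,14,17,8,16,30,29,18,10,9,19,21,20,22], Sub 91 [15,2,4,12,13,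
   14,17,8,16,30,29,18,9,10,20,22,19,21], Sub 91 [15,2,4,12,13,14,17,8,16,30,29,18,10,9,21,19,20,
   22], Sub 91 [15,2,4,12,13,14,17,8,16,30,29,18,9,10,22,20,19,21], Sub 138 [1,2,3,4,5,6,8,10,9,12,
   13,14,15,16,17,18,20,23,24,25,26,27,28,30,29,31,32], Sub 131 [12,13,16,15,30,29,6,3,23,24,26,
   28], Sub 138 [1,2,3,4,5,6,8,10,9,12,13,14,15,16,17,18,20,23,24,27,26,25,28,30,29,31,32],
   Sub 131 [12,13,16,15,30,29,6,3,23,24,28,26], Sub 1 [16,29,30], Sub 91 [12,23,6,15,13,24,26,3,16,
   30,29,28,5,2,31,32,1,4], Sub 91 [12,23,6,15,13,24,26,3,16,30,29,28,5,2,32,31,1,4], Sub 7 [29,16,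
   30,33,13,12,15], Sub 144 [1,2,3,4,5,6,7,8,9,10,12,13,14,15,16,17,18,19,20,21,22,23,24,25,26,27,
   28,29,30,31,32,33,34]]),
   ([[2,7,11],[3,4],[5,6],[8,12],[31,32],[15,23],[],[9,10],[20,22],[19,21],[],[13,14],[15,16],[17,
   18],[24],[29,30],[],[],[],[],[],[],[25,27],[26,28],[],[],[],[],[],[],[],[]], 29, [Sub 91 [15,8,
   4,12,13,14,17,2,16,29,30,18,1,3,7,11,5,6], Sub 91 [15,8,4,12,13,14,17,2,16,29,30,18,1,3,11,7,5,
   6], Sub 131 [4,12,14,13,17,18,15,6,24,16,29,30], Sub 131 [4,12,14,13,18,17,15,6,24,16,29,30],
   Sub 91 [15,2,4,12,13,14,17,8,16,29,30,18,10,9,19,21,20,22], Sub 91 [15,2,4,12,13,14,17,8,16,29,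
   30,18,9,10,20,22,19,21], Sub 91 [15,2,4,12,13,14,17,8,16,29,30,18,10,9,21,19,20,22], Sub 91 [15,
   2,4,12,13,14,17,8,16,29,30,18,9,10,22,20,19,21], Sub 138 [1,2,3,4,5,6,8,10,9,12,13,14,15,16,17,
   18,20,23,24,25,26,27,28,29,30,31,32], Sub 131 [12,13,16,15,29,30,6,3,23,24,26,28], Sub 138 [1,2,
   3,4,5,6,8,10,9,12,13,14,15,16,17,18,20,23,24,27,26,25,28,29,30,31,32], Sub 131 [12,13,16,15,29,
   30,6,3,23,24,28,26], Sub 1 [16,29,30], Sub 91 [12,23,6,15,13,24,26,3,16,29,30,28,5,2,31,32,1,4],
   Sub 91 [12,23,6,15,13,24,26,3,16,29,30,28,5,2,32,31,1,4], Sub 145 [1,2,3,4,5,6,7,8,9,10,11,12,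
   13,14,15,16,17,18,19,20,21,22,23,24,25,26,27,28,29,30,31,32,33]]),
   ([[2,7,11],[3,4],[5,6],[8,12],[31],[15,23],[],[9,10],[20,22],[19,21],[],[13,14],[15,16],[17,18],
   [24],[29,30],[],[],[],[],[],[],[25,27],[26,28],[],[],[],[],[],[],[]], 5, [Sub 128 [1,2,3,5,7,31,
   4,11], Sub 128 [1,2,3,5,11,31,4,7], Sub 91 [2,24,15,6,3,23,25,13,5,17,31,27,12,16,14,4,29,30],
   Sub 91 [2,24,15,6,3,23,25,13,5,18,31,27,12,16,14,4,29,30], Sub 93 [15,6,4,12,13,14,3,24,17,8,16,
   18,26,2,28,5,10,9,19,21,20,22,31], Sub 93 [15,6,4,12,13,14,3,24,17,8,16,18,26,2,28,5,9,10,20,22,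
   19,21,31], Sub 93 [15,6,4,12,13,14,3,24,17,8,16,18,26,2,28,5,10,9,21,19,20,22,31], Sub 93 [15,6,
   4,12,13,14,3,24,17,8,16,18,26,2,28,5,9,10,22,20,19,21,31], Sub 128 [3,5,25,23,6,27,31,2],
   Sub 83 [25,2,3,6,23,15,24,5,27,13,26,31,28], Sub 128 [3,5,27,23,6,25,31,2], Sub 83 [25,2,3,6,23,
   15,24,5,27,13,28,31,26], Sub 91 [6,8,4,2,3,1,7,12,5,29,31,11,13,14,16,15,17,18], Sub 91 [6,8,4,
   2,3,1,7,12,5,30,31,11,13,14,16,15,17,18], Sub 146 [1,2,3,4,5,6,7,8,9,10,11,12,13,14,15,16,17,18,
   19,20,21,22,23,24,25,26,27,28,29,30,31,32]]),
   ([[2,7,11],[3,4],[5,6],[8,12],[],[15,23],[],[9,10],[20,22],[19,21],[],[13,14],[15,16],[17,18],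
   [24],[29,30],[],[],[],[],[],[],[25,27],[26,28],[],[],[],[],[],[]], 5, [Sub 129 [7,1,2,3,5,6,11],
   Sub 129 [11,1,2,3,5,6,7], Sub 91 [4,24,15,13,12,16,29,6,14,17,18,30,3,23,5,2,25,27], Sub 91 [4,
   24,15,13,12,16,29,6,14,18,17,30,3,23,5,2,25,27], Sub 137 [14,12,13,4,16,15,17,8,9,10,18,2,3,1,6,
   5,19,20,21,24,23,26,28], Sub 137 [14,12,13,4,16,15,17,8,10,9,18,2,3,1,6,5,20,19,22,24,23,26,28],
   Sub 137 [14,12,13,4,16,15,17,8,9,10,18,2,3,1,6,5,21,20,19,24,23,26,28], Sub 137 [14,12,13,4,16,
   15,17,8,10,9,18,2,3,1,6,5,22,19,20,24,23,26,28], Sub 129 [5,3,6,23,25,27,2], Sub 131 [23,6,3,15,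
   5,2,13,12,16,24,26,28], Sub 129 [5,3,6,23,27,25,2], Sub 131 [23,6,3,15,5,2,13,12,16,24,28,26],
   Sub 91 [15,8,4,12,13,14,17,2,16,29,30,18,3,1,5,6,7,11], Sub 91 [15,8,4,12,13,14,17,2,16,30,29,
   18,3,1,5,6,7,11], Sub 147 [1,2,3,4,5,6,7,8,9,10,11,12,13,14,15,16,17,18,19,20,21,22,23,24,25,26,
   27,28,29,30,31]]),
   ([[2,7,11],[3,4],[5,6],[8,12],[],[15,23],[],[9,10],[20,22],[19,21],[],[13,14],[15,16],[17,18],
   [24],[29],[],[],[],[],[],[],[25,27],[26,28],[],[],[],[],[]], 16, [Sub 83 [26,23,6,15,24,13,16,3,
   28,12,5,2,29], Sub 136 [1,2,3,4,5,6,7,8,9,10,11,12,13,14,15,16,19,20,22,23,24,25,27],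
   Sub 136 [1,2,3,4,5,6,11,8,9,10,7,12,13,14,15,16,19,20,22,23,24,25,27], Sub 128 [12,14,17,16,13,
   29,18,4], Sub 128 [12,14,18,16,13,29,17,4], Sub 93 [6,15,4,2,3,1,13,23,7,8,5,11,25,12,27,16,10,
   9,19,21,20,22,29], Sub 93 [6,15,4,2,3,1,13,23,7,8,5,11,25,12,27,16,9,10,20,22,19,21,29],
   Sub 93 [6,15,4,2,3,1,13,23,7,8,5,11,25,12,27,16,10,9,21,19,20,22,29], Sub 93 [6,15,4,2,3,1,13,
   23,7,8,5,11,25,12,27,16,9,10,22,20,19,21,29], Sub 83 [26,3,6,15,24,13,16,23,28,12,25,27,29],
   Sub 128 [13,16,26,24,15,28,29,12], Sub 83 [26,3,6,15,24,13,16,23,28,12,27,25,29], Sub 128 [13,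
   16,28,24,15,26,29,12], Sub 148 [1,2,3,4,5,6,7,8,9,10,11,12,13,14,15,16,17,18,19,20,21,22,23,24,
   25,26,27,28,29,30]])]"

definition steps10 :: "(nat list list \<times> nat \<times> leaf list) list" where
  "steps10 = [
   ([[2,7,11],[3,4],[5,6],[8,12],[],[15,23],[],[9,10],[20,22],[19,21],[],[13,14],[15,16],[17,18],
   [24],[],[],[],[],[],[],[],[25,27],[26,28],[],[],[],[]], 16, [Sub 131 [23,6,3,15,5,2,24,26,28,13,
   16,12], Sub 136 [1,2,3,4,5,6,7,8,9,10,11,12,13,14,15,16,19,20,22,23,24,25,27], Sub 136 [1,2,3,4,
   5,6,11,8,9,10,7,12,13,14,15,16,19,20,22,23,24,25,27], Sub 129 [16,13,12,14,17,18,15],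
   Sub 129 [16,13,12,14,18,17,15], Sub 137 [1,2,3,4,5,6,7,8,9,10,11,12,13,14,15,16,19,20,21,23,24,
   25,27], Sub 137 [1,2,3,4,5,6,7,8,10,9,11,12,13,14,15,16,20,19,22,23,24,25,27], Sub 137 [1,2,3,4,
   5,6,7,8,9,10,11,12,13,14,15,16,21,20,19,23,24,25,27], Sub 137 [1,2,3,4,5,6,7,8,10,9,11,12,13,14,
   15,16,22,19,20,23,24,25,27], Sub 131 [3,6,23,15,25,27,24,26,28,13,16,12], Sub 129 [16,13,15,24,
   26,28,12], Sub 131 [3,6,23,15,27,25,24,26,28,13,16,12], Sub 129 [16,13,15,24,28,26,12],
   Sub 149 [1,2,3,4,5,6,7,8,9,10,11,12,13,14,15,16,17,18,19,20,21,22,23,24,25,26,27,28,29]]),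
   ([[2,7,11],[3,4],[5,6],[8,12],[],[15,23],[],[9,10],[20,22],[19,21],[],[13,14],[15,16],[17,18],
   [24],[],[],[],[],[],[],[],[25,27],[26],[],[],[]], 24, [Sub 126 [24,15,6,3,5,2,13,26,1,23],
   Sub 135 [14,12,13,4,16,15,17,8,9,10,18,2,3,1,6,5,7,11,20,19,22,24,23], Sub 135 [14,12,13,4,16,
   15,17,8,9,10,18,2,3,1,6,5,11,7,20,19,22,24,23], Sub 5 [13,15,24,16,6,3,23,26,12], Sub 131 [16,
   13,12,15,14,4,6,3,23,24,17,26], Sub 131 [16,13,12,15,14,4,6,3,23,24,18,26], Sub 86 [8,9,13,12,4,
   14,20,10,17,15,2,26,18,19,21,24,6,3,23], Sub 86 [8,10,13,12,4,14,19,9,17,15,2,26,18,20,22,24,6,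
   3,23], Sub 86 [8,9,13,12,4,14,20,10,17,15,2,26,18,21,19,24,6,3,23], Sub 86 [8,10,13,12,4,14,19,
   9,17,15,2,26,18,22,20,24,6,3,23], Sub 128 [6,23,25,24,15,26,27,3], Sub 128 [6,23,27,24,15,26,25,
   3], Sub 150 [1,2,3,4,5,6,7,8,9,10,11,12,13,14,15,16,17,18,19,20,21,22,23,24,25,26,27,28]]),
   ([[2,7,11],[3,4],[5,6],[8,12],[],[15,23],[],[9,10],[20,22],[19,21],[],[13,14],[15,16],[17,18],
   [24],[],[],[],[],[],[],[],[25],[26],[],[]], 23, [Sub 5 [3,6,23,5,15,13,24,25,2], Sub 131 [5,3,2,
   6,1,4,15,13,24,23,7,25], Sub 131 [5,3,2,6,1,4,15,13,24,23,11,25], Sub 126 [23,6,15,13,16,12,3,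
   25,4,24], Sub 135 [1,2,3,4,5,6,7,8,9,10,11,12,13,14,15,16,17,18,20,19,22,23,24], Sub 135 [1,2,3,
   4,5,6,7,8,9,10,11,12,13,14,15,16,18,17,20,19,22,23,24], Sub 86 [6,15,4,2,3,1,13,23,7,8,5,21,11,
   19,25,10,9,20,22], Sub 86 [6,15,4,2,3,1,13,23,7,8,5,22,11,20,25,9,10,19,21], Sub 86 [6,15,4,2,3,
   1,13,23,7,8,5,19,11,21,25,10,9,20,22], Sub 86 [6,15,4,2,3,1,13,23,7,8,5,20,11,22,25,9,10,19,21],
   Sub 5 [6,15,24,23,13,12,16,26,3], Sub 129 [24,15,6,23,26,25,13], Sub 151 [1,2,3,4,5,6,7,8,9,10,
   11,12,13,14,15,16,17,18,19,20,21,22,23,24,25,26,27]]),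
   ([[2,7,11],[3,4],[5,6],[8,12],[],[15,23],[],[9,10],[20,22],[19,21],[],[13,14],[15,16],[17,18],
   [24],[],[],[],[],[],[],[],[25],[],[]], 24, [Sub 129 [5,3,6,15,24,13,2], Sub 135 [14,12,13,4,16,
   15,17,8,9,10,18,2,3,1,6,5,7,11,20,19,22,24,23], Sub 135 [14,12,13,4,16,15,17,8,9,10,18,2,3,1,6,
   5,11,7,20,19,22,24,23], Sub 6 [16,13,15,24,12,4,14,6], Sub 131 [16,13,15,12,24,6,4,2,8,14,17,
   18], Sub 131 [16,13,15,12,24,6,4,2,8,14,18,17], Sub 91 [16,2,4,12,13,14,17,8,15,24,6,18,10,9,19,
   21,20,22], Sub 91 [16,2,4,12,13,14,17,8,15,24,6,18,9,10,20,22,19,21], Sub 91 [16,2,4,12,13,14,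
   17,8,15,24,6,18,10,9,21,19,20,22], Sub 91 [16,2,4,12,13,14,17,8,15,24,6,18,9,10,22,20,19,21],
   Sub 5 [15,6,23,24,3,2,5,25,13], Sub 130 [25,24,15,6,23,3], Sub 152 [1,2,3,4,5,6,7,8,9,10,11,12,
   13,14,15,16,17,18,19,20,21,22,23,24,25,26]]),
   ([[2,7,11],[3,4],[5,6],[8,12],[],[15,23],[],[9,10],[20,22],[19,21],[],[13,14],[15,16],[17,18],
   [24],[],[],[],[],[],[],[],[],[]], 23, [Sub 6 [5,3,6,23,2,1,4,15], Sub 131 [5,3,6,2,23,15,4,8,12,
   1,7,11], Sub 131 [5,3,6,2,23,15,4,8,12,1,11,7], Sub 129 [23,6,15,13,16,12,3], Sub 135 [1,2,3,4,
   5,6,7,8,9,10,11,12,13,14,15,16,17,18,20,19,22,23,24], Sub 135 [1,2,3,4,5,6,7,8,9,10,11,12,13,14,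
   15,16,18,17,20,19,22,23,24], Sub 91 [5,12,4,2,3,1,7,8,6,23,15,11,10,9,19,21,20,22], Sub 91 [5,
   12,4,2,3,1,7,8,6,23,15,11,9,10,20,22,19,21], Sub 91 [5,12,4,2,3,1,7,8,6,23,15,11,10,9,21,19,20,
   22], Sub 91 [5,12,4,2,3,1,7,8,6,23,15,11,9,10,22,20,19,21], Sub 6 [23,6,15,24,3,2,5,13],
   Sub 153 [1,2,3,4,5,6,7,8,9,10,11,12,13,14,15,16,17,18,19,20,21,22,23,24,25]]),
   ([[2,7,11],[3,4],[5,6],[8,12],[],[15,23],[],[9,10],[20,22],[19,21],[],[13,14],[15,16],[17,18],
   [],[],[],[],[],[],[],[],[]], 15, [Sub 6 [5,3,6,15,2,1,4,23], Sub 131 [5,3,6,2,15,23,4,8,12,1,7,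
   11], Sub 131 [5,3,6,2,15,23,4,8,12,1,11,7], Sub 1 [13,15,16], Sub 126 [14,12,13,15,17,6,4,18,3,
   16], Sub 126 [14,12,13,15,18,6,4,17,3,16], Sub 90 [5,12,4,2,3,1,7,8,6,15,23,11,10,9,19,21,20,22,
   13], Sub 90 [5,12,4,2,3,1,7,8,6,15,23,11,9,10,20,22,19,21,13], Sub 90 [5,12,4,2,3,1,7,8,6,15,23,
   11,10,9,21,19,20,22,13], Sub 90 [5,12,4,2,3,1,7,8,6,15,23,11,9,10,22,20,19,21,13], Sub 1 [6,15,
   23], Sub 154 [1,2,3,4,5,6,7,8,9,10,11,12,13,14,15,16,17,18,19,20,21,22,23,24]]),
   ([[2,7,11],[3,4],[5,6],[8,12],[],[15],[],[9,10],[20,22],[19,21],[],[13,14],[15,16],[17,18],[],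
   [],[],[],[],[],[],[]], 6, [Sub 1 [3,5,6], Sub 126 [1,2,3,6,7,15,4,11,13,5], Sub 126 [1,2,3,6,11,
   15,4,7,13,5], Sub 7 [15,6,16,13,3,2,5], Sub 132 [2,4,6,8,12,13,14,15,16,17,18], Sub 132 [2,4,6,
   8,12,13,14,15,16,18,17], Sub 134 [2,3,4,5,6,8,9,10,12,13,14,15,16,17,18,19,20,21,22],
   Sub 134 [2,3,4,5,6,8,10,9,12,13,14,15,16,17,18,20,19,22,21], Sub 134 [2,3,4,5,6,8,9,10,12,13,14,
   15,16,17,18,21,20,19,22], Sub 134 [2,3,4,5,6,8,10,9,12,13,14,15,16,17,18,22,19,20,21],
   Sub 155 [1,2,3,4,5,6,7,8,9,10,11,12,13,14,15,16,17,18,19,20,21,22,23]]),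
   ([[2,7,11],[3,4],[5,6],[8,12],[],[],[23,26],[9,10],[20,22],[19,21],[24,25],[13,14],[15,16],[17,
   18],[],[],[],[],[],[],[],[],[30],[27,29],[32],[28,31],[],[],[],[],[],[]], 23, [Sub 83 [24,4,2,1,
   11,7,23,3,25,26,5,6,30], Sub 83 [24,4,2,1,11,7,23,3,25,26,6,5,30], Sub 86 [7,26,4,2,1,3,28,23,5,
   12,11,16,6,15,30,13,14,17,18], Sub 86 [7,26,4,2,1,3,28,23,5,12,11,15,6,16,30,13,14,17,18],
   Sub 86 [7,26,4,2,1,3,28,23,5,12,11,18,6,17,30,14,13,15,16], Sub 86 [7,26,4,2,1,3,28,23,5,12,11,
   17,6,18,30,14,13,15,16], Sub 86 [7,26,4,2,1,3,28,23,5,8,11,21,6,19,30,10,9,20,22], Sub 86 [7,26,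
   4,2,1,3,28,23,5,8,11,22,6,20,30,9,10,19,21], Sub 86 [7,26,4,2,1,3,28,23,5,8,11,19,6,21,30,10,9,
   20,22], Sub 86 [7,26,4,2,1,3,28,23,5,8,11,20,6,22,30,9,10,19,21], Sub 121 [7,23,25,11,1,24,30,
   26,27,32,2,3,4,29,28], Sub 83 [3,26,7,1,2,11,24,23,4,25,27,30,29], Sub 5 [23,7,26,28,1,2,11,31,
   30], Sub 83 [3,26,7,1,2,11,24,23,4,25,29,30,27], Sub 5 [23,7,26,31,1,2,11,28,30], Sub 131 [2,1,
   11,7,25,24,26,28,31,23,32,30], Dense [2,7,8,11,12]]),
   ([[2,7,11],[3,4],[5,6],[8,12],[],[],[23,26],[9,10],[20,22],[19,21],[24,25],[13,14],[15,16],[17,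
   18],[],[],[],[],[],[],[],[],[30],[27,29],[],[28,31],[],[],[],[],[]], 25, [Sub 131 [7,1,11,2,25,
   24,4,8,12,3,5,6], Sub 131 [7,1,11,2,25,24,4,8,12,3,6,5], Sub 91 [14,3,2,4,12,8,9,1,13,15,16,10,
   11,7,25,24,23,26], Sub 91 [14,3,2,4,12,8,9,1,13,16,15,10,11,7,25,24,23,26], Sub 91 [13,3,2,4,12,
   8,9,1,14,17,18,10,11,7,25,24,23,26], Sub 91 [13,3,2,4,12,8,9,1,14,18,17,10,11,7,25,24,23,26],
   Sub 91 [9,3,2,4,8,12,13,1,10,19,21,14,11,7,25,24,23,26], Sub 91 [10,3,2,4,8,12,13,1,9,20,22,14,
   11,7,25,24,23,26], Sub 91 [9,3,2,4,8,12,13,1,10,21,19,14,11,7,25,24,23,26], Sub 91 [10,3,2,4,8,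
   12,13,1,9,22,20,14,11,7,25,24,23,26], Sub 126 [23,7,1,11,25,24,26,30,27,2], Sub 6 [25,11,24,27,
   1,2,7,29], Sub 131 [23,7,26,1,28,31,2,3,4,11,25,24], Sub 6 [25,11,24,29,1,2,7,27], Sub 132 [3,2,
   30,4,1,7,11,23,26,25,24], Sub 131 [23,7,26,1,31,28,2,3,4,11,25,24], Sub 157 [1,2,3,4,5,6,7,8,9,
   10,11,12,13,14,15,16,17,18,19,20,21,22,23,24,25,26,27,28,29,30,31,32]])]"

definition steps11 :: "(nat list list \<times> nat \<times> leaf list) list" where
  "steps11 = [
   ([[2,7,11],[3,4],[5,6],[8,12],[],[],[23,26],[9,10],[20,22],[19,21],[24,25],[13,14],[15,16],[17,
   18],[],[],[],[],[],[],[],[],[30],[27,29],[],[28],[],[],[],[]], 26, [Sub 83 [24,4,2,1,11,7,26,3,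
   25,23,5,6,28], Sub 83 [24,4,2,1,11,7,26,3,25,23,6,5,28], Sub 86 [7,23,4,2,1,3,30,26,5,12,11,16,
   6,15,28,13,14,17,18], Sub 86 [7,23,4,2,1,3,30,26,5,12,11,15,6,16,28,13,14,17,18], Sub 86 [7,23,
   4,2,1,3,30,26,5,12,11,18,6,17,28,14,13,15,16], Sub 86 [7,23,4,2,1,3,30,26,5,12,11,17,6,18,28,14,
   13,15,16], Sub 86 [7,23,4,2,1,3,30,26,5,8,11,21,6,19,28,10,9,20,22], Sub 86 [7,23,4,2,1,3,30,26,
   5,8,11,22,6,20,28,9,10,19,21], Sub 86 [7,23,4,2,1,3,30,26,5,8,11,19,6,21,28,10,9,20,22],
   Sub 86 [7,23,4,2,1,3,30,26,5,8,11,20,6,22,28,9,10,19,21], Sub 1 [7,23,26], Sub 126 [26,7,1,11,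
   25,24,23,28,27,2], Sub 83 [3,23,7,1,2,11,24,26,4,25,27,28,29], Sub 83 [3,23,7,1,2,11,24,26,4,25,
   29,28,27], Sub 6 [23,7,26,30,1,2,11,28], Sub 158 [1,2,3,4,5,6,7,8,9,10,11,12,13,14,15,16,17,18,
   19,20,21,22,23,24,25,26,27,28,29,30,31]]),
   ([[2,7,11],[3,4],[5,6],[8,12],[],[],[23,26],[9,10],[20,22],[19,21],[24,25],[13,14],[15,16],[17,
   18],[],[],[],[],[],[],[],[],[],[27,29],[],[28],[],[],[]], 23, [Sub 131 [11,1,7,2,23,26,4,8,12,3,
   5,6], Sub 131 [11,1,7,2,23,26,4,8,12,3,6,5], Sub 91 [14,3,2,4,12,8,9,1,13,15,16,10,7,11,23,26,
   24,25], Sub 91 [14,3,2,4,12,8,9,1,13,16,15,10,7,11,23,26,24,25], Sub 91 [13,3,2,4,12,8,9,1,14,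
   17,18,10,7,11,23,26,24,25], Sub 91 [13,3,2,4,12,8,9,1,14,18,17,10,7,11,23,26,24,25], Sub 91 [9,
   3,2,4,8,12,13,1,10,19,21,14,7,11,23,26,24,25], Sub 91 [10,3,2,4,8,12,13,1,9,20,22,14,7,11,23,26,
   24,25], Sub 91 [9,3,2,4,8,12,13,1,10,21,19,14,7,11,23,26,24,25], Sub 91 [10,3,2,4,8,12,13,1,9,
   22,20,14,7,11,23,26,24,25], Sub 129 [23,7,1,11,25,24,26], Sub 1 [7,23,26], Sub 131 [25,11,24,1,
   27,29,2,3,4,7,23,26], Sub 7 [23,7,26,28,1,2,11], Sub 131 [25,11,24,1,29,27,2,3,4,7,23,26],
   Sub 159 [1,2,3,4,5,6,7,8,9,10,11,12,13,14,15,16,17,18,19,20,21,22,23,24,25,26,27,28,29,30]]),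
   ([[2,7,11],[3,4],[5,6],[8,12],[],[],[23,26],[9,10],[20,22],[19,21],[24,25],[13,14],[15,16],[17,
   18],[],[],[],[],[],[],[],[],[],[27],[],[28],[],[]], 24, [Sub 83 [23,4,2,1,7,11,24,3,26,25,5,6,
   27], Sub 83 [23,4,2,1,7,11,24,3,26,25,6,5,27], Sub 90 [7,8,4,2,1,3,5,12,11,24,25,6,13,14,15,16,
   17,18,27], Sub 90 [7,8,4,2,1,3,5,12,11,24,25,6,13,14,16,15,17,18,27], Sub 90 [7,8,4,2,1,3,5,12,
   11,24,25,6,14,13,17,18,15,16,27], Sub 90 [7,8,4,2,1,3,5,12,11,24,25,6,14,13,18,17,15,16,27],
   Sub 90 [7,12,4,2,1,3,5,8,11,24,25,6,10,9,19,21,20,22,27], Sub 90 [7,12,4,2,1,3,5,8,11,24,25,6,9,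
   10,20,22,19,21,27], Sub 90 [7,12,4,2,1,3,5,8,11,24,25,6,10,9,21,19,20,22,27], Sub 90 [7,12,4,2,
   1,3,5,8,11,24,25,6,9,10,22,20,19,21,27], Sub 126 [24,11,1,7,23,26,25,27,28,2], Sub 1 [11,24,25],
   Sub 125 [24,26,7,1,11,2,28,27,3,23,25], Sub 131 [25,11,24,1,28,27,2,3,4,7,26,23], Sub 160 [1,2,
   3,4,5,6,7,8,9,10,11,12,13,14,15,16,17,18,19,20,21,22,23,24,25,26,27,28,29]]),
   ([[2,7,11],[3,4],[5,6],[8,12],[],[],[23,26],[9,10],[20,22],[19,21],[24,25],[13,14],[15,16],[17,
   18],[],[],[],[],[],[],[],[],[],[27],[],[],[]], 26, [Sub 131 [11,1,7,2,26,23,4,8,12,3,5,6],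
   Sub 131 [11,1,7,2,26,23,4,8,12,3,6,5], Sub 91 [14,3,2,4,12,8,9,1,13,15,16,10,7,11,26,23,24,25],
   Sub 91 [14,3,2,4,12,8,9,1,13,16,15,10,7,11,26,23,24,25], Sub 91 [13,3,2,4,12,8,9,1,14,17,18,10,
   7,11,26,23,24,25], Sub 91 [13,3,2,4,12,8,9,1,14,18,17,10,7,11,26,23,24,25], Sub 91 [9,3,2,4,8,
   12,13,1,10,19,21,14,7,11,26,23,24,25], Sub 91 [10,3,2,4,8,12,13,1,9,20,22,14,7,11,26,23,24,25],
   Sub 91 [9,3,2,4,8,12,13,1,10,21,19,14,7,11,26,23,24,25], Sub 91 [10,3,2,4,8,12,13,1,9,22,20,14,
   7,11,26,23,24,25], Sub 1 [7,23,26], Sub 128 [1,7,26,24,11,27,23,2], Sub 129 [26,7,1,11,25,24,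
   23], Sub 132 [3,2,27,4,1,7,11,26,23,24,25], Sub 161 [1,2,3,4,5,6,7,8,9,10,11,12,13,14,15,16,17,
   18,19,20,21,22,23,24,25,26,27,28]]),
   ([[2,7,11],[3,4],[5,6],[8,12],[],[],[23,26],[9,10],[20,22],[19,21],[24,25],[13,14],[15,16],[17,
   18],[],[],[],[],[],[],[],[],[],[],[],[]], 24, [Sub 131 [7,1,11,2,24,25,4,8,12,3,5,6],
   Sub 131 [7,1,11,2,24,25,4,8,12,3,6,5], Sub 91 [14,3,2,4,12,8,9,1,13,15,16,10,11,7,24,25,23,26],
   Sub 91 [14,3,2,4,12,8,9,1,13,16,15,10,11,7,24,25,23,26], Sub 91 [13,3,2,4,12,8,9,1,14,17,18,10,
   11,7,24,25,23,26], Sub 91 [13,3,2,4,12,8,9,1,14,18,17,10,11,7,24,25,23,26], Sub 91 [9,3,2,4,8,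
   12,13,1,10,19,21,14,11,7,24,25,23,26], Sub 91 [10,3,2,4,8,12,13,1,9,20,22,14,11,7,24,25,23,26],
   Sub 91 [9,3,2,4,8,12,13,1,10,21,19,14,11,7,24,25,23,26], Sub 91 [10,3,2,4,8,12,13,1,9,22,20,14,
   11,7,24,25,23,26], Sub 129 [23,7,1,11,24,25,26], Sub 1 [11,24,25], Sub 129 [26,7,1,11,24,25,23],
   Sub 162 [1,2,3,4,5,6,7,8,9,10,11,12,13,14,15,16,17,18,19,20,21,22,23,24,25,26,27]]),
   ([[2,7,11],[3,4],[5,6],[8,12],[],[],[23],[9,10],[20,22],[19,21],[24,25],[13,14],[15,16],[17,18],
   [],[],[],[],[],[],[],[],[],[],[]], 7, [Sub 128 [1,7,5,3,2,6,23,11], Sub 128 [1,7,6,3,2,5,23,11],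
   Sub 155 [3,2,1,4,11,7,5,8,9,10,6,12,13,14,15,16,17,18,19,20,21,22,23], Sub 155 [3,2,1,4,11,7,5,
   8,9,10,6,12,13,14,16,15,17,18,19,20,21,22,23], Sub 155 [3,2,1,4,11,7,5,8,9,10,6,12,14,13,17,18,
   15,16,19,20,21,22,23], Sub 155 [3,2,1,4,11,7,5,8,9,10,6,12,14,13,18,17,15,16,19,20,21,22,23],
   Sub 155 [3,2,1,4,11,7,5,12,13,14,6,8,10,9,19,21,20,22,17,15,18,16,23], Sub 155 [3,2,1,4,11,7,5,
   12,13,14,6,8,9,10,20,22,19,21,17,15,18,16,23], Sub 155 [3,2,1,4,11,7,5,12,13,14,6,8,10,9,21,19,
   20,22,17,15,18,16,23], Sub 155 [3,2,1,4,11,7,5,12,13,14,6,8,9,10,22,20,19,21,17,15,18,16,23],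
   Sub 5 [7,1,11,24,2,3,4,25,23], Sub 5 [7,1,11,25,2,3,4,24,23], Sub 163 [1,2,3,4,5,6,7,8,9,10,11,
   12,13,14,15,16,17,18,19,20,21,22,23,24,25,26]]),
   ([[2,7,11],[3,4],[5,6],[8,12],[24],[23],[],[9,10],[20,22],[19,21],[],[13,14],[15,16],[17,18],[],
   [],[],[],[],[],[],[],[],[]], 5, [Sub 1 [3,5,6], Sub 128 [1,2,3,5,7,24,4,11], Sub 128 [1,2,3,5,
   11,24,4,7], Sub 155 [1,2,3,4,6,5,7,8,9,10,11,12,13,14,15,16,17,18,19,20,21,22,24], Sub 155 [1,2,
   3,4,6,5,7,8,9,10,11,12,13,14,16,15,17,18,19,20,21,22,24], Sub 155 [1,2,3,4,6,5,7,8,9,10,11,12,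
   14,13,17,18,15,16,19,20,21,22,24], Sub 155 [1,2,3,4,6,5,7,8,9,10,11,12,14,13,18,17,15,16,19,20,
   21,22,24], Sub 155 [1,2,3,4,6,5,7,12,13,14,11,8,10,9,19,21,20,22,17,15,18,16,24], Sub 155 [1,2,
   3,4,6,5,7,12,13,14,11,8,9,10,20,22,19,21,17,15,18,16,24], Sub 155 [1,2,3,4,6,5,7,12,13,14,11,8,
   10,9,21,19,20,22,17,15,18,16,24], Sub 155 [1,2,3,4,6,5,7,12,13,14,11,8,9,10,22,20,19,21,17,15,
   18,16,24], Sub 6 [6,3,5,23,2,1,4,24], Sub 164 [3,2,1,4,7,11,6,8,9,10,5,12,13,14,15,16,17,18,19,
   20,21,22,23,24,25]]),
   ([[2,7,11],[3,4],[5,6],[8,12],[],[23],[],[9,10],[20,22],[19,21],[],[13,14],[15,16],[17,18],[],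
   [],[],[],[],[],[],[],[]], 5, [Sub 1 [3,5,6], Sub 129 [7,1,2,3,5,6,11], Sub 129 [11,1,2,3,5,6,7],
   Sub 156 [1,2,3,4,6,5,7,8,9,10,11,12,13,14,15,16,17,18,19,20,21,22], Sub 156 [1,2,3,4,6,5,7,8,9,
   10,11,12,13,14,16,15,17,18,19,20,21,22], Sub 156 [1,2,3,4,6,5,7,8,9,10,11,12,14,13,17,18,15,16,
   19,20,21,22], Sub 156 [1,2,3,4,6,5,7,8,9,10,11,12,14,13,18,17,15,16,19,20,21,22], Sub 156 [1,2,
   3,4,6,5,7,12,13,14,11,8,10,9,19,21,20,22,17,15,18,16], Sub 156 [1,2,3,4,6,5,7,12,13,14,11,8,9,
   10,20,22,19,21,17,15,18,16], Sub 156 [1,2,3,4,6,5,7,12,13,14,11,8,10,9,21,19,20,22,17,15,18,16],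
   Sub 156 [1,2,3,4,6,5,7,12,13,14,11,8,9,10,22,20,19,21,17,15,18,16], Sub 7 [5,3,6,23,2,1,4],
   Sub 165 [1,2,3,4,5,6,7,8,9,10,11,12,13,14,15,16,17,18,19,20,21,22,23,24]])]"

text \<open>Numbers 167 to 187. These patterns are trees: read backwards, they grow from a single
  edge, number 187, through a path and a claw. An edge that closes a short cycle in such a tree
  falls under one of the earlier stages.\<close>

definition steps12 :: "(nat list list \<times> nat \<times> leaf list) list" where
  "steps12 = [
   ([[2,7,11],[3,4],[5,6],[8,12],[],[],[],[9,10],[20,22],[19,21],[],[13,14],[15,16],[17,18],[],[],
   [],[],[],[],[],[]], 6, [Sub 1 [3,5,6], Sub 129 [7,1,2,3,6,5,11], Sub 129 [11,1,2,3,6,5,7],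
   Sub 156 [1,2,3,4,5,6,7,8,9,10,11,12,13,14,15,16,17,18,19,20,21,22], Sub 156 [1,2,3,4,5,6,7,8,9,
   10,11,12,13,14,16,15,17,18,19,20,21,22], Sub 156 [1,2,3,4,5,6,7,8,9,10,11,12,14,13,17,18,15,16,
   19,20,21,22], Sub 156 [1,2,3,4,5,6,7,8,9,10,11,12,14,13,18,17,15,16,19,20,21,22], Sub 156 [1,2,
   3,4,5,6,7,12,13,14,11,8,10,9,19,21,20,22,17,15,18,16], Sub 156 [1,2,3,4,5,6,7,12,13,14,11,8,9,
   10,20,22,19,21,17,15,18,16], Sub 156 [1,2,3,4,5,6,7,12,13,14,11,8,10,9,21,19,20,22,17,15,18,16],
   Sub 156 [1,2,3,4,5,6,7,12,13,14,11,8,9,10,22,20,19,21,17,15,18,16], Sub 166 [1,2,3,4,5,6,7,8,9,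
   10,11,12,13,14,15,16,17,18,19,20,21,22,23]]),
   ([[2,7,11],[3,4],[5,6],[8,12],[],[],[],[9,10],[20],[19,21],[],[13,14],[15,16],[17,18],[],[],[],
   [],[],[],[]], 9, [Sub 83 [13,1,2,4,12,8,9,3,14,10,5,6,20], Sub 83 [13,1,2,4,12,8,9,3,14,10,6,5,
   20], Sub 83 [13,3,2,4,12,8,9,1,14,10,7,11,20], Sub 83 [13,3,2,4,12,8,9,1,14,10,11,7,20],
   Sub 83 [1,10,8,4,2,12,13,9,3,14,15,20,16], Sub 83 [1,10,8,4,2,12,13,9,3,14,16,20,15], Sub 83 [1,
   10,8,4,2,12,14,9,3,13,17,20,18], Sub 83 [1,10,8,4,2,12,14,9,3,13,18,20,17], Sub 5 [9,8,10,19,4,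
   2,12,21,20], Sub 5 [9,8,10,21,4,2,12,19,20], Sub 167 [1,2,3,4,5,6,7,8,9,10,11,12,13,14,15,16,17,
   18,19,20,21,22]]),
   ([[2,7,11],[3,4],[5,6],[8,12],[],[],[],[9,10],[20],[19],[],[13,14],[15,16],[17,18],[],[],[],[],
   [],[]], 10, [Sub 83 [13,1,2,4,12,8,10,3,14,9,5,6,19], Sub 83 [13,1,2,4,12,8,10,3,14,9,6,5,19],
   Sub 83 [13,3,2,4,12,8,10,1,14,9,7,11,19], Sub 1 [8,9,10], Sub 83 [13,3,2,4,12,8,10,1,14,9,11,7,
   19], Sub 83 [1,9,8,4,2,12,13,10,3,14,15,19,16], Sub 83 [1,9,8,4,2,12,13,10,3,14,16,19,15],
   Sub 83 [1,9,8,4,2,12,14,10,3,13,17,19,18], Sub 83 [1,9,8,4,2,12,14,10,3,13,18,19,17], Sub 6 [9,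
   8,10,20,4,2,12,19], Sub 168 [1,2,3,4,5,6,7,8,9,10,11,12,13,14,15,16,17,18,19,20,21]]),
   ([[2,7,11],[3,4],[5,6],[8,12],[],[],[],[9,10],[],[19],[],[13,14],[15,16],[17,18],[],[],[],[],
   []], 9, [Sub 131 [1,2,3,4,5,6,12,13,14,8,9,10], Sub 131 [1,2,3,4,6,5,12,13,14,8,9,10],
   Sub 131 [3,2,1,4,7,11,12,13,14,8,9,10], Sub 1 [8,9,10], Sub 131 [3,2,1,4,11,7,12,13,14,8,9,10],
   Sub 131 [2,4,8,12,9,10,14,17,18,13,15,16], Sub 131 [2,4,8,12,9,10,14,17,18,13,16,15],
   Sub 131 [2,4,8,12,9,10,13,15,16,14,17,18], Sub 131 [2,4,8,12,9,10,13,15,16,14,18,17], Sub 7 [9,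
   8,10,19,4,2,12], Sub 169 [1,2,3,4,5,6,7,8,9,10,11,12,13,14,15,16,17,18,19,20]]),
   ([[2,7,11],[3,4],[5,6],[8,12],[],[],[],[9,10],[],[],[],[13,14],[15,16],[17,18],[],[],[],[]], 10,
   [Sub 131 [1,2,3,4,5,6,12,13,14,8,10,9], Sub 131 [1,2,3,4,6,5,12,13,14,8,10,9], Sub 131 [3,2,1,4,
   7,11,12,13,14,8,10,9], Sub 1 [8,9,10], Sub 131 [3,2,1,4,11,7,12,13,14,8,10,9], Sub 131 [2,4,8,
   12,10,9,14,17,18,13,15,16], Sub 131 [2,4,8,12,10,9,14,17,18,13,16,15], Sub 131 [2,4,8,12,10,9,
   13,15,16,14,17,18], Sub 131 [2,4,8,12,10,9,13,15,16,14,18,17], Sub 170 [1,2,3,4,5,6,7,8,9,10,11,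
   12,13,14,15,16,17,18,19]]),
   ([[2,7,11],[3,4],[5,6],[8,12],[],[],[],[9,10],[],[],[],[13,14],[15,16],[17],[],[],[]], 14,
   [Sub 83 [9,1,2,4,8,12,14,3,10,13,5,6,17], Sub 83 [9,1,2,4,8,12,14,3,10,13,6,5,17], Sub 83 [9,3,
   2,4,8,12,14,1,10,13,7,11,17], Sub 128 [4,8,9,14,12,17,10,2], Sub 128 [4,8,10,14,12,17,9,2],
   Sub 83 [9,3,2,4,8,12,14,1,10,13,11,7,17], Sub 5 [13,12,14,15,4,2,8,17,16], Sub 5 [13,12,14,16,4,
   2,8,17,15], Sub 171 [1,2,3,4,5,6,7,8,9,10,11,12,13,14,15,16,17,18]]),
   ([[2,7,11],[3,4],[5,6],[8,12],[],[],[],[9,10],[],[],[],[13,14],[15,16],[],[],[]], 14,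
   [Sub 131 [1,2,3,4,5,6,8,9,10,12,14,13], Sub 131 [1,2,3,4,6,5,8,9,10,12,14,13], Sub 131 [3,2,1,4,
   7,11,8,9,10,12,14,13], Sub 129 [9,8,4,12,14,13,10], Sub 129 [10,8,4,12,14,13,9], Sub 131 [3,2,1,
   4,11,7,8,9,10,12,14,13], Sub 6 [14,12,13,15,4,2,8,16], Sub 6 [14,12,13,16,4,2,8,15], Sub 172 [1,
   2,3,4,5,6,7,8,9,10,11,12,13,14,15,16,17]]),
   ([[2,7,11],[3,4],[5,6],[8,12],[],[],[],[9,10],[],[],[],[13,14],[15],[],[]], 13, [Sub 83 [9,1,2,
   4,8,12,13,3,10,14,5,6,15], Sub 83 [9,1,2,4,8,12,13,3,10,14,6,5,15], Sub 83 [9,3,2,4,8,12,13,1,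
   10,14,7,11,15], Sub 128 [4,8,9,13,12,15,10,2], Sub 128 [4,8,10,13,12,15,9,2], Sub 83 [9,3,2,4,8,
   12,13,1,10,14,11,7,15], Sub 1 [12,13,14], Sub 173 [1,2,3,4,5,6,7,8,9,10,11,12,13,14,15,16]]),
   ([[2,7,11],[3,4],[5,6],[8,12],[],[],[],[9,10],[],[],[],[13,14],[],[]], 13, [Sub 131 [1,2,3,4,5,
   6,8,9,10,12,13,14], Sub 131 [1,2,3,4,6,5,8,9,10,12,13,14], Sub 131 [3,2,1,4,7,11,8,9,10,12,13,
   14], Sub 129 [9,8,4,12,13,14,10], Sub 129 [10,8,4,12,13,14,9], Sub 131 [3,2,1,4,11,7,8,9,10,12,
   13,14], Sub 1 [12,13,14], Sub 174 [1,2,3,4,5,6,7,8,9,10,11,12,13,14,15]]),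
   ([[2,7,11],[3,4],[5,6],[8,12],[],[],[],[9,10],[],[],[],[13],[]], 12, [Sub 128 [2,3,5,12,4,13,6,
   1], Sub 128 [2,3,6,12,4,13,5,1], Sub 128 [1,2,4,12,7,13,3,11], Sub 5 [8,4,12,9,2,1,3,13,10],
   Sub 5 [8,4,12,10,2,1,3,13,9], Sub 128 [1,2,4,12,11,13,3,7], Sub 175 [1,2,3,4,5,6,7,8,9,10,11,12,
   13,14]]),
   ([[2,7,11],[3,4],[5,6],[8,12],[],[],[],[9,10],[],[],[],[]], 12, [Sub 129 [5,3,2,4,12,8,6],
   Sub 129 [6,3,2,4,12,8,5], Sub 129 [7,1,2,4,12,8,11], Sub 6 [12,4,8,9,2,1,3,10], Sub 6 [12,4,8,
   10,2,1,3,9], Sub 129 [11,1,2,4,12,8,7], Sub 176 [1,2,3,4,5,6,7,8,9,10,11,12,13]]),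
   ([[2,7,11],[3,4],[5,6],[8],[],[],[],[9,10],[],[],[]], 4, [Sub 5 [3,2,4,5,1,7,11,8,6], Sub 5 [3,
   2,4,6,1,7,11,8,5], Sub 5 [1,2,4,7,3,5,6,8,11], Sub 1 [4,8,9], Sub 1 [4,8,10], Sub 5 [1,2,4,11,3,
   5,6,8,7], Sub 177 [1,2,3,4,5,6,7,8,9,10,11,12]]),
   ([[2,7],[3,4],[5,6],[8],[],[],[],[9,10],[],[]], 1, [Sub 1 [1,2,4], Sub 8 [1,2,3,5,4,8],
   Sub 8 [1,2,3,6,4,8], Sub 128 [1,2,4,8,9,10,3,7], Sub 128 [1,2,4,8,10,9,3,7], Sub 178 [1,2,3,4,5,
   6,7,8,9,10,11]]),
   ([[2,7],[3,4],[5,6],[8],[],[],[],[9],[]], 8, [Sub 6 [4,2,1,8,3,5,6,7], Sub 128 [2,3,5,8,4,9,6,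
   1], Sub 128 [2,3,6,8,4,9,5,1], Sub 129 [1,2,4,8,7,9,3], Sub 179 [1,2,3,4,5,6,7,8,9,10]]),
   ([[2,7],[3,4],[5,6],[8],[],[],[],[]], 8, [Sub 6 [4,2,1,8,3,5,6,7], Sub 130 [8,5,3,2,4,1],
   Sub 130 [8,6,3,2,4,1], Sub 130 [8,7,1,2,4,3], Sub 180 [1,2,3,4,5,6,7,8,9]]),
   ([[2,7],[3,4],[5,6],[],[],[],[]], 4, [Sub 1 [1,2,4], Sub 8 [3,2,4,5,1,7], Sub 8 [3,2,4,6,1,7],
   Sub 7 [1,2,4,7,3,5,6], Sub 181 [1,2,3,4,5,6,7,8]]),
   ([[2],[3,4],[5,6],[],[],[]], 1, [Sub 1 [1,2,4], Sub 9 [1,2,3,5,4], Sub 9 [1,2,3,6,4],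
   Sub 182 [1,2,3,4,5,6,7]]),
   ([[2],[3,4],[5],[],[]], 3, [Sub 1 [1,2,3], Sub 1 [2,3,4], Sub 183 [1,2,3,4,5,6]]),
   ([[2],[3,4],[],[]], 3, [Sub 1 [1,2,3], Sub 1 [2,3,4], Sub 184 [1,2,3,4,5]]),
   ([[2],[3],[]], 2, [Sub 185 [1,2,3,4]]),
   ([[2],[]], 2, [Sub 186 [1,2,3]])]"

definition steps :: "(nat list list \<times> nat \<times> leaf list) list" where
  "steps = steps1 @ steps2 @ steps3 @ steps4 @ steps5 @ steps6 @ steps7 @ steps8 @ steps9 @ steps10 @ steps11 @ steps12"

text \<open>The key is 4, the first one left free by \<open>start\<close>. The check is evaluated by
  rewriting with proved equations.\<close>

lemma steps_ok: "check start (num.Bit0 (num.Bit0 num.One)) steps"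
  by code_simp

lemma last_step: "fst (last steps) = [[2], []]" "steps \<noteq> []"
  by code_simp+

section \<open>The theorem\<close>

text \<open>The root of the search is a single edge, which every cubic graph contains. Its entry
  forces one of the initial patterns; the triangle is impossible, and the other two are closed and
  hence all of \<open>G\<close>.\<close>

lemma connected_cubic:
  assumes G: "is_graph G" "regular 3 G" "connected G" "triangle_free G" "nu G \<le> 0"
    and nonneg: "\<And>J. subgraph J G \<Longrightarrow> nverts J < nverts G \<Longrightarrow> nu J \<ge> 0"
  shows "G \<cong> twoC7 \<or> G \<cong> W5"
proof -
  interpret tight_cubic G
    using G closed_nbhd_ineq[OF G(1,2,5) _ nonneg] by unfold_locales
  obtain x where x: "x \<in> verts G" using G(1) by (auto simp: is_graph_def)
  then have "nbrs G x \<noteq> {}" using card_nbrs by fastforce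
  then obtain y where y: "{x, y} \<in> edges G" by (auto simp: nbrs_def)
  \<comment> \<open>The edge has only the labels 1 and 2, so all labels other than 1 may go to
    \<open>y\<close>; injectivity is required just on these two.\<close>
  let ?\<phi> = "\<lambda>k. if k = num.One then x else y"
  have "map nums [[2], []] = [[num.Bit0 num.One], []]" by code_simp
  then have "occurs ?\<phi> (map nums [[2], []]) G"
    using y edge_verts[OF G(1) y] by (auto simp: occurs_def inj_on_def)
  moreover have "(fst (last steps), fst (snd (last steps)), snd (snd (last steps))) \<in> set steps"
    using last_in_set[OF last_step(2)] by simp
  then have "([[2], []], fst (snd (last steps)), snd (snd (last steps))) \<in> set steps"
    unfolding last_step(1) .
  ultimately obtain j \<psi> where occ: "occurs \<psi> (fetch C3_pattern j start) G"
    using check_sound[OF steps_ok] by blast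
  consider "fetch C3_pattern j start = C3_pattern" | "fetch C3_pattern j start = twoC7_pattern"
    | "fetch C3_pattern j start = W5_pattern"
    using fetch_start[of j] by blast
  then show ?thesis
    using occ not_occurs_C3[OF G(4), of \<psi>] occurs_twoC7[OF G(1-3), of \<psi>]
      occurs_W5[OF G(1-3), of \<psi>]
    by cases simp_all
qed

theorem mainTheorem2:
  fixes G C :: "'a graph"
  assumes "is_graph G" and "triangle_free G"
    and "\<And>J :: nat graph.
      is_graph J \<Longrightarrow> triangle_free J \<Longrightarrow>
      nverts J < nverts G \<or> (nverts J = nverts G \<and> nedges J < nedges G) \<Longrightarrow>
      nu J \<ge> 0 \<and> (connected J \<and> nu J = 0 \<longrightarrow> (\<exists>H\<in>family. J \<cong> H))"
    and "nu G \<le> 0"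
    and "component C G" and "regular 3 C"
  shows "C \<cong> twoC7 \<or> C \<cong> W5"
proof -
  have sub: "subgraph C G" and con: "connected C" using assms(5) by (simp_all add: component_def)
  have C: "is_graph C" using sub by (rule subgraph_is_graph)
  have smaller: "nu J \<ge> 0" "connected J \<Longrightarrow> nu J = 0 \<Longrightarrow> \<exists>H\<in>family. J \<cong> H"
    if J: "subgraph J G" "nverts J < nverts G" for J :: "'a graph"
  proof -
    have gJ: "is_graph J" using J(1) by (rule subgraph_is_graph)
    obtain f :: "'a \<Rightarrow> nat" where f: "inj_on f (verts J)" using gJ by (rule nat_relabelling)
    have "nu (relabel f J) \<ge> 0 \<and>
        (connected (relabel f J) \<and> nu (relabel f J) = 0 \<longrightarrow> (\<exists>H\<in>family. relabel f J \<cong> H))"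
      using J(2) by (intro assms(3) relabel_is_graph triangle_free_relabel gJ f
          triangle_free_subgraph[OF assms(2) J(1)]) (simp add: nverts_relabel[OF f])
    then show "nu J \<ge> 0" "connected J \<Longrightarrow> nu J = 0 \<Longrightarrow> \<exists>H\<in>family. J \<cong> H"
      using nu_relabel[OF gJ f] connected_relabel[of J f] isomorphic_trans[OF relabel_isomorphic[OF gJ f]]
      by auto
  qed
  show ?thesis
  proof (cases "verts C = verts G")
    case True
    then have "C = G" by (rule component_eq[OF assms(1,5)])
    then show ?thesis
      using connected_cubic[OF assms(1) _ _ assms(2,4) smaller(1)] assms(6) con by simp
  next
    case False
    have vC: "verts C \<subset> verts G" using sub False by (auto simp: subgraph_def)
    then have ne: "verts G - verts C \<noteq> {}" by blast
    let ?D = "induced G (verts G - verts C)"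
    have fin: "finite (verts G)" using assms(1) by (simp add: is_graph_def)
    have D: "subgraph ?D G" using ne by (intro subgraph_induced assms(1)) blast
    have "verts ?D \<subset> verts G"
      using C vC by (auto simp: induced_def is_graph_def)
    then have "nu ?D \<ge> 0" using D fin by (intro smaller(1)) (auto simp: nverts_def psubset_card_mono)
    moreover have lt: "nverts C < nverts G" using vC fin by (simp add: nverts_def psubset_card_mono)
    then have "nu C \<ge> 0" by (rule smaller(1)[OF sub])
    ultimately have "nu C = 0" using nu_component[OF assms(1,5) ne] assms(4) by linarith
    then obtain H where "H \<in> family" "C \<cong> H" using smaller(2)[OF sub lt con] by blast
    then show ?thesis using cubic_family[OF C assms(6)] by blast
  qed
qed

end
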